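(* Let $\mathbb F$ be a field of characteristic $0$, $A=\mathbb F[x_i]_{i\in\mathcal I}=S(V)$, where $V$ is the vector space with basis $\{x_i\}_{i\in\mathcal I}$, let $\{\cdot,\cdot\}$ be any Poisson bracket on $A$ and $X_{ij}=\{x_i,x_j\}$. Then the formula $$\begin{aligned} \pi_\star=\pi&+\frac h2X_{ij}\partial^i\otimes\partial^j+\frac{h^2}{24}\Big[2X_{ij}^lX_{lk}(\partial^i\otimes\partial^{jk}+\partial^{jk}\otimes\partial^i)+3X_{ij}X_{kl}\partial^{ik}\otimes\partial^{jl}\Big]\\ &+\frac{h^3}{48}\Big[2X_{ij}X_{kl}^iX_{mn}^{jk}(\partial^n\otimes\partial^{lm}-\partial^{lm}\otimes\partial^n)+X_{ij}X_{kl}X_{mn}\partial^{ikm}\otimes\partial^{jln}\\ &\qquad+X_{lm}^kX_{jn}^lX_{ki}(\partial^{mn}\otimes\partial^{ij}-\partial^{ij}\otimes\partial^{mn})+X_{mn}^{kl}X_{lj}X_{ki}(\partial^m\otimes\partial^{nij}-\partial^{nij}\otimes\partial^m)\\ &\qquad+2X_{ij}^kX_{kl}X_{mn}(\partial^{jlm}\otimes\partial^{in}-\partial^{in}\otimes\partial^{jlm})\Big] \end{aligned}$$ gives a bracket-exact balanced deformation of $A$ of order $3$.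
   Context: $\pi$ is the product of $A$; a Poisson bracket is an antisymmetric biderivation satisfying the Jacobi identity. Repeated indices are summed over $\mathcal I$. Superscripts denote partial derivatives: $\partial^i=\partial/\partial x_i$, $\partial^{ij\cdots}=\partial^i\partial^j\cdots$, $X_{ij}^{kl\cdots}=\partial^{kl\cdots}X_{ij}$; and $(p\,\partial^I\otimes\partial^J)(f,g)=p\,\partial^I(f)\,\partial^J(g)$. A third order deformation of $A$ is an $\mathbb F[[h]]$-bilinear product $\star=\pi+h\pi_1+h^2\pi_2+h^3\pi_3$ (with $\mathbb F$-bilinear $\pi_i:A\times A\to A$) which is associative modulo $h^4$; it is regarded as a product on $A[[h]]/(h^4)$. Put $[p,q]_\star=p\star q-q\star p$. The deformation is bracket-exact if $[x,y]_\star=h\{x,y\}$ (modulo $h^4$) for all $x,y\in V$. The $\star$-symmetrization is the $\mathbb F[[h]]$-linear map $\sigma_\star$ of $A[[h]]/(h^4)$ with $\sigma_\star(\prod_{i=1}^na_i)=\frac1{n!}\sum_{p\in S_n}a_{p(1)}\star\cdots\star a_{p(n)}$ for $a_i\in V$ (the empty $\star$-product being the unit of $\star$). $\star$ is $s$-balanced if $\sigma_\star$ is the identity on elements of $S(V)$ of degree $\le s$, and balanced if it is $s$-balanced, where $s$ (possibly infinite) is the supremum of the degrees of all coefficients (in powers of $h$) of $[x,y]_\star$, $x,y\in V$. *)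

theory Defs
  imports
    "HOL-Library.Poly_Mapping"
    "HOL-Library.Extended_Nat"
    "HOL-Combinatorics.Permutations"
    "HOL-Computational_Algebra.Formal_Power_Series"
begin

section \<open>The polynomial algebra\<close>

text \<open>
  \<open>A = F[x\<^sub>i] = S(V)\<close> is the monoid algebra of the monoid of exponent vectors \<open>'i \<Rightarrow>\<^sub>0 nat\<close>: a
  polynomial maps exponent vectors to coefficients, and multiplication is convolution. The index
  type \<open>'i\<close> may be infinite.
\<close>

type_synonym ('i, 'k) mpol = "('i \<Rightarrow>\<^sub>0 nat) \<Rightarrow>\<^sub>0 'k"

definition const :: "'k::zero \<Rightarrow> ('i, 'k) mpol" where
  "const c = Poly_Mapping.single 0 c"

definition var :: "'i \<Rightarrow> ('i, 'k::zero_neq_one) mpol" where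
  "var i = Poly_Mapping.single (Poly_Mapping.single i 1) 1"

definition V :: "('i, 'k::field_char_0) mpol set" where
  "V = {(\<Sum>i\<in>S. const (c i) * var i) | S c. finite S}"

definition mon_degree :: "('i \<Rightarrow>\<^sub>0 nat) \<Rightarrow> nat" where
  "mon_degree m = (\<Sum>i\<in>Poly_Mapping.keys m. Poly_Mapping.lookup m i)"

text \<open>Total degree, with the convention that the zero polynomial has degree 0.\<close>

definition tot_degree :: "('i, 'k::zero) mpol \<Rightarrow> nat" where
  "tot_degree f = Max (insert 0 (mon_degree ` Poly_Mapping.keys f))"

text \<open>
  The subtraction of exponent vectors is truncated, but the terms affected by this carry the
  coefficient 0.
\<close>

definition pderiv1 :: "'i \<Rightarrow> ('i, 'k::semiring_1) mpol \<Rightarrow> ('i, 'k) mpol" where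
  "pderiv1 i f = (\<Sum>m\<in>Poly_Mapping.keys f.
     Poly_Mapping.single (m - Poly_Mapping.single i 1)
       (of_nat (Poly_Mapping.lookup m i) * Poly_Mapping.lookup f m))"

definition D :: "'i list \<Rightarrow> ('i, 'k::semiring_1) mpol \<Rightarrow> ('i, 'k) mpol" where
  "D I f = foldr pderiv1 I f"

definition bilin ::
  "(('i, 'k::field_char_0) mpol \<Rightarrow> ('i, 'k) mpol \<Rightarrow> ('i, 'k) mpol) \<Rightarrow> bool" where
  "bilin p \<longleftrightarrow>
     (\<forall>f g h. p (f + g) h = p f h + p g h) \<and>
     (\<forall>f g h. p f (g + h) = p f g + p f h) \<and>
     (\<forall>c f g. p (const c * f) g = const c * p f g) \<and>
     (\<forall>c f g. p f (const c * g) = const c * p f g)"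

definition poisson_bracket ::
  "(('i, 'k::field_char_0) mpol \<Rightarrow> ('i, 'k) mpol \<Rightarrow> ('i, 'k) mpol) \<Rightarrow> bool" where
  "poisson_bracket B \<longleftrightarrow>
     bilin B \<and>
     (\<forall>f g. B f g = - B g f) \<and>
     (\<forall>f g h. B (f * g) h = f * B g h + B f h * g) \<and>
     (\<forall>f g h. B f (g * h) = B f g * h + g * B f h) \<and>
     (\<forall>f g h. B f (B g h) + B g (B h f) + B h (B f g) = 0)"


section \<open>Third order deformations\<close>

text \<open>
  Elements of \<open>A[[h]]/(h\<^sup>4)\<close> are represented by elements of \<open>A[[h]]\<close>, and equality in the quotient
  by congruence modulo \<open>h\<^sup>4\<close>; \<open>h\<close> is \<^const>\<open>fps_X\<close>. Elements of \<open>A\<close> are embedded by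
  \<^const>\<open>fps_const\<close>, scalars from \<open>F[[h]]\<close> by \<open>scal\<close>.
\<close>

definition eq_h4 :: "('i, 'k::field_char_0) mpol fps \<Rightarrow> ('i, 'k) mpol fps \<Rightarrow> bool"
    (infix \<open>\<approx>\<close> 50) where
  "F \<approx> G \<longleftrightarrow> fps_X ^ 4 dvd F - G"

definition scal :: "'k::field_char_0 fps \<Rightarrow> ('i, 'k) mpol fps" where
  "scal c = Abs_fps (\<lambda>n. const (fps_nth c n))"

text \<open>The \<open>F[[h]]\<close>-bilinear extension of a bilinear map on \<open>A\<close>.\<close>

definition ext ::
  "(('i, 'k::field_char_0) mpol \<Rightarrow> ('i, 'k) mpol \<Rightarrow> ('i, 'k) mpol) \<Rightarrow>
   ('i, 'k) mpol fps \<Rightarrow> ('i, 'k) mpol fps \<Rightarrow> ('i, 'k) mpol fps" where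
  "ext p F G = Abs_fps (\<lambda>n. \<Sum>i\<le>n. p (fps_nth F i) (fps_nth G (n - i)))"

definition star ::
  "(('i, 'k::field_char_0) mpol \<Rightarrow> ('i, 'k) mpol \<Rightarrow> ('i, 'k) mpol) \<Rightarrow>
   (('i, 'k) mpol \<Rightarrow> ('i, 'k) mpol \<Rightarrow> ('i, 'k) mpol) \<Rightarrow>
   (('i, 'k) mpol \<Rightarrow> ('i, 'k) mpol \<Rightarrow> ('i, 'k) mpol) \<Rightarrow>
   ('i, 'k) mpol fps \<Rightarrow> ('i, 'k) mpol fps \<Rightarrow> ('i, 'k) mpol fps" where
  "star p1 p2 p3 F G =
     ext (*) F G + fps_X * ext p1 F G + fps_X ^ 2 * ext p2 F G + fps_X ^ 3 * ext p3 F G"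

definition third_order_deformation ::
  "(('i, 'k::field_char_0) mpol \<Rightarrow> ('i, 'k) mpol \<Rightarrow> ('i, 'k) mpol) \<Rightarrow>
   (('i, 'k) mpol \<Rightarrow> ('i, 'k) mpol \<Rightarrow> ('i, 'k) mpol) \<Rightarrow>
   (('i, 'k) mpol \<Rightarrow> ('i, 'k) mpol \<Rightarrow> ('i, 'k) mpol) \<Rightarrow> bool" where
  "third_order_deformation p1 p2 p3 \<longleftrightarrow>
     bilin p1 \<and> bilin p2 \<and> bilin p3 \<and>
     (\<forall>F G H. star p1 p2 p3 (star p1 p2 p3 F G) H \<approx> star p1 p2 p3 F (star p1 p2 p3 G H))"

text \<open>In what follows \<open>S\<close> is the product \<open>\<star>\<close> on \<open>A[[h]]\<close>.\<close>

definition star_commutator ::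
  "(('i, 'k::field_char_0) mpol fps \<Rightarrow> ('i, 'k) mpol fps \<Rightarrow> ('i, 'k) mpol fps) \<Rightarrow>
   ('i, 'k) mpol fps \<Rightarrow> ('i, 'k) mpol fps \<Rightarrow> ('i, 'k) mpol fps" where
  "star_commutator S F G = S F G - S G F"

definition bracket_exact ::
  "(('i, 'k::field_char_0) mpol \<Rightarrow> ('i, 'k) mpol \<Rightarrow> ('i, 'k) mpol) \<Rightarrow>
   (('i, 'k) mpol fps \<Rightarrow> ('i, 'k) mpol fps \<Rightarrow> ('i, 'k) mpol fps) \<Rightarrow> bool" where
  "bracket_exact B S \<longleftrightarrow>
     (\<forall>x\<in>V. \<forall>y\<in>V.
        star_commutator S (fps_const x) (fps_const y) \<approx> fps_X * fps_const (B x y))"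

definition star_unit ::
  "(('i, 'k::field_char_0) mpol fps \<Rightarrow> ('i, 'k) mpol fps \<Rightarrow> ('i, 'k) mpol fps) \<Rightarrow>
   ('i, 'k) mpol fps \<Rightarrow> bool" where
  "star_unit S u \<longleftrightarrow> (\<forall>F. S u F \<approx> F \<and> S F u \<approx> F)"

text \<open>
  \<open>\<sigma>\<close> represents the \<open>\<star>\<close>-symmetrization map: it is \<open>F[[h]]\<close>-linear modulo \<open>h\<^sup>4\<close> (hence, by
  linearity over \<open>h\<^sup>4\<close>, well defined on \<open>A[[h]]/(h\<^sup>4)\<close>), and takes the prescribed values on all
  products \<open>a\<^sub>0 \<cdots> a\<^sub>n\<^sub>-\<^sub>1\<close> of elements of \<open>V\<close>. For a third order deformation these conditions
  determine \<open>\<sigma>\<close> modulo \<open>h\<^sup>4\<close>, because such products span \<open>A\<close>.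
  The unit \<open>u\<close> closes the iterated product \<open>a \<star> (b \<star> (\<cdots> \<star> u))\<close>, so the empty product is \<open>u\<close>.
\<close>

definition star_symmetrization ::
  "(('i, 'k::field_char_0) mpol fps \<Rightarrow> ('i, 'k) mpol fps \<Rightarrow> ('i, 'k) mpol fps) \<Rightarrow>
   (('i, 'k) mpol fps \<Rightarrow> ('i, 'k) mpol fps) \<Rightarrow> bool" where
  "star_symmetrization S \<sigma> \<longleftrightarrow>
     (\<forall>F G. \<sigma> (F + G) \<approx> \<sigma> F + \<sigma> G) \<and>
     (\<forall>c F. \<sigma> (scal c * F) \<approx> scal c * \<sigma> F) \<and>
     (\<exists>u. star_unit S u \<and>
       (\<forall>as. set as \<subseteq> V \<longrightarrow>
         \<sigma> (fps_const (prod_list as)) \<approx>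
           scal (fps_const (1 / fact (length as))) *
           (\<Sum>p | p permutes {..<length as}.
              foldr S (map (\<lambda>i. fps_const (as ! p i)) [0..<length as]) u)))"

definition s_balanced ::
  "enat \<Rightarrow> (('i, 'k::field_char_0) mpol fps \<Rightarrow> ('i, 'k) mpol fps \<Rightarrow> ('i, 'k) mpol fps) \<Rightarrow> bool"
where
  "s_balanced s S \<longleftrightarrow>
     (\<exists>\<sigma>. star_symmetrization S \<sigma> \<and>
       (\<forall>f. enat (tot_degree f) \<le> s \<longrightarrow> \<sigma> (fps_const f) \<approx> fps_const f))"

text \<open>Only the coefficients of \<open>h\<^sup>0, \<dots>, h\<^sup>3\<close> are meaningful modulo \<open>h\<^sup>4\<close>.\<close>

definition commutator_degree ::
  "(('i, 'k::field_char_0) mpol fps \<Rightarrow> ('i, 'k) mpol fps \<Rightarrow> ('i, 'k) mpol fps) \<Rightarrow> enat" where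
  "commutator_degree S =
     Sup {enat (tot_degree (fps_nth (star_commutator S (fps_const x) (fps_const y)) n)) |
          x y n. x \<in> V \<and> y \<in> V \<and> n < 4}"

definition balanced ::
  "(('i, 'k::field_char_0) mpol fps \<Rightarrow> ('i, 'k) mpol fps \<Rightarrow> ('i, 'k) mpol fps) \<Rightarrow> bool" where
  "balanced S \<longleftrightarrow> s_balanced (commutator_degree S) S"


section \<open>The universal formula\<close>

text \<open>\<open>X B i j [k, l, \<dots>]\<close> is \<open>\<partial>\<^sup>k\<partial>\<^sup>l\<cdots>{x\<^sub>i, x\<^sub>j}\<close>.\<close>

definition X ::
  "(('i, 'k::field_char_0) mpol \<Rightarrow> ('i, 'k) mpol \<Rightarrow> ('i, 'k) mpol) \<Rightarrow>
   'i \<Rightarrow> 'i \<Rightarrow> 'i list \<Rightarrow> ('i, 'k) mpol" where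
  "X B i j K = D K (B (var i) (var j))"

text \<open>
  The sums below range over tuples of indices. Even if the index type is infinite, only finitely
  many summands are nonzero, so that \<^const>\<open>Sum_any\<close> is the intended sum: the indices of
  derivatives of \<open>f\<close> and \<open>g\<close> are restricted to the finitely many variables of \<open>f\<close> and \<open>g\<close>, and
  every other index occurs as an upper index of some \<open>X\<close> whose lower indices have already been
  restricted to a finite set.
\<close>

definition star_coeff1 ::
  "(('i, 'k::field_char_0) mpol \<Rightarrow> ('i, 'k) mpol \<Rightarrow> ('i, 'k) mpol) \<Rightarrow>
   ('i, 'k) mpol \<Rightarrow> ('i, 'k) mpol \<Rightarrow> ('i, 'k) mpol" where
  "star_coeff1 B f g =
     const (1 / 2) * Sum_any (\<lambda>(i, j). X B i j [] * (D [i] f * D [j] g))"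

definition star_coeff2 ::
  "(('i, 'k::field_char_0) mpol \<Rightarrow> ('i, 'k) mpol \<Rightarrow> ('i, 'k) mpol) \<Rightarrow>
   ('i, 'k) mpol \<Rightarrow> ('i, 'k) mpol \<Rightarrow> ('i, 'k) mpol" where
  "star_coeff2 B f g =
     const (1 / 24) *
      (Sum_any (\<lambda>(i, j, k, l).
         2 * X B i j [l] * X B l k [] * (D [i] f * D [j, k] g + D [j, k] f * D [i] g))
     + Sum_any (\<lambda>(i, j, k, l).
         3 * X B i j [] * X B k l [] * (D [i, k] f * D [j, l] g)))"

definition star_coeff3 ::
  "(('i, 'k::field_char_0) mpol \<Rightarrow> ('i, 'k) mpol \<Rightarrow> ('i, 'k) mpol) \<Rightarrow>
   ('i, 'k) mpol \<Rightarrow> ('i, 'k) mpol \<Rightarrow> ('i, 'k) mpol" where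
  "star_coeff3 B f g =
     const (1 / 48) *
      (Sum_any (\<lambda>(i, j, k, l, m, n).
         2 * X B i j [] * X B k l [i] * X B m n [j, k] *
           (D [n] f * D [l, m] g - D [l, m] f * D [n] g))
     + Sum_any (\<lambda>(i, j, k, l, m, n).
         X B i j [] * X B k l [] * X B m n [] * (D [i, k, m] f * D [j, l, n] g))
     + Sum_any (\<lambda>(i, j, k, l, m, n).
         X B l m [k] * X B j n [l] * X B k i [] *
           (D [m, n] f * D [i, j] g - D [i, j] f * D [m, n] g))
     + Sum_any (\<lambda>(i, j, k, l, m, n).
         X B m n [k, l] * X B l j [] * X B k i [] *
           (D [m] f * D [n, i, j] g - D [n, i, j] f * D [m] g))
     + Sum_any (\<lambda>(i, j, k, l, m, n).
         2 * X B i j [k] * X B k l [] * X B m n [] *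
           (D [j, l, m] f * D [i, n] g - D [i, n] f * D [j, l, m] g)))"

end

theory Submission
  imports Defs "HOL-Combinatorics.Multiset_Permutations"
begin

text \<open>
  Associativity is reduced to triples whose first factor is a variable: the associator satisfies a
  pentagon identity, \<open>A\<close> is generated by the variables under \<open>\<star>\<close> up to higher powers of \<open>h\<close>, and so
  the associator vanishes one power of \<open>h\<close> after the other. For a first factor \<open>x\<^sub>i\<close>, the
  obstruction in degree 3 is expanded in the partial derivatives of the third factor. Its coefficients
  are differential operators in the second factor; symmetrized over the derivatives, those of
  order 1 and 3 cancel, and that of order 2 becomes a derivation, which vanishes on the variables by the
  Jacobi identity. The star product is balanced because \<open>a \<star> a\<^sup>n = a\<^bsup>n+1\<^esup>\<close> for
  \<open>a \<in> V\<close>, which holds by antisymmetry and makes the symmetrization map the identity.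
\<close>

section \<open>Partial derivatives\<close>

text \<open>A variable is a good first factor because its second derivatives vanish. Of
  \<open>star_coeff2 B (var i)\<close> and \<open>star_coeff3 B (var i)\<close> only the terms with
  a single derivative on the first factor survive, and \<open>star_coeff3 B (var i * g) h\<close>
  differs from \<open>var i * star_coeff3 B g h\<close> only by terms in which exactly one
  derivative falls on \<open>var i\<close>. A general first factor would require an expansion in
  derivatives of all three factors. Coefficients may be symmetrized because partial derivatives
  commute. In order two this is essential: before symmetrization, the coefficient of the second
  derivatives is in general itself of order two in the second factor. Powers of \<open>h\<close> are
  gained one at a time because \<open>var i * f\<close> agrees with the star product of
  \<open>var i\<close> and \<open>f\<close> only up to a multiple of \<open>h\<close>, and the
  associator of that correction has to be controlled to one power less. For balancedness, grouping
  permutations by their first factor leaves a sum of terms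
  \<open>p (a k) (\<Prod>j\<in>K - {k}. a j)\<close>, the polarized form of
  \<open>p a (a ^ n)\<close>.\<close>

lemma const_0 [simp]: "const 0 = 0"
  by (simp add: const_def)

lemma const_1 [simp]: "const 1 = 1"
  by (simp add: const_def)

lemma const_mult: "const (a * b) = const a * (const b :: ('i, 'k::comm_semiring_1) mpol)"
  by (simp add: const_def mult_single)

lemma const_of_nat [simp]: "const (of_nat n) = (of_nat n :: ('i, 'k::comm_semiring_1) mpol)"
  by (simp add: const_def)

lemma const_numeral [simp]: "const (numeral n) = (numeral n :: ('i, 'k::comm_semiring_1) mpol)"
  by (simp add: const_def)

text \<open>Lowering the exponent of \<open>i\<close> is truncated and hence not injective, but it
  is injective on exponent vectors containing \<open>i\<close>, and all others carry the factor 0.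
  So at most one summand survives, and additivity and commutation of derivatives become
  coefficientwise identities.\<close>

lemma lookup_pderiv1:
  fixes f :: "('i, 'k::comm_semiring_1) mpol"
  shows "Poly_Mapping.lookup (pderiv1 i f) m =
    of_nat (Suc (Poly_Mapping.lookup m i)) * Poly_Mapping.lookup f (m + Poly_Mapping.single i 1)"
proof -
  let ?e = "Poly_Mapping.single i (1::nat)"
  have split: "m' = m + ?e" if "m' - ?e = m" "Poly_Mapping.lookup m' i \<noteq> 0" for m'
  proof (rule poly_mapping_eqI)
    fix j
    show "Poly_Mapping.lookup m' j = Poly_Mapping.lookup (m + ?e) j"
      using that by (cases "j = i") (auto simp: lookup_add lookup_minus lookup_single)
  qed
  have "Poly_Mapping.lookup (pderiv1 i f) m = (\<Sum>m'\<in>Poly_Mapping.keys f.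
      (of_nat (Poly_Mapping.lookup m' i) * Poly_Mapping.lookup f m' when m' - ?e = m))"
    by (simp add: pderiv1_def lookup_sum lookup_single)
  also have "\<dots> = (\<Sum>m'\<in>Poly_Mapping.keys f. if m' = m + ?e then
      of_nat (Suc (Poly_Mapping.lookup m i)) * Poly_Mapping.lookup f (m + ?e) else 0)"
  proof (rule sum.cong[OF refl])
    fix m' assume "m' \<in> Poly_Mapping.keys f"
    show "(of_nat (Poly_Mapping.lookup m' i) * Poly_Mapping.lookup f m' when m' - ?e = m) =
      (if m' = m + ?e then
       of_nat (Suc (Poly_Mapping.lookup m i)) * Poly_Mapping.lookup f (m + ?e) else 0)"
    proof (cases "m' = m + ?e")
      case True
      then show ?thesis
        by (simp add: lookup_add)
    next
      case False
      then have "Poly_Mapping.lookup m' i = 0 \<or> m' - ?e \<noteq> m"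
        using split by blast
      with False show ?thesis
        by auto
    qed
  qed
  also have "\<dots> = of_nat (Suc (Poly_Mapping.lookup m i)) * Poly_Mapping.lookup f (m + ?e)"
    by (simp add: in_keys_iff)
  finally show ?thesis .
qed

lemma pderiv1_add: "pderiv1 i (f + g) = pderiv1 i f + pderiv1 i (g :: ('i, 'k::comm_semiring_1) mpol)"
  by (rule poly_mapping_eqI) (simp add: lookup_pderiv1 lookup_add algebra_simps)

lemma pderiv1_0 [simp]: "pderiv1 i (0 :: ('i, 'k::comm_semiring_1) mpol) = 0"
  by (rule poly_mapping_eqI) (simp add: lookup_pderiv1)

lemma pderiv1_sum:
  "pderiv1 i (\<Sum>a\<in>A. f a) = (\<Sum>a\<in>A. pderiv1 i (f a :: ('i, 'k::comm_semiring_1) mpol))"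
  by (induction A rule: infinite_finite_induct) (simp_all add: pderiv1_add)

lemma pderiv1_commute:
  "pderiv1 i (pderiv1 j f) = pderiv1 j (pderiv1 i (f :: ('i, 'k::comm_semiring_1) mpol))"
  by (rule poly_mapping_eqI)
     (cases "i = j", simp_all add: lookup_pderiv1 lookup_add lookup_single algebra_simps)

lemma single_decomp_sum: "(f :: ('i, 'k::comm_semiring_1) mpol) =
    (\<Sum>m\<in>Poly_Mapping.keys f. Poly_Mapping.single m (Poly_Mapping.lookup f m))"
  by (rule poly_mapping_eqI) (simp add: lookup_sum lookup_single when_def in_keys_iff)

lemma pderiv1_single:
  "pderiv1 i (Poly_Mapping.single m (c :: 'k::comm_semiring_1)) =
     Poly_Mapping.single (m - Poly_Mapping.single i 1) (of_nat (Poly_Mapping.lookup m i) * c)"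
  by (cases "c = 0") (simp_all add: pderiv1_def)

text \<open>Truncated subtraction commutes with addition of exponent vectors only if
  \<open>i\<close> occurs in the vector that is lowered; otherwise the corresponding summand has
  coefficient 0. Hence the four cases.\<close>

lemma pderiv1_mult_single:
  fixes c d :: "'k::comm_semiring_1"
  shows "pderiv1 i (Poly_Mapping.single m c * Poly_Mapping.single n d) =
    Poly_Mapping.single m c * pderiv1 i (Poly_Mapping.single n d) +
    pderiv1 i (Poly_Mapping.single m c) * Poly_Mapping.single n d"
proof -
  let ?e = "Poly_Mapping.single i (1::nat)"
  have m: "m - ?e + n = m + n - ?e" if "Poly_Mapping.lookup m i \<noteq> 0"
    using that by (intro poly_mapping_eqI) (auto simp: lookup_add lookup_minus lookup_single when_def)
  have n: "m + (n - ?e) = m + n - ?e" if "Poly_Mapping.lookup n i \<noteq> 0"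
    using that by (intro poly_mapping_eqI) (auto simp: lookup_add lookup_minus lookup_single when_def)
  show ?thesis
    using m n
    by (cases "Poly_Mapping.lookup m i = 0"; cases "Poly_Mapping.lookup n i = 0")
       (simp_all add: pderiv1_single mult_single lookup_add algebra_simps flip: single_add)
qed

lemma pderiv1_mult:
  fixes f g :: "('i, 'k::comm_semiring_1) mpol"
  shows "pderiv1 i (f * g) = f * pderiv1 i g + pderiv1 i f * g"
proof -
  have 1: "pderiv1 i (Poly_Mapping.single m c * g) =
      Poly_Mapping.single m c * pderiv1 i g + pderiv1 i (Poly_Mapping.single m c) * g" for m c
    by (subst (1 2 3) single_decomp_sum[of g])
       (simp add: sum_distrib_left pderiv1_sum pderiv1_mult_single sum.distrib)
  show ?thesis
    by (subst (1 2 3) single_decomp_sum[of f])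
       (simp add: sum_distrib_right pderiv1_sum 1 sum.distrib)
qed

lemma pderiv1_const [simp]: "pderiv1 i (const c :: ('i, 'k::comm_semiring_1) mpol) = 0"
  by (simp add: const_def pderiv1_single)

lemma pderiv1_const_mult [simp]:
  "pderiv1 i (const c * f) = const c * pderiv1 i (f :: ('i, 'k::comm_semiring_1) mpol)"
  by (simp add: pderiv1_mult)

lemma pderiv1_1 [simp]: "pderiv1 i (1 :: ('i, 'k::comm_semiring_1) mpol) = 0"
  using pderiv1_const[of i 1] by simp

lemma pderiv1_var: "pderiv1 i (var j :: ('i, 'k::comm_semiring_1) mpol) = (if i = j then 1 else 0)"
  by (auto simp: var_def pderiv1_single lookup_single)

lemma pderiv1_pderiv1_var [simp]: "pderiv1 i (pderiv1 j (var k :: ('i, 'k::comm_semiring_1) mpol)) = 0"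
  by (simp add: pderiv1_var)

text \<open>Occurrence of a variable is measured by derivatives rather than exponent vectors: this
  is exactly what allows a sum weighted by derivatives of \<open>f\<close> to be extended to a
  larger index set or restricted to a smaller one.\<close>

definition vars :: "('i, 'k::semiring_1) mpol \<Rightarrow> 'i set" where
  "vars f = {i. pderiv1 i f \<noteq> 0}"

lemma pderiv1_eq_0: "vars f \<subseteq> S \<Longrightarrow> i \<notin> S \<Longrightarrow> pderiv1 i f = 0"
  by (auto simp: vars_def)

lemma vars_pderiv1: "vars (pderiv1 i (f :: ('i, 'k::comm_semiring_1) mpol)) \<subseteq> vars f"
  by (auto simp: vars_def pderiv1_commute[of _ i])

lemma pderiv1_pderiv1_eq_0:
  "vars f \<subseteq> S \<Longrightarrow> i \<notin> S \<Longrightarrow> pderiv1 i (pderiv1 j (f :: ('i, 'k::comm_semiring_1) mpol)) = 0"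
  by (rule pderiv1_eq_0[OF order.trans[OF vars_pderiv1]])

lemma vars_mult: "vars (f * (g :: ('i, 'k::comm_semiring_1) mpol)) \<subseteq> vars f \<union> vars g"
  by (auto simp: vars_def pderiv1_mult)

lemma vars_add: "vars (f + (g :: ('i, 'k::comm_semiring_1) mpol)) \<subseteq> vars f \<union> vars g"
  by (auto simp: vars_def pderiv1_add)

lemma vars_subset_keys:
  "vars (f :: ('i, 'k::comm_semiring_1) mpol) \<subseteq> (\<Union>m\<in>Poly_Mapping.keys f. Poly_Mapping.keys m)"
proof
  fix i assume i: "i \<in> vars f"
  show "i \<in> (\<Union>m\<in>Poly_Mapping.keys f. Poly_Mapping.keys m)"
  proof (rule ccontr)
    assume "\<not> ?thesis"
    then have "Poly_Mapping.lookup m i = 0" if "m \<in> Poly_Mapping.keys f" for m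
      using that by (auto simp: in_keys_iff)
    then have "pderiv1 i f = 0"
      by (simp add: pderiv1_def)
    with i show False
      by (simp add: vars_def)
  qed
qed

lemma finite_vars [simp]: "finite (vars (f :: ('i, 'k::comm_semiring_1) mpol))"
  by (rule finite_subset[OF vars_subset_keys]) simp

lemma vars_var: "vars (var i :: ('i, 'k::comm_semiring_1) mpol) \<subseteq> {i}"
  by (auto simp: vars_def pderiv1_var split: if_splits)

text \<open>Monomials are built up by multiplying with one variable on the left, the shape to which
  the Leibniz rule and later the pentagon identity apply.\<close>

lemma mpol_induct [case_names const add var]:
  fixes f :: "('i, 'k::comm_semiring_1) mpol"
  assumes const: "\<And>c. Q (const c)"
    and add: "\<And>f g. Q f \<Longrightarrow> Q g \<Longrightarrow> Q (f + g)"
    and var: "\<And>i f. Q f \<Longrightarrow> Q (var i * f)"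
  shows "Q f"
proof -
  have single: "Q (Poly_Mapping.single m c)" for m c
  proof (induction "mon_degree m" arbitrary: m)
    case 0
    then have "m = 0"
      by (intro poly_mapping_eqI) (metis in_keys_iff mon_degree_def finite_keys lookup_zero sum_eq_0_iff)
    then show ?case
      using const[of c] by (simp add: const_def)
  next
    case (Suc n)
    then obtain i where i: "Poly_Mapping.lookup m i \<noteq> 0"
      by (auto simp: mon_degree_def dest!: sym[of "Suc _"] sum_SucD)
    define m' where "m' = m - Poly_Mapping.single i 1"
    have m: "m = Poly_Mapping.single i 1 + m'"
      using i by (intro poly_mapping_eqI)
        (auto simp: m'_def lookup_add lookup_minus lookup_single when_def)
    have "mon_degree m = mon_degree (Poly_Mapping.single i 1) + mon_degree m'"
      unfolding m mon_degree_def by (rule setsum_keys_plus_distrib) auto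
    then have "n = mon_degree m'"
      using Suc(2) by (simp add: mon_degree_def)
    then have "Q (var i * Poly_Mapping.single m' c)"
      by (intro var Suc(1))
    then show ?case
      by (simp add: var_def mult_single m)
  qed
  have "Q (\<Sum>m\<in>M. Poly_Mapping.single m (Poly_Mapping.lookup f m))" if "finite M" for M
    using that
  proof induction
    case empty
    then show ?case
      using const[of 0] by simp
  qed (auto intro: add single)
  then show ?thesis
    by (subst single_decomp_sum) simp
qed

section \<open>Derivations\<close>

text \<open>Vanishing on constants stands for linearity over the field, which then follows from the
  Leibniz rule.\<close>

definition derivation :: "(('i, 'k::field_char_0) mpol \<Rightarrow> ('i, 'k) mpol) \<Rightarrow> bool" where
  "derivation d \<longleftrightarrow> (\<forall>f g. d (f + g) = d f + d g) \<and> (\<forall>f g. d (f * g) = f * d g + d f * g) \<and>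
     (\<forall>c. d (const c) = 0)"

lemma derivation_expand:
  assumes d: "derivation d" and "finite S" "vars f \<subseteq> S"
  shows "d f = (\<Sum>a\<in>S. d (var a) * pderiv1 a f)"
proof -
  define U where "U = S \<union> (\<Union>m\<in>Poly_Mapping.keys f. Poly_Mapping.keys m)"
  have gen: "d g = (\<Sum>a\<in>W. d (var a) * pderiv1 a g)"
    if "finite W" "\<forall>m\<in>Poly_Mapping.keys g. Poly_Mapping.keys m \<subseteq> W" for g W
  proof -
    have "\<exists>W0. finite W0 \<and> (\<forall>W. finite W \<longrightarrow> W0 \<subseteq> W \<longrightarrow> d g = (\<Sum>a\<in>W. d (var a) * pderiv1 a g))"
    proof (induction g rule: mpol_induct)
      case (const c)
      then show ?case
        using d by (auto simp: derivation_def)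
    next
      case (add f g)
      then obtain W1 W2 where "finite W1" "finite W2"
        "\<forall>W. finite W \<longrightarrow> W1 \<subseteq> W \<longrightarrow> d f = (\<Sum>a\<in>W. d (var a) * pderiv1 a f)"
        "\<forall>W. finite W \<longrightarrow> W2 \<subseteq> W \<longrightarrow> d g = (\<Sum>a\<in>W. d (var a) * pderiv1 a g)"
        by blast
      then show ?case
        using d by (intro exI[of _ "W1 \<union> W2"])
          (simp add: derivation_def pderiv1_add sum.distrib distrib_left)
    next
      case (var i f)
      then obtain W0 where W0: "finite W0"
        "\<forall>W. finite W \<longrightarrow> W0 \<subseteq> W \<longrightarrow> d f = (\<Sum>a\<in>W. d (var a) * pderiv1 a f)"
        by blast
      show ?case
      proof (intro exI[of _ "insert i W0"] conjI allI impI)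
        fix W assume W: "finite W" "insert i W0 \<subseteq> W"
        have "(\<Sum>a\<in>W. d (var a) * pderiv1 a (var i * f)) =
            (\<Sum>a\<in>W. var i * (d (var a) * pderiv1 a f)) + (\<Sum>a\<in>W. if a = i then d (var a) * f else 0)"
          unfolding sum.distrib[symmetric]
          by (rule sum.cong) (auto simp: pderiv1_mult pderiv1_var algebra_simps)
        then show "d (var i * f) = (\<Sum>a\<in>W. d (var a) * pderiv1 a (var i * f))"
          using W W0 d by (simp add: derivation_def sum_distrib_left)
      qed (use W0 in auto)
    qed
    moreover have v: "vars g \<subseteq> W"
      using vars_subset_keys[of g] that(2) by blast
    ultimately obtain W0 where W0: "finite W0"
      "\<forall>W. finite W \<longrightarrow> W0 \<subseteq> W \<longrightarrow> d g = (\<Sum>a\<in>W. d (var a) * pderiv1 a g)"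
      by blast
    then have "d g = (\<Sum>a\<in>W \<union> W0. d (var a) * pderiv1 a g)"
      using that(1) by (meson finite_UnI sup_ge2)
    also have "\<dots> = (\<Sum>a\<in>W. d (var a) * pderiv1 a g)"
      using that(1) W0(1) pderiv1_eq_0[OF v]
      by (intro sum.mono_neutral_right) auto
    finally show ?thesis .
  qed
  have "d f = (\<Sum>a\<in>U. d (var a) * pderiv1 a f)"
    by (rule gen) (use assms in \<open>auto simp: U_def\<close>)
  also have "\<dots> = (\<Sum>a\<in>S. d (var a) * pderiv1 a f)"
    using assms(2) pderiv1_eq_0[OF assms(3)]
    by (intro sum.mono_neutral_right) (auto simp: U_def)
  finally show ?thesis .
qed

text \<open>The derivation with prescribed values \<open>\<phi> l\<close> on the variables. Summing
  over \<open>vars f\<close> keeps it meaningful when infinitely many \<open>\<phi> l\<close> are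
  nonzero.\<close>

definition dvf :: "('i \<Rightarrow> ('i, 'k::field_char_0) mpol) \<Rightarrow> ('i, 'k) mpol \<Rightarrow> ('i, 'k) mpol" where
  "dvf \<phi> f = (\<Sum>l\<in>vars f. \<phi> l * pderiv1 l f)"

lemma dvf_eq:
  assumes "finite S" "vars f \<subseteq> S"
  shows "dvf \<phi> f = (\<Sum>l\<in>S. \<phi> l * pderiv1 l f)"
  unfolding dvf_def using assms by (intro sum.mono_neutral_left) (auto simp: vars_def)

lemma derivation_dvf: "derivation (dvf \<phi>)"
  unfolding derivation_def
proof (intro conjI allI)
  fix f g :: "('a, 'b) mpol"
  let ?S = "vars f \<union> vars g"
  show "dvf \<phi> (f + g) = dvf \<phi> f + dvf \<phi> g"
    by (subst (1 2 3) dvf_eq[of ?S]) (use vars_add[of f g] in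
      \<open>auto simp: pderiv1_add distrib_left sum.distrib\<close>)
  show "dvf \<phi> (f * g) = f * dvf \<phi> g + dvf \<phi> f * g"
    by (subst (1 2 3) dvf_eq[of ?S]) (use vars_mult[of f g] in
      \<open>auto simp: pderiv1_mult sum.distrib sum_distrib_left sum_distrib_right algebra_simps\<close>)
  show "dvf \<phi> (const c) = 0" for c
    by (simp add: dvf_def)
qed

lemma dvf_var [simp]: "dvf \<phi> (var i) = \<phi> i"
  by (subst dvf_eq[of "{i}"]) (use vars_var[of i] in \<open>auto simp: pderiv1_var\<close>)

context
  fixes d :: "('i, 'k::field_char_0) mpol \<Rightarrow> ('i, 'k) mpol"
  assumes d: "derivation d"
begin

lemma derivation_add: "d (f + g) = d f + d g"
  using d by (simp add: derivation_def)

lemma derivation_mult: "d (f * g) = f * d g + d f * g"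
  using d by (simp add: derivation_def)

lemma derivation_const: "d (const c) = 0"
  using d by (simp add: derivation_def)

lemma derivation_const_mult: "d (const c * f) = const c * d f"
  by (simp add: derivation_mult derivation_const)

lemma derivation_0: "d 0 = 0"
  using derivation_const[of 0] by simp

lemma derivation_uminus: "d (- f) = - d f"
  using derivation_add[of f "- f"] by (simp add: derivation_0 eq_neg_iff_add_eq_0 add.commute)

lemma derivation_diff: "d (f - g) = d f - d g"
  using derivation_add[of f "- g"] by (simp add: derivation_uminus)

lemma derivation_sum: "d (\<Sum>a\<in>A. f a) = (\<Sum>a\<in>A. d (f a))"
  by (induction A rule: infinite_finite_induct) (simp_all add: derivation_add derivation_0)

lemma derivation_numeral: "d (numeral n * f) = numeral n * d f"
  using derivation_const_mult[of "numeral n" f] by simp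

end

section \<open>Contraction operators of a Poisson bracket\<close>

locale poisson =
  fixes B :: "('i, 'k::field_char_0) mpol \<Rightarrow> ('i, 'k) mpol \<Rightarrow> ('i, 'k) mpol"
  assumes poisson: "poisson_bracket B"
begin

lemma B_add_left: "B (f + g) h = B f h + B g h"
  and B_add_right: "B f (g + h) = B f g + B f h"
  and B_anti: "B f g = - B g f"
  and B_mult_left: "B (f * g) h = f * B g h + B f h * g"
  and B_mult_right': "B f (g * h) = B f g * h + g * B f h"
  and B_jacobi: "B f (B g h) + B g (B h f) + B h (B f g) = 0"
  using poisson unfolding poisson_bracket_def bilin_def by - (elim conjE; iprover)+

lemma B_mult_right: "B f (g * h) = g * B f h + B f g * h"
  by (rule trans[OF B_mult_right' add.commute])

lemma B_const_left: "B (const c) h = 0"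
proof -
  have "B 1 h = 0"
    using B_mult_left[of 1 1 h] by simp
  moreover have "B (const c * 1) h = const c * B 1 h"
    using poisson unfolding poisson_bracket_def bilin_def by blast
  ultimately show ?thesis
    by simp
qed

lemma derivation_B_left: "derivation (\<lambda>f. B f g)"
  by (simp add: derivation_def B_add_left B_mult_left B_const_left)

lemma derivation_B_right: "derivation (B f)"
  using B_anti[of f "const _"] by (simp add: derivation_def B_add_right B_mult_right B_const_left)

lemmas B_0_left [simp] = derivation_0[OF derivation_B_left]
  and B_0_right [simp] = derivation_0[OF derivation_B_right]
  and B_const_right = derivation_const[OF derivation_B_right]
  and B_uminus_left = derivation_uminus[OF derivation_B_left]
  and B_uminus_right = derivation_uminus[OF derivation_B_right]
  and B_diff_left = derivation_diff[OF derivation_B_left]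
  and B_diff_right = derivation_diff[OF derivation_B_right]
  and B_sum_left = derivation_sum[OF derivation_B_left]
  and B_const_mult_left = derivation_const_mult[OF derivation_B_left]
  and B_const_mult_right = derivation_const_mult[OF derivation_B_right]
  and B_numeral_left = derivation_numeral[OF derivation_B_left]
  and B_numeral_right = derivation_numeral[OF derivation_B_right]

lemmas B_expand_left = derivation_expand[OF derivation_B_left]
  and B_expand_right = derivation_expand[OF derivation_B_right]

lemma B_1_left [simp]: "B 1 f = 0"
  using B_const_left[of 1 f] by simp

lemma B_1_right [simp]: "B f 1 = 0"
  using B_const_right[of f 1] by simp

abbreviation Xv :: "'i \<Rightarrow> 'i \<Rightarrow> ('i, 'k) mpol" where
  "Xv a b \<equiv> B (var a) (var b)"

abbreviation P :: "'i \<Rightarrow> 'i \<Rightarrow> 'i \<Rightarrow> ('i, 'k) mpol" where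
  "P a b c \<equiv> B (Xv a b) (var c)"

text \<open>
  In the notation of the formula, \<open>P a b c = X\<^bsub>ab\<^esub>\<^sup>k X\<^bsub>kc\<^esub>\<close>,
  \<open>Z b c = X\<^bsub>lb\<^esub>\<^sup>k X\<^bsub>kc\<^esub> \<partial>\<^sup>l\<close>,
  \<open>N b = X\<^bsub>ba\<^esub>\<^sup>k X\<^bsub>kd\<^esub> \<partial>\<^bsup>ad\<^esup>\<close>
  and \<open>Y b c = X\<^bsub>lb\<^esub> X\<^bsub>kc\<^esub> \<partial>\<^bsup>kl\<^esup>\<close>. Inner contractions are thereby
  brackets, which avoids summing over an index set closed under the variables of the \<open>X\<^bsub>ij\<^esub>\<close>:
  there need not be a finite one.
\<close>

definition Z :: "'i \<Rightarrow> 'i \<Rightarrow> ('i, 'k) mpol \<Rightarrow> ('i, 'k) mpol" where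
  "Z b c = dvf (\<lambda>l. P l b c)"

definition N :: "'i \<Rightarrow> ('i, 'k) mpol \<Rightarrow> ('i, 'k) mpol" where
  "N b u = (\<Sum>a\<in>vars u. B (Xv b a) (pderiv1 a u))"

definition Y :: "'i \<Rightarrow> 'i \<Rightarrow> ('i, 'k) mpol \<Rightarrow> ('i, 'k) mpol" where
  "Y b c u = B (B u (var b)) (var c) - Z b c u"

lemma Z_eq: "finite S \<Longrightarrow> vars u \<subseteq> S \<Longrightarrow> Z b c u = (\<Sum>l\<in>S. P l b c * pderiv1 l u)"
  unfolding Z_def by (rule dvf_eq)

lemma Z_var [simp]: "Z b c (var a) = P a b c"
  by (simp add: Z_def)

lemma derivation_Z: "derivation (Z b c)"
  unfolding Z_def by (rule derivation_dvf)

lemmas Z_add = derivation_add[OF derivation_Z]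
  and Z_mult = derivation_mult[OF derivation_Z]
  and Z_const_mult = derivation_const_mult[OF derivation_Z]
  and Z_uminus = derivation_uminus[OF derivation_Z]

lemma N_eq: "finite S \<Longrightarrow> vars u \<subseteq> S \<Longrightarrow> N b u = (\<Sum>a\<in>S. B (Xv b a) (pderiv1 a u))"
  unfolding N_def by (intro sum.mono_neutral_left) (auto simp: vars_def)

lemma N_expand:
  assumes "finite S" "vars u \<subseteq> S"
  shows "N b u = (\<Sum>a\<in>S. \<Sum>d\<in>S. P b a d * pderiv1 d (pderiv1 a u))"
  unfolding N_eq[OF assms]
  by (intro sum.cong refl B_expand_right assms(1) order.trans[OF vars_pderiv1 assms(2)])

text \<open>By the Leibniz rule the iterated bracket splits into a part with second derivatives of
  \<open>u\<close> and a part in which the outer bracket hits \<open>Xv l b\<close>. The latter is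
  \<open>Z b c u\<close>, which the definition of \<open>Y\<close> removes.\<close>

lemma Y_expand:
  assumes "finite S" "vars u \<subseteq> S"
  shows "Y b c u = (\<Sum>l\<in>S. \<Sum>k\<in>S. Xv l b * Xv k c * pderiv1 k (pderiv1 l u))"
proof -
  have "B (B u (var b)) (var c) = (\<Sum>l\<in>S. Xv l b * B (pderiv1 l u) (var c)) + Z b c u"
    by (simp add: B_expand_left[OF assms, of "var b"] Z_eq[OF assms] B_sum_left B_mult_left sum.distrib)
  moreover have "B (pderiv1 l u) (var c) = (\<Sum>k\<in>S. Xv k c * pderiv1 k (pderiv1 l u))" for l
    by (intro B_expand_left assms(1) order.trans[OF vars_pderiv1 assms(2)])
  ultimately show ?thesis
    by (simp add: Y_def sum_distrib_left mult.assoc)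
qed

lemma Y_commute: "Y b c u = Y c b u"
proof -
  have "Y b c u = (\<Sum>l\<in>vars u. \<Sum>k\<in>vars u. Xv l b * Xv k c * pderiv1 k (pderiv1 l u))"
    by (rule Y_expand) auto
  also have "\<dots> = (\<Sum>k\<in>vars u. \<Sum>l\<in>vars u. Xv k c * Xv l b * pderiv1 l (pderiv1 k u))"
    by (subst sum.swap) (simp add: mult.commute pderiv1_commute)
  also have "\<dots> = Y c b u"
    by (rule Y_expand[symmetric]) auto
  finally show ?thesis .
qed

text \<open>The form in which the Jacobi identity enters most computations: \<open>Y\<close> is
  symmetric in its indices, so the antisymmetric part of \<open>Z\<close> is that of the iterated
  bracket.\<close>

lemma Z_swap: "Z a b u = Z b a u + B u (Xv a b)"
proof -
  have e1: "B (B u (var a)) (var b) = - B (var b) (B u (var a))"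
    by (rule B_anti)
  have e2: "B (B u (var b)) (var a) = B (var a) (B (var b) u)"
    by (subst B_anti[of u]) (simp only: B_uminus_left B_anti[of "B (var b) u" "var a"] minus_minus)
  have "B u (Xv a b) = - (B (var a) (B (var b) u) + B (var b) (B u (var a)))"
    using B_jacobi[of u "var a" "var b"] by (simp only: eq_neg_iff_add_eq_0 add.assoc)
  then have "B (B u (var a)) (var b) - B (B u (var b)) (var a) = B u (Xv a b)"
    unfolding e1 e2 by simp
  then show ?thesis
    using Y_commute[of a b u] by (simp add: Y_def algebra_simps)
qed

lemma Y_add: "Y b c (u + v) = Y b c u + Y b c v"
  by (simp add: Y_def B_add_left Z_add)

lemma Y_const_mult: "Y b c (const k * u) = const k * Y b c u"
  by (simp add: Y_def B_const_mult_left Z_const_mult right_diff_distrib)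

lemma Y_mult:
  "Y b c (u * v) = u * Y b c v + v * Y b c u + B u (var b) * B v (var c) + B u (var c) * B v (var b)"
  by (simp add: Y_def B_mult_left B_add_left Z_mult algebra_simps)

lemma Y_var [simp]: "Y b c (var a) = 0"
  by (simp add: Y_def)

lemma N_var [simp]: "N b (var a) = 0"
  unfolding N_def by (rule sum.neutral) (simp add: pderiv1_var)

lemma N_add: "N b (u + v) = N b u + N b v"
proof -
  let ?S = "vars u \<union> vars v"
  show ?thesis
    by (subst (1 2 3) N_eq[of ?S])
      (use vars_add[of u v] in \<open>auto simp: pderiv1_add B_add_right sum.distrib\<close>)
qed

lemma N_const_mult: "N b (const k * u) = const k * N b u"
proof -
  have "vars (const k * u) \<subseteq> vars u"
    by (auto simp: vars_def)
  then show ?thesis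
    by (subst (1 2) N_eq[of "vars u"]) (auto simp: B_const_mult_right sum_distrib_left)
qed

lemma N_sum: "N b (\<Sum>a\<in>A. f a) = (\<Sum>a\<in>A. N b (f a))"
  by (induction A rule: infinite_finite_induct) (simp_all add: N_add N_def[of _ 0])

text \<open>\<open>N b\<close> has order two, so the Leibniz rule fails by terms with derivatives on
  both factors. In the cross term with \<open>B (Xv b a) v * pderiv1 a u\<close>, expanding the
  bracket in \<open>v\<close> and exchanging the sums produces a contraction of \<open>P\<close>
  with derivatives of \<open>u\<close>, which is \<open>- Z b d u\<close>.\<close>

lemma N_mult:
  assumes "finite S" "vars v \<subseteq> S"
  shows "N b (u * v) = u * N b v + v * N b u + (\<Sum>a\<in>S. (B (Xv b a) u - Z b a u) * pderiv1 a v)"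
proof -
  let ?T = "S \<union> vars u"
  have T: "finite ?T" "vars v \<subseteq> ?T" "vars u \<subseteq> ?T" "vars (u * v) \<subseteq> ?T"
    using assms vars_mult[of u v] by auto
  have "N b (u * v) = u * N b v + v * N b u + (\<Sum>a\<in>?T. B (Xv b a) u * pderiv1 a v) +
      (\<Sum>a\<in>?T. B (Xv b a) v * pderiv1 a u)"
    by (simp add: N_eq[OF T(1)] T pderiv1_mult B_add_right B_mult_right sum.distrib
        sum_distrib_left algebra_simps)
  also have "(\<Sum>a\<in>?T. B (Xv b a) v * pderiv1 a u) =
      (\<Sum>a\<in>?T. \<Sum>d\<in>?T. P b a d * pderiv1 d v * pderiv1 a u)"
    by (simp add: B_expand_right[OF T(1,2)] sum_distrib_right)
  also have "\<dots> = (\<Sum>d\<in>?T. (\<Sum>a\<in>?T. P b a d * pderiv1 a u) * pderiv1 d v)"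
    by (subst sum.swap) (simp add: sum_distrib_left sum_distrib_right mult_ac)
  also have "\<dots> = (\<Sum>d\<in>?T. - Z b d u * pderiv1 d v)"
    by (simp add: Z_eq[OF T(1,3)] B_anti[of "var b"] B_uminus_left sum_negf)
  finally have "N b (u * v) = u * N b v + v * N b u +
      (\<Sum>a\<in>?T. (B (Xv b a) u - Z b a u) * pderiv1 a v)"
    by (simp add: sum_negf sum_subtractf left_diff_distrib)
  also have "(\<Sum>a\<in>?T. (B (Xv b a) u - Z b a u) * pderiv1 a v) =
      (\<Sum>a\<in>S. (B (Xv b a) u - Z b a u) * pderiv1 a v)"
    using assms pderiv1_eq_0[OF assms(2)] by (intro sum.mono_neutral_right) auto
  finally show ?thesis .
qed

text \<open>The commutator of a second order operator with a derivation has order two again: the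
  third derivatives of \<open>g\<close> in \<open>N2\<close> and \<open>N3\<close> coincide. What
  remains comes from differentiating coefficients and from the cross terms of
  \<open>N_mult\<close>.\<close>

lemma N_commutator:
  assumes "finite S" "vars g \<subseteq> S"
  shows "B (N a g) (var b) - N a (B g (var b)) =
    (\<Sum>k\<in>S. \<Sum>l\<in>S. (B (P a k l) (var b) - B (Xv a k) (Xv l b) + Z a k (Xv l b)) *
       pderiv1 l (pderiv1 k g)) - (\<Sum>k\<in>S. N a (Xv k b) * pderiv1 k g)"
proof -
  have v: "vars (pderiv1 k g) \<subseteq> S" for k
    by (rule order.trans[OF vars_pderiv1 assms(2)])
  have N1: "N a (B g (var b)) = (\<Sum>k\<in>S. Xv k b * N a (pderiv1 k g)) +
      (\<Sum>k\<in>S. N a (Xv k b) * pderiv1 k g) +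
      (\<Sum>k\<in>S. \<Sum>l\<in>S. (B (Xv a l) (Xv k b) - Z a l (Xv k b)) * pderiv1 l (pderiv1 k g))"
    by (simp add: B_expand_left[OF assms, of "var b"] N_sum N_mult[OF assms(1) v] sum.distrib
        mult.commute[of "N _ (B _ _)"])
  have "(\<Sum>k\<in>S. Xv k b * N a (pderiv1 k g)) =
      (\<Sum>k\<in>S. Xv k b * (\<Sum>d\<in>S. \<Sum>l\<in>S. P a d l * pderiv1 l (pderiv1 d (pderiv1 k g))))"
    by (simp add: N_expand[OF assms(1) v])
  also have "\<dots> = (\<Sum>d\<in>S. \<Sum>l\<in>S. P a d l * (\<Sum>k\<in>S. Xv k b * pderiv1 k (pderiv1 l (pderiv1 d g))))"
    (is "_ = ?R")
  proof -
    have "(\<Sum>k\<in>S. Xv k b * (\<Sum>d\<in>S. \<Sum>l\<in>S. P a d l * pderiv1 l (pderiv1 d (pderiv1 k g)))) =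
        (\<Sum>k\<in>S. \<Sum>d\<in>S. \<Sum>l\<in>S. P a d l * (Xv k b * pderiv1 k (pderiv1 l (pderiv1 d g))))"
      by (simp add: sum_distrib_left pderiv1_commute[of _ k for k] mult_ac)
    also have "\<dots> = (\<Sum>d\<in>S. \<Sum>l\<in>S. \<Sum>k\<in>S. P a d l * (Xv k b * pderiv1 k (pderiv1 l (pderiv1 d g))))"
      by (subst sum.swap) (intro sum.cong refl sum.swap)
    finally show ?thesis
      by (simp add: sum_distrib_left)
  qed
  also have "?R = (\<Sum>d\<in>S. \<Sum>l\<in>S. P a d l * B (pderiv1 l (pderiv1 d g)) (var b))"
    by (intro sum.cong refl arg_cong[where f = "(*) _"] B_expand_left[symmetric] assms(1)
        order.trans[OF vars_pderiv1 v])
  finally have N2: "(\<Sum>k\<in>S. Xv k b * N a (pderiv1 k g)) = \<dots>" .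
  have N3: "B (N a g) (var b) = (\<Sum>d\<in>S. \<Sum>l\<in>S. P a d l * B (pderiv1 l (pderiv1 d g)) (var b)) +
      (\<Sum>d\<in>S. \<Sum>l\<in>S. B (P a d l) (var b) * pderiv1 l (pderiv1 d g))"
    by (simp add: N_expand[OF assms] B_sum_left B_mult_left sum.distrib)
  have N4: "(\<Sum>k\<in>S. \<Sum>l\<in>S. (B (Xv a l) (Xv k b) - Z a l (Xv k b)) * pderiv1 l (pderiv1 k g)) =
      (\<Sum>k\<in>S. \<Sum>l\<in>S. (B (Xv a k) (Xv l b) - Z a k (Xv l b)) * pderiv1 l (pderiv1 k g))"
    by (subst sum.swap) (simp add: pderiv1_commute)
  show ?thesis
    unfolding N3 N1 N2 N4
    by (simp add: left_diff_distrib distrib_right sum.distrib sum_subtractf)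
qed

end

section \<open>The coefficients of the star product\<close>

text \<open>Restriction to a finite box and reordering of the indices in one move. Where the
  reordering is not trivial, the tuples in \<open>T\<close> list the indices to be contracted
  last.\<close>

lemma Sum_any_reindex:
  fixes F :: "'a \<Rightarrow> 'c::comm_monoid_add"
  assumes "finite T" "\<And>x. F x \<noteq> 0 \<Longrightarrow> \<psi> x \<in> T" "\<And>x. \<phi> (\<psi> x) = x" "\<And>y. \<psi> (\<phi> y) = y"
  shows "Sum_any F = (\<Sum>y\<in>T. F (\<phi> y))"
proof -
  have "Sum_any F = sum F (\<phi> ` T)"
    by (rule Sum_any.expand_superset) (use assms in \<open>auto intro!: image_eqI[of _ \<phi>]\<close>)
  also have "\<dots> = (\<Sum>y\<in>T. F (\<phi> y))"
    using assms(4) by (subst sum.reindex) (auto intro!: inj_on_inverseI[of _ \<psi>])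
  finally show ?thesis .
qed

lemma D_simps [simp]: "D [] f = f" "D (i # I) f = pderiv1 i (D I f)"
  by (simp_all add: D_def)

context poisson
begin

lemma p1_eq: "star_coeff1 B f g = const (1 / 2) * B f g"
proof -
  let ?S = "vars f \<union> vars g"
  have "Sum_any (\<lambda>(i, j). X B i j [] * (D [i] f * D [j] g)) =
      (\<Sum>(i, j)\<in>?S \<times> ?S. X B i j [] * (D [i] f * D [j] g))"
    by (rule Sum_any_reindex[where \<psi> = "\<lambda>x. x"]) (simp, auto simp: vars_def)
  also have "\<dots> = (\<Sum>i\<in>?S. (\<Sum>j\<in>?S. Xv i j * pderiv1 j g) * pderiv1 i f)"
    by (simp add: sum.cartesian_product[symmetric] X_def sum_distrib_left sum_distrib_right mult_ac)
  also have "\<dots> = (\<Sum>i\<in>?S. B (var i) g * pderiv1 i f)"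
    by (subst B_expand_right[of ?S g]) auto
  also have "\<dots> = B f g"
    by (subst B_expand_left[of ?S f]) auto
  finally show ?thesis
    by (simp add: star_coeff1_def)
qed

lemma sum_D2_mono:
  fixes g :: "('i, 'k) mpol"
  assumes "finite T" "S \<subseteq> T" "vars g \<subseteq> S"
  shows "(\<Sum>b\<in>T. \<Sum>c\<in>T. F b c * D [b, c] g) = (\<Sum>b\<in>S. \<Sum>c\<in>S. F b c * D [b, c] g)"
proof -
  have "D [b, c] g = 0" if "b \<notin> S \<or> c \<notin> S" for b c
    using that pderiv1_eq_0[OF assms(3)] pderiv1_pderiv1_eq_0[OF assms(3)] by auto
  then have "(\<Sum>b\<in>S. \<Sum>c\<in>S. F b c * D [b, c] g) = (\<Sum>b\<in>S. \<Sum>c\<in>T. F b c * D [b, c] g)"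
    using assms by (intro sum.cong refl sum.mono_neutral_left) auto
  also have "\<dots> = (\<Sum>b\<in>T. \<Sum>c\<in>T. F b c * D [b, c] g)"
    using assms \<open>\<And>b c. _ \<Longrightarrow> D [b, c] g = 0\<close>
    by (intro sum.mono_neutral_left) (auto intro!: sum.neutral simp del: D_simps)
  finally show ?thesis ..
qed

text \<open>The operator is sorted by the derivatives of \<open>g\<close>. \<open>Z\<close> and
  \<open>N\<close> stem from the two halves of the symmetric pair in the formula, \<open>Y\<close>
  from the product of two undifferentiated brackets.\<close>

lemma p2_eq:
  assumes S: "finite S" "vars g \<subseteq> S"
  shows "star_coeff2 B f g = const (1 / 24) *
    ((\<Sum>b\<in>S. \<Sum>c\<in>S. (2 * Z b c f + 3 * Y b c f) * D [b, c] g) + 2 * (\<Sum>b\<in>S. N b f * D [b] g))"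
proof -
  let ?T = "S \<union> vars f"
  \<comment> \<open>The contracted index \<open>l\<close> is an upper index of
    \<open>X B i j [l]\<close> and may lie outside \<open>?T\<close>; \<open>W\<close> contains all
    values at which it contributes.\<close>
  define W where "W = (\<Union>i\<in>?T. \<Union>j\<in>?T. vars (Xv i j))"
  have T: "finite ?T" "vars f \<subseteq> ?T" "vars g \<subseteq> ?T" and W: "finite W"
    using S by (auto simp: W_def)
  have WX: "vars (Xv i j) \<subseteq> W" if "i \<in> ?T" "j \<in> ?T" for i j
    using that unfolding W_def by blast
  have z: "i \<notin> ?T \<Longrightarrow> pderiv1 i f = 0" "i \<notin> ?T \<Longrightarrow> pderiv1 i g = 0" for i
    using pderiv1_eq_0[OF T(2)] pderiv1_eq_0[OF T(3)] by auto
  have z2: "i \<notin> ?T \<Longrightarrow> pderiv1 i (pderiv1 j f) = 0" "i \<notin> ?T \<Longrightarrow> pderiv1 i (pderiv1 j g) = 0" for i j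
    using pderiv1_pderiv1_eq_0[OF T(2)] pderiv1_pderiv1_eq_0[OF T(3)] by auto
  have "Sum_any (\<lambda>(i, j, k, l). 2 * X B i j [l] * X B l k [] * (D [i] f * D [j, k] g + D [j, k] f * D [i] g)) =
      (\<Sum>(i, j, k, l)\<in>?T \<times> ?T \<times> ?T \<times> W.
        2 * X B i j [l] * X B l k [] * (D [i] f * D [j, k] g + D [j, k] f * D [i] g))"
  proof (rule Sum_any_reindex[where \<psi> = "\<lambda>x. x"], goal_cases)
    case (2 x)
    obtain i j k l where x: "x = (i, j, k, l)"
      by (cases x)
    have "i \<in> ?T" "j \<in> ?T" "k \<in> ?T"
      using 2 z z2 unfolding x by - (rule ccontr, simp add: X_def)+
    moreover from this have "l \<in> W"
      using 2 pderiv1_eq_0[OF WX] unfolding x by - (rule ccontr, simp add: X_def)+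
    ultimately show ?case
      unfolding x by blast
  qed (use T W in auto)
  also have "\<dots> = (\<Sum>i\<in>?T. \<Sum>j\<in>?T. \<Sum>k\<in>?T. 2 * (\<Sum>l\<in>W. Xv l k * pderiv1 l (Xv i j)) *
        (D [i] f * D [j, k] g + D [j, k] f * D [i] g))"
    by (simp add: sum.cartesian_product[symmetric] X_def sum_distrib_right sum_distrib_left mult_ac)
  also have "\<dots> = (\<Sum>i\<in>?T. \<Sum>j\<in>?T. \<Sum>k\<in>?T. 2 * P i j k * (D [i] f * D [j, k] g + D [j, k] f * D [i] g))"
    by (intro sum.cong refl arg_cong2[where f = "(*)"] B_expand_left[symmetric] W WX)
  also have "\<dots> = (\<Sum>i\<in>?T. \<Sum>j\<in>?T. \<Sum>k\<in>?T. 2 * (P i j k * D [i] f) * D [j, k] g) +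
      (\<Sum>i\<in>?T. \<Sum>j\<in>?T. \<Sum>k\<in>?T. 2 * (P i j k * D [k, j] f) * D [i] g)"
    by (simp add: distrib_left sum.distrib mult_ac pderiv1_commute)
  also have "(\<Sum>i\<in>?T. \<Sum>j\<in>?T. \<Sum>k\<in>?T. 2 * (P i j k * D [i] f) * D [j, k] g) =
      (\<Sum>j\<in>?T. \<Sum>k\<in>?T. \<Sum>i\<in>?T. 2 * (P i j k * D [i] f) * D [j, k] g)"
    by (subst sum.swap) (intro sum.cong refl sum.swap)
  also have "\<dots> = (\<Sum>j\<in>?T. \<Sum>k\<in>?T. 2 * Z j k f * D [j, k] g)"
    by (simp add: Z_eq[OF T(1,2)] sum_distrib_left sum_distrib_right)
  also have "(\<Sum>i\<in>?T. \<Sum>j\<in>?T. \<Sum>k\<in>?T. 2 * (P i j k * D [k, j] f) * D [i] g) =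
      2 * (\<Sum>i\<in>?T. N i f * D [i] g)"
    by (simp add: N_expand[OF T(1,2)] sum_distrib_left sum_distrib_right mult_ac)
  also have "(\<Sum>i\<in>?T. N i f * D [i] g) = (\<Sum>i\<in>S. N i f * D [i] g)"
    using T pderiv1_eq_0[OF S(2)] by (intro sum.mono_neutral_right) auto
  finally have 1: "Sum_any (\<lambda>(i, j, k, l).
        2 * X B i j [l] * X B l k [] * (D [i] f * D [j, k] g + D [j, k] f * D [i] g)) =
      (\<Sum>j\<in>?T. \<Sum>k\<in>?T. 2 * Z j k f * D [j, k] g) + 2 * (\<Sum>i\<in>S. N i f * D [i] g)" .
  have "Sum_any (\<lambda>(i, j, k, l). 3 * X B i j [] * X B k l [] * (D [i, k] f * D [j, l] g)) =
      (\<Sum>(j, l, i, k)\<in>?T \<times> ?T \<times> ?T \<times> ?T. 3 * X B i j [] * X B k l [] * (D [i, k] f * D [j, l] g))"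
  proof (subst Sum_any_reindex[where \<psi> = "\<lambda>(i, j, k, l). (j, l, i, k)"
        and \<phi> = "\<lambda>(j, l, i, k). (i, j, k, l)" and T = "?T \<times> ?T \<times> ?T \<times> ?T"], goal_cases)
    case (2 x)
    obtain i j k l where x: "x = (i, j, k, l)"
      by (cases x)
    have "i \<in> ?T" "j \<in> ?T" "k \<in> ?T" "l \<in> ?T"
      using 2 z z2 unfolding x by - (rule ccontr, simp add: X_def)+
    then show ?case
      unfolding x by auto
  qed (use T in \<open>auto intro!: sum.cong\<close>)
  also have "\<dots> = (\<Sum>j\<in>?T. \<Sum>l\<in>?T. 3 * Y j l f * D [j, l] g)"
    by (simp add: sum.cartesian_product[symmetric] Y_expand[OF T(1,2)] X_def
        sum_distrib_right sum_distrib_left mult_ac pderiv1_commute)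
  finally have 2: "Sum_any (\<lambda>(i, j, k, l). 3 * X B i j [] * X B k l [] * (D [i, k] f * D [j, l] g)) = \<dots>" .
  show ?thesis
    unfolding star_coeff2_def 1 2
    by (simp add: sum_D2_mono[OF T(1) _ S(2)] distrib_right sum.distrib add_ac del: D_simps)
qed

text \<open>The five sums keep the order of the formula. Every index that joins two factors
  \<open>X\<close> is summed away, so that only the indices of the derivatives of \<open>f\<close>
  and \<open>g\<close> remain.\<close>

lemma p3_eq:
  assumes S: "finite S" "vars f \<subseteq> S" "vars g \<subseteq> S"
  shows "star_coeff3 B f g = const (1 / 48) *
    ((\<Sum>l\<in>S. \<Sum>m\<in>S. \<Sum>n\<in>S. - 2 * N l (Xv m n) * (D [n] f * D [l, m] g - D [l, m] f * D [n] g))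
   + (\<Sum>i\<in>S. \<Sum>j\<in>S. \<Sum>k\<in>S. \<Sum>l\<in>S. \<Sum>m\<in>S. \<Sum>n\<in>S.
        Xv i j * Xv k l * Xv m n * (D [i, k, m] f * D [j, l, n] g))
   + (\<Sum>i\<in>S. \<Sum>j\<in>S. \<Sum>m\<in>S. \<Sum>n\<in>S.
        Z m i (Xv j n) * (D [m, n] f * D [i, j] g - D [i, j] f * D [m, n] g))
   + (\<Sum>m\<in>S. \<Sum>n\<in>S. \<Sum>i\<in>S. \<Sum>j\<in>S.
        Y i j (Xv m n) * (D [m] f * D [n, i, j] g - D [n, i, j] f * D [m] g))
   + (\<Sum>i\<in>S. \<Sum>j\<in>S. \<Sum>l\<in>S. \<Sum>m\<in>S. \<Sum>n\<in>S.
        2 * P i j l * Xv m n * (D [j, l, m] f * D [i, n] g - D [i, n] f * D [j, l, m] g)))"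
proof -
  \<comment> \<open>\<open>W1\<close> bounds the upper indices of an \<open>X\<close> whose two
    lower indices belong to derivatives of \<open>f\<close> and \<open>g\<close>. If one lower index
    is itself such a contracted index, the bound is \<open>W2\<close>.\<close>
  define W1 where "W1 = (\<Union>i\<in>S. \<Union>j\<in>S. vars (Xv i j))"
  define W2 where "W2 = (\<Union>i\<in>W1. \<Union>j\<in>S. vars (Xv i j))"
  have W: "finite W1" "finite W2"
    using S by (auto simp: W1_def W2_def)
  have W1: "vars (Xv i j) \<subseteq> W1" if "i \<in> S" "j \<in> S" for i j
    using that unfolding W1_def by blast
  have W2: "vars (Xv i j) \<subseteq> W2" if "i \<in> W1" "j \<in> S" for i j
    using that unfolding W2_def by blast
  have z: "i \<notin> S \<Longrightarrow> pderiv1 i f = 0" "i \<notin> S \<Longrightarrow> pderiv1 i g = 0" for i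
    using pderiv1_eq_0[OF S(2)] pderiv1_eq_0[OF S(3)] by auto
  have z2: "i \<notin> S \<Longrightarrow> pderiv1 i (pderiv1 j f) = 0" "i \<notin> S \<Longrightarrow> pderiv1 i (pderiv1 j g) = 0" for i j
    using pderiv1_pderiv1_eq_0[OF S(2)] pderiv1_pderiv1_eq_0[OF S(3)] by auto
  have z3: "i \<notin> S \<Longrightarrow> pderiv1 i (pderiv1 j (pderiv1 k f)) = 0"
    "i \<notin> S \<Longrightarrow> pderiv1 i (pderiv1 j (pderiv1 k g)) = 0" for i j k
    using pderiv1_pderiv1_eq_0[OF order.trans[OF vars_pderiv1 S(2)]]
      pderiv1_pderiv1_eq_0[OF order.trans[OF vars_pderiv1 S(3)]] by auto
  have zW: "i \<in> S \<Longrightarrow> j \<in> S \<Longrightarrow> k \<notin> W1 \<Longrightarrow> pderiv1 k (pderiv1 l (Xv i j)) = 0" for i j k l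
    using pderiv1_pderiv1_eq_0[OF W1] by auto
  have "Sum_any (\<lambda>(i, j, k, l, m, n). 2 * X B i j [] * X B k l [i] * X B m n [j, k] *
          (D [n] f * D [l, m] g - D [l, m] f * D [n] g)) =
      (\<Sum>(l, m, n, k, j, i)\<in>S \<times> S \<times> S \<times> W1 \<times> W1 \<times> W2. 2 * X B i j [] * X B k l [i] * X B m n [j, k] *
          (D [n] f * D [l, m] g - D [l, m] f * D [n] g))"
  proof (subst Sum_any_reindex[where \<psi> = "\<lambda>(i, j, k, l, m, n). (l, m, n, k, j, i)"
        and \<phi> = "\<lambda>(l, m, n, k, j, i). (i, j, k, l, m, n)" and T = "S \<times> S \<times> S \<times> W1 \<times> W1 \<times> W2"], goal_cases)
    case (2 x)
    obtain i j k l m n where x: "x = (i, j, k, l, m, n)"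
      by (cases x)
    have s: "l \<in> S" "m \<in> S" "n \<in> S"
      using 2 z z2 unfolding x by - (rule ccontr, simp add: X_def)+
    have w: "j \<in> W1" "k \<in> W1"
      using 2 zW[OF s(2,3)] pderiv1_eq_0[OF W1[OF s(2,3)]] unfolding x by - (rule ccontr, simp add: X_def)+
    have "i \<in> W2"
      using 2 pderiv1_eq_0[OF W2[OF w(2) s(1)]] unfolding x by - (rule ccontr, simp add: X_def)+
    with s w show ?case
      unfolding x by auto
  qed (use S W in \<open>auto intro!: sum.cong\<close>)
  also have "\<dots> = (\<Sum>l\<in>S. \<Sum>m\<in>S. \<Sum>n\<in>S. 2 * (\<Sum>k\<in>W1. \<Sum>j\<in>W1. (\<Sum>i\<in>W2. Xv i j * pderiv1 i (Xv k l)) *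
      pderiv1 j (pderiv1 k (Xv m n))) * (D [n] f * D [l, m] g - D [l, m] f * D [n] g))"
    by (simp add: sum.cartesian_product[symmetric] X_def sum_distrib_right sum_distrib_left mult_ac)
  also have "\<dots> = (\<Sum>l\<in>S. \<Sum>m\<in>S. \<Sum>n\<in>S. 2 * (\<Sum>k\<in>W1. \<Sum>j\<in>W1. B (Xv k l) (var j) *
      pderiv1 j (pderiv1 k (Xv m n))) * (D [n] f * D [l, m] g - D [l, m] f * D [n] g))"
    by (intro sum.cong refl arg_cong2[where f = "(*)"] B_expand_left[symmetric] W W2)
  also have "\<dots> = (\<Sum>l\<in>S. \<Sum>m\<in>S. \<Sum>n\<in>S. 2 * (\<Sum>k\<in>W1. B (Xv k l) (pderiv1 k (Xv m n))) *
      (D [n] f * D [l, m] g - D [l, m] f * D [n] g))"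
    by (intro sum.cong refl arg_cong2[where f = "(*)"] B_expand_right[symmetric] W
        order.trans[OF vars_pderiv1 W1])
  \<comment> \<open>The lower indices of \<open>X B k l [i]\<close> are opposite to those in the
    definition of \<open>N l\<close>; this is the origin of the minus sign.\<close>
  also have "\<dots> = (\<Sum>l\<in>S. \<Sum>m\<in>S. \<Sum>n\<in>S. - 2 * N l (Xv m n) * (D [n] f * D [l, m] g - D [l, m] f * D [n] g))"
  proof (intro sum.cong refl)
    fix l m n assume "l \<in> S" "m \<in> S" "n \<in> S"
    then have "N l (Xv m n) = (\<Sum>k\<in>W1. B (Xv l k) (pderiv1 k (Xv m n)))"
      by (intro N_eq W W1)
    then show "2 * (\<Sum>k\<in>W1. B (Xv k l) (pderiv1 k (Xv m n))) *
        (D [n] f * D [l, m] g - D [l, m] f * D [n] g) =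
        - 2 * N l (Xv m n) * (D [n] f * D [l, m] g - D [l, m] f * D [n] g)"
      by (simp add: B_anti[of "var l"] B_uminus_left sum_negf)
  qed
  finally have 1: "Sum_any (\<lambda>(i, j, k, l, m, n). 2 * X B i j [] * X B k l [i] * X B m n [j, k] *
          (D [n] f * D [l, m] g - D [l, m] f * D [n] g)) = \<dots>" .
  have "Sum_any (\<lambda>(i, j, k, l, m, n). X B i j [] * X B k l [] * X B m n [] * (D [i, k, m] f * D [j, l, n] g)) =
      (\<Sum>(i, j, k, l, m, n)\<in>S \<times> S \<times> S \<times> S \<times> S \<times> S.
        X B i j [] * X B k l [] * X B m n [] * (D [i, k, m] f * D [j, l, n] g))"
  proof (rule Sum_any_reindex[where \<psi> = "\<lambda>x. x"], goal_cases)
    case (2 x)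
    obtain i j k l m n where x: "x = (i, j, k, l, m, n)"
      by (cases x)
    have "i \<in> S" "j \<in> S" "k \<in> S" "l \<in> S" "m \<in> S" "n \<in> S"
      using 2 z z2 z3 unfolding x by - (rule ccontr, simp add: X_def)+
    then show ?case
      unfolding x by auto
  qed (use S in auto)
  also have "\<dots> = (\<Sum>i\<in>S. \<Sum>j\<in>S. \<Sum>k\<in>S. \<Sum>l\<in>S. \<Sum>m\<in>S. \<Sum>n\<in>S.
        Xv i j * Xv k l * Xv m n * (D [i, k, m] f * D [j, l, n] g))"
    by (simp add: sum.cartesian_product[symmetric] X_def)
  finally have 2: "Sum_any (\<lambda>(i, j, k, l, m, n).
      X B i j [] * X B k l [] * X B m n [] * (D [i, k, m] f * D [j, l, n] g)) = \<dots>" .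
  have "Sum_any (\<lambda>(i, j, k, l, m, n). X B l m [k] * X B j n [l] * X B k i [] *
          (D [m, n] f * D [i, j] g - D [i, j] f * D [m, n] g)) =
      (\<Sum>(i, j, m, n, l, k)\<in>S \<times> S \<times> S \<times> S \<times> W1 \<times> W2. X B l m [k] * X B j n [l] * X B k i [] *
          (D [m, n] f * D [i, j] g - D [i, j] f * D [m, n] g))"
  proof (subst Sum_any_reindex[where \<psi> = "\<lambda>(i, j, k, l, m, n). (i, j, m, n, l, k)"
        and \<phi> = "\<lambda>(i, j, m, n, l, k). (i, j, k, l, m, n)" and T = "S \<times> S \<times> S \<times> S \<times> W1 \<times> W2"], goal_cases)
    case (2 x)
    obtain i j k l m n where x: "x = (i, j, k, l, m, n)"
      by (cases x)
    have s: "i \<in> S" "j \<in> S" "m \<in> S" "n \<in> S"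
      using 2 z z2 unfolding x by - (rule ccontr, simp add: X_def)+
    have w: "l \<in> W1"
      using 2 pderiv1_eq_0[OF W1[OF s(2,4)]] unfolding x by - (rule ccontr, simp add: X_def)+
    have "k \<in> W2"
      using 2 pderiv1_eq_0[OF W2[OF w s(3)]] unfolding x by - (rule ccontr, simp add: X_def)+
    with s w show ?case
      unfolding x by auto
  qed (use S W in \<open>auto intro!: sum.cong\<close>)
  also have "\<dots> = (\<Sum>i\<in>S. \<Sum>j\<in>S. \<Sum>m\<in>S. \<Sum>n\<in>S. (\<Sum>l\<in>W1. (\<Sum>k\<in>W2. Xv k i * pderiv1 k (Xv l m)) *
      pderiv1 l (Xv j n)) * (D [m, n] f * D [i, j] g - D [i, j] f * D [m, n] g))"
    by (simp add: sum.cartesian_product[symmetric] X_def sum_distrib_right sum_distrib_left mult_ac)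
  also have "\<dots> = (\<Sum>i\<in>S. \<Sum>j\<in>S. \<Sum>m\<in>S. \<Sum>n\<in>S. (\<Sum>l\<in>W1. P l m i *
      pderiv1 l (Xv j n)) * (D [m, n] f * D [i, j] g - D [i, j] f * D [m, n] g))"
    by (intro sum.cong refl arg_cong2[where f = "(*)"] B_expand_left[symmetric] W W2)
  also have "\<dots> = (\<Sum>i\<in>S. \<Sum>j\<in>S. \<Sum>m\<in>S. \<Sum>n\<in>S.
      Z m i (Xv j n) * (D [m, n] f * D [i, j] g - D [i, j] f * D [m, n] g))"
    by (intro sum.cong refl arg_cong2[where f = "(*)"] Z_eq[symmetric] W W1)
  finally have 3: "Sum_any (\<lambda>(i, j, k, l, m, n). X B l m [k] * X B j n [l] * X B k i [] *
          (D [m, n] f * D [i, j] g - D [i, j] f * D [m, n] g)) = \<dots>" .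
  have "Sum_any (\<lambda>(i, j, k, l, m, n). X B m n [k, l] * X B l j [] * X B k i [] *
          (D [m] f * D [n, i, j] g - D [n, i, j] f * D [m] g)) =
      (\<Sum>(m, n, i, j, k, l)\<in>S \<times> S \<times> S \<times> S \<times> W1 \<times> W1. X B m n [k, l] * X B l j [] * X B k i [] *
          (D [m] f * D [n, i, j] g - D [n, i, j] f * D [m] g))"
  proof (subst Sum_any_reindex[where \<psi> = "\<lambda>(i, j, k, l, m, n). (m, n, i, j, k, l)"
        and \<phi> = "\<lambda>(m, n, i, j, k, l). (i, j, k, l, m, n)" and T = "S \<times> S \<times> S \<times> S \<times> W1 \<times> W1"], goal_cases)
    case (2 x)
    obtain i j k l m n where x: "x = (i, j, k, l, m, n)"
      by (cases x)
    have s: "i \<in> S" "j \<in> S" "m \<in> S" "n \<in> S"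
      using 2 z z2 z3 unfolding x by - (rule ccontr, simp add: X_def)+
    have "k \<in> W1" "l \<in> W1"
      using 2 zW[OF s(3,4)] pderiv1_eq_0[OF W1[OF s(3,4)]] unfolding x by - (rule ccontr, simp add: X_def)+
    with s show ?case
      unfolding x by auto
  qed (use S W in \<open>auto intro!: sum.cong\<close>)
  also have "\<dots> = (\<Sum>m\<in>S. \<Sum>n\<in>S. \<Sum>i\<in>S. \<Sum>j\<in>S.
      (\<Sum>k\<in>W1. \<Sum>l\<in>W1. Xv k i * Xv l j * pderiv1 l (pderiv1 k (Xv m n))) *
      (D [m] f * D [n, i, j] g - D [n, i, j] f * D [m] g))"
    by (simp add: sum.cartesian_product[symmetric] X_def sum_distrib_right sum_distrib_left mult_ac
        pderiv1_commute)
  also have "\<dots> = (\<Sum>m\<in>S. \<Sum>n\<in>S. \<Sum>i\<in>S. \<Sum>j\<in>S.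
      Y i j (Xv m n) * (D [m] f * D [n, i, j] g - D [n, i, j] f * D [m] g))"
    by (intro sum.cong refl arg_cong2[where f = "(*)"] Y_expand[symmetric] W W1)
  finally have 4: "Sum_any (\<lambda>(i, j, k, l, m, n). X B m n [k, l] * X B l j [] * X B k i [] *
          (D [m] f * D [n, i, j] g - D [n, i, j] f * D [m] g)) = \<dots>" .
  have "Sum_any (\<lambda>(i, j, k, l, m, n). 2 * X B i j [k] * X B k l [] * X B m n [] *
          (D [j, l, m] f * D [i, n] g - D [i, n] f * D [j, l, m] g)) =
      (\<Sum>(i, j, l, m, n, k)\<in>S \<times> S \<times> S \<times> S \<times> S \<times> W1. 2 * X B i j [k] * X B k l [] * X B m n [] *
          (D [j, l, m] f * D [i, n] g - D [i, n] f * D [j, l, m] g))"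
  proof (subst Sum_any_reindex[where \<psi> = "\<lambda>(i, j, k, l, m, n). (i, j, l, m, n, k)"
        and \<phi> = "\<lambda>(i, j, l, m, n, k). (i, j, k, l, m, n)" and T = "S \<times> S \<times> S \<times> S \<times> S \<times> W1"], goal_cases)
    case (2 x)
    obtain i j k l m n where x: "x = (i, j, k, l, m, n)"
      by (cases x)
    have s: "i \<in> S" "j \<in> S" "l \<in> S" "m \<in> S" "n \<in> S"
      using 2 z z2 z3 unfolding x by - (rule ccontr, simp add: X_def)+
    have "k \<in> W1"
      using 2 pderiv1_eq_0[OF W1[OF s(1,2)]] unfolding x by - (rule ccontr, simp add: X_def)+
    with s show ?case
      unfolding x by auto
  qed (use S W in \<open>auto intro!: sum.cong\<close>)
  also have "\<dots> = (\<Sum>i\<in>S. \<Sum>j\<in>S. \<Sum>l\<in>S. \<Sum>m\<in>S. \<Sum>n\<in>S.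
      2 * (\<Sum>k\<in>W1. Xv k l * pderiv1 k (Xv i j)) * Xv m n *
      (D [j, l, m] f * D [i, n] g - D [i, n] f * D [j, l, m] g))"
    by (simp add: sum.cartesian_product[symmetric] X_def sum_distrib_right sum_distrib_left mult_ac)
  also have "\<dots> = (\<Sum>i\<in>S. \<Sum>j\<in>S. \<Sum>l\<in>S. \<Sum>m\<in>S. \<Sum>n\<in>S.
        2 * P i j l * Xv m n * (D [j, l, m] f * D [i, n] g - D [i, n] f * D [j, l, m] g))"
    by (intro sum.cong refl arg_cong2[where f = "(*)"] B_expand_left[symmetric] W W1)
  finally have 5: "Sum_any (\<lambda>(i, j, k, l, m, n). 2 * X B i j [k] * X B k l [] * X B m n [] *
          (D [j, l, m] f * D [i, n] g - D [i, n] f * D [j, l, m] g)) = \<dots>" .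
  show ?thesis
    unfolding star_coeff3_def 1 2 3 4 5 ..
qed

end

section \<open>Contractions with partial derivatives\<close>

text \<open>The three contractions allow a differential operator to be handled as its family of
  coefficients. The families need not be symmetric; only their symmetrizations affect the
  value.\<close>

definition con1 :: "'i set \<Rightarrow> ('i, 'k::field_char_0) mpol \<Rightarrow> ('i \<Rightarrow> ('i, 'k) mpol) \<Rightarrow> ('i, 'k) mpol" where
  "con1 S h F = (\<Sum>b\<in>S. F b * D [b] h)"

definition con2 ::
  "'i set \<Rightarrow> ('i, 'k::field_char_0) mpol \<Rightarrow> ('i \<Rightarrow> 'i \<Rightarrow> ('i, 'k) mpol) \<Rightarrow> ('i, 'k) mpol" where
  "con2 S h F = (\<Sum>b\<in>S. \<Sum>c\<in>S. F b c * D [b, c] h)"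

definition con3 ::
  "'i set \<Rightarrow> ('i, 'k::field_char_0) mpol \<Rightarrow> ('i \<Rightarrow> 'i \<Rightarrow> 'i \<Rightarrow> ('i, 'k) mpol) \<Rightarrow> ('i, 'k) mpol" where
  "con3 S h F = (\<Sum>b\<in>S. \<Sum>c\<in>S. \<Sum>d\<in>S. F b c d * D [b, c, d] h)"

lemma con_add:
  "con1 S h (\<lambda>b. F1 b + G1 b) = con1 S h F1 + con1 S h G1"
  "con2 S h (\<lambda>b c. F2 b c + G2 b c) = con2 S h F2 + con2 S h G2"
  "con3 S h (\<lambda>b c d. F3 b c d + G3 b c d) = con3 S h F3 + con3 S h G3"
  by (simp_all add: con1_def con2_def con3_def distrib_right sum.distrib)

lemma con_mult:
  "con1 S h (\<lambda>b. u * F1 b) = u * con1 S h F1"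
  "con2 S h (\<lambda>b c. u * F2 b c) = u * con2 S h F2"
  "con3 S h (\<lambda>b c d. u * F3 b c d) = u * con3 S h F3"
  by (simp_all add: con1_def con2_def con3_def sum_distrib_left mult.assoc)

lemma con_mult_right:
  "con1 S h (\<lambda>b. F1 b * u) = u * con1 S h F1"
  "con2 S h (\<lambda>b c. F2 b c * u) = u * con2 S h F2"
  "con3 S h (\<lambda>b c d. F3 b c d * u) = u * con3 S h F3"
  by (simp_all add: con_mult mult.commute[of _ u])

lemma con_uminus:
  "con1 S h (\<lambda>b. - F1 b) = - con1 S h F1"
  "con2 S h (\<lambda>b c. - F2 b c) = - con2 S h F2"
  "con3 S h (\<lambda>b c d. - F3 b c d) = - con3 S h F3"
  by (simp_all add: con1_def con2_def con3_def sum_negf)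

lemma con_diff:
  "con1 S h (\<lambda>b. F1 b - G1 b) = con1 S h F1 - con1 S h G1"
  "con2 S h (\<lambda>b c. F2 b c - G2 b c) = con2 S h F2 - con2 S h G2"
  "con3 S h (\<lambda>b c d. F3 b c d - G3 b c d) = con3 S h F3 - con3 S h G3"
  by (simp_all add: con1_def con2_def con3_def left_diff_distrib sum_subtractf)

lemma con_0:
  "con1 S h (\<lambda>b. 0) = 0" "con2 S h (\<lambda>b c. 0) = 0" "con3 S h (\<lambda>b c d. 0) = 0"
  by (simp_all add: con1_def con2_def con3_def)

lemma con_1 [simp]:
  "con1 S 1 F1 = 0" "con2 S 1 F2 = 0" "con3 S 1 F3 = 0"
  by (simp_all add: con1_def con2_def con3_def)

lemma con2_swap: "con2 S h (\<lambda>b c. F c b) = con2 S h F"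
  unfolding con2_def by (subst sum.swap) (simp add: pderiv1_commute)

lemma con3_swap: "con3 S h (\<lambda>b c d. F c b d) = con3 S h F"
  unfolding con3_def by (subst sum.swap) (simp add: pderiv1_commute)

lemma con3_swap': "con3 S h (\<lambda>b c d. F b d c) = con3 S h F"
proof -
  have "con3 S h (\<lambda>b c d. F b d c) = (\<Sum>b\<in>S. \<Sum>d\<in>S. \<Sum>c\<in>S. F b d c * D [b, c, d] h)"
    unfolding con3_def by (intro sum.cong refl sum.swap)
  then show ?thesis
    by (simp add: con3_def pderiv1_commute)
qed

lemma con_var:
  assumes "finite S" "i \<in> S"
  shows "con1 S (var i) F1 = F1 i" "con2 S (var i) F2 = 0" "con3 S (var i) F3 = 0"
  using assms
  by (simp add: con1_def pderiv1_var if_distrib[of "(*) _"] cong: if_cong)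
    (simp_all add: con2_def con3_def)

lemma con1_times: "con1 S (u * v) F = u * con1 S v F + v * con1 S u F"
  by (simp add: con1_def pderiv1_mult sum_distrib_left sum.distrib algebra_simps)

text \<open>\<open>F\<close> is not assumed symmetric, so the mixed terms record every position that
  a derivative of \<open>u\<close> can occupy: two positions here, and three in each mixed term of
  \<open>con3_times\<close>.\<close>

lemma con2_times: "con2 S (u * v) F = u * con2 S v F + v * con2 S u F +
    con1 S v (\<lambda>b. con1 S u (\<lambda>a. F a b + F b a))"
proof -
  have "con2 S (u * v) F = u * con2 S v F + v * con2 S u F +
      ((\<Sum>b\<in>S. \<Sum>c\<in>S. F b c * D [b] u * D [c] v) + (\<Sum>b\<in>S. \<Sum>c\<in>S. F b c * D [c] u * D [b] v))"
    by (simp add: con2_def pderiv1_mult pderiv1_add sum_distrib_left sum.distrib algebra_simps)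
  also have "(\<Sum>b\<in>S. \<Sum>c\<in>S. F b c * D [b] u * D [c] v) = (\<Sum>b\<in>S. \<Sum>a\<in>S. F a b * D [a] u * D [b] v)"
    by (rule sum.swap)
  finally show ?thesis
    by (simp add: con1_def sum_distrib_right sum.distrib distrib_right)
qed

lemma con3_times: "con3 S (u * v) F = u * con3 S v F + v * con3 S u F +
    con2 S v (\<lambda>b c. con1 S u (\<lambda>a. F a b c + F b a c + F b c a)) +
    con1 S v (\<lambda>b. con2 S u (\<lambda>a d. F b a d + F a b d + F a d b))"
proof -
  have "con3 S (u * v) F = u * con3 S v F + v * con3 S u F +
      ((\<Sum>b\<in>S. \<Sum>c\<in>S. \<Sum>d\<in>S. F b c d * D [b] u * D [c, d] v) +
       (\<Sum>b\<in>S. \<Sum>c\<in>S. \<Sum>d\<in>S. F b c d * D [c] u * D [b, d] v) +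
       (\<Sum>b\<in>S. \<Sum>c\<in>S. \<Sum>d\<in>S. F b c d * D [d] u * D [b, c] v)) +
      ((\<Sum>b\<in>S. \<Sum>c\<in>S. \<Sum>d\<in>S. F b c d * D [c, d] u * D [b] v) +
       (\<Sum>b\<in>S. \<Sum>c\<in>S. \<Sum>d\<in>S. F b c d * D [b, d] u * D [c] v) +
       (\<Sum>b\<in>S. \<Sum>c\<in>S. \<Sum>d\<in>S. F b c d * D [b, c] u * D [d] v))"
    by (simp add: con3_def pderiv1_mult pderiv1_add sum_distrib_left sum.distrib algebra_simps)
  also have "(\<Sum>b\<in>S. \<Sum>c\<in>S. \<Sum>d\<in>S. F b c d * D [b] u * D [c, d] v) =
      (\<Sum>b\<in>S. \<Sum>c\<in>S. \<Sum>a\<in>S. F a b c * D [a] u * D [b, c] v)"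
    by (subst sum.swap) (intro sum.cong refl sum.swap)
  also have "(\<Sum>b\<in>S. \<Sum>c\<in>S. \<Sum>d\<in>S. F b c d * D [c] u * D [b, d] v) =
      (\<Sum>b\<in>S. \<Sum>c\<in>S. \<Sum>a\<in>S. F b a c * D [a] u * D [b, c] v)"
    by (intro sum.cong refl sum.swap)
  also have "(\<Sum>b\<in>S. \<Sum>c\<in>S. \<Sum>d\<in>S. F b c d * D [b, d] u * D [c] v) =
      (\<Sum>b\<in>S. \<Sum>a\<in>S. \<Sum>d\<in>S. F a b d * D [a, d] u * D [b] v)"
    by (rule sum.swap)
  also have "(\<Sum>b\<in>S. \<Sum>c\<in>S. \<Sum>d\<in>S. F b c d * D [b, c] u * D [d] v) =
      (\<Sum>b\<in>S. \<Sum>a\<in>S. \<Sum>d\<in>S. F a d b * D [a, d] u * D [b] v)"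
    by (subst (2) sum.swap) (intro sum.cong refl sum.swap)
  finally show ?thesis
    by (simp add: con1_def con2_def sum_distrib_right sum.distrib distrib_right)
qed

lemma const_inverse_numeral: "numeral n * (const (1 / numeral n) * f) = (f :: ('i, 'k::field_char_0) mpol)"
proof -
  have "numeral n * (const (1 / numeral n) * f) = const (numeral n * (1 / numeral n)) * f"
    by (simp only: const_numeral const_mult mult.assoc)
  then show ?thesis
    by simp
qed

text \<open>Denominators are cleared by multiplying with numerals, which turns the conditions into
  identities with integer coefficients; characteristic 0 allows dividing back.\<close>

lemma numeral_mult_cancel:
  "numeral n * f = numeral n * g \<Longrightarrow> f = (g :: ('i, 'k::field_char_0) mpol)"
  by (metis const_inverse_numeral mult.left_commute)

lemma half_double: "f + f = 0 \<Longrightarrow> f = (0 :: ('i, 'k::field_char_0) mpol)"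
  by (rule numeral_mult_cancel[of "num.Bit0 num.One"]) (simp only: mult_2 mult_zero_right)

text \<open>Second derivatives commute, so \<open>F\<close> and its transpose have the same
  contraction, and the sum of both vanishes.\<close>

lemma con2_eq_0:
  assumes "\<And>b c. b \<in> S \<Longrightarrow> c \<in> S \<Longrightarrow> F b c + F c b = 0"
  shows "con2 S h F = 0"
proof (rule half_double)
  have "con2 S h F + con2 S h F = con2 S h (\<lambda>b c. F b c + F c b)"
    by (simp only: con_add con2_swap[of S h F])
  also have "\<dots> = 0"
    using assms by (simp add: con2_def)
  finally show "con2 S h F + con2 S h F = 0" .
qed

lemma derivation_con1:
  "finite S \<Longrightarrow> derivation d \<Longrightarrow> vars g \<subseteq> S \<Longrightarrow> con1 S g (\<lambda>a. d (var a)) = d g"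
  by (simp add: con1_def derivation_expand)

text \<open>A commutator of derivations is again a derivation. This converts a difference of
  operators of order two in \<open>g\<close> into a contraction with first derivatives.\<close>

lemma derivation_commutator:
  assumes "finite S" "vars g \<subseteq> S" "derivation d" "derivation d'"
  shows "d (d' g) - d' (d g) = con1 S g (\<lambda>a. d (d' (var a)) - d' (d (var a)))"
proof -
  have "derivation (\<lambda>f. d (d' f) - d' (d f))"
    unfolding derivation_def using assms(3,4)
    by (simp add: derivation_add derivation_mult derivation_const derivation_0 algebra_simps)
  from derivation_expand[OF this assms(1,2)] show ?thesis
    by (simp add: con1_def)
qed

lemma derivation_of_con1:
  assumes "finite S" "vars h \<subseteq> S" "derivation d"
  shows "d (con1 S h F) = con1 S h (\<lambda>b. d (F b)) + con2 S h (\<lambda>b c. F b * d (var c))"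
proof -
  have "d (D [b] h) = (\<Sum>c\<in>S. d (var c) * D [b, c] h)" for b
    using derivation_expand[OF assms(3,1) order.trans[OF vars_pderiv1[of b] assms(2)]]
    by (simp add: pderiv1_commute[of b])
  then show ?thesis
    by (simp add: con1_def con2_def derivation_sum[OF assms(3)] derivation_mult[OF assms(3)]
        sum.distrib sum_distrib_left mult_ac del: D_simps)
qed

lemma derivation_of_con2:
  assumes "finite S" "vars h \<subseteq> S" "derivation d"
  shows "d (con2 S h F) = con2 S h (\<lambda>b c. d (F b c)) + con3 S h (\<lambda>b c e. F b c * d (var e))"
proof -
  have "d (D [b, c] h) = (\<Sum>e\<in>S. d (var e) * D [b, c, e] h)" for b c
    using derivation_expand[OF assms(3,1)
        order.trans[OF vars_pderiv1[of b] order.trans[OF vars_pderiv1[of c] assms(2)]]]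
    by (simp add: pderiv1_commute)
  then show ?thesis
    by (simp add: con2_def con3_def derivation_sum[OF assms(3)] derivation_mult[OF assms(3)]
        sum.distrib sum_distrib_left mult_ac del: D_simps)
qed

lemma vars_const_mult: "vars (const c * (f :: ('i, 'k::comm_semiring_1) mpol)) \<subseteq> vars f"
  by (auto simp: vars_def)

lemma con_add_right:
  "con1 S (u + v) F1 = con1 S u F1 + con1 S v F1"
  "con2 S (u + v) F2 = con2 S u F2 + con2 S v F2"
  "con3 S (u + v) F3 = con3 S u F3 + con3 S v F3"
  by (simp_all add: con1_def con2_def con3_def pderiv1_add distrib_left sum.distrib)

lemma con_const_mult_right:
  "con1 S (const k * u) F1 = const k * con1 S u F1"
  "con2 S (const k * u) F2 = const k * con2 S u F2"
  "con3 S (const k * u) F3 = const k * con3 S u F3"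
  by (simp_all add: con1_def con2_def con3_def sum_distrib_left mult.left_commute)

lemma con_times_var:
  assumes "finite S" "i \<in> S"
  shows "con1 S (var i * v) F1 = var i * con1 S v F1 + v * F1 i"
    and "con2 S (var i * v) F2 = var i * con2 S v F2 + con1 S v (\<lambda>a. F2 i a + F2 a i)"
    and "con3 S (var i * v) F3 = var i * con3 S v F3 + con2 S v (\<lambda>a d. F3 i a d + F3 a i d + F3 a d i)"
  by (simp_all add: con1_times con2_times con3_times con_var[OF assms] con_0)

context poisson
begin

lemma Z_con1: "finite S \<Longrightarrow> vars f \<subseteq> S \<Longrightarrow> con1 S f (\<lambda>a. P a b c) = Z b c f"
  using derivation_con1[OF _ derivation_Z] by simp

lemma N_con2: "finite S \<Longrightarrow> vars f \<subseteq> S \<Longrightarrow> con2 S f (P b) = N b f"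
  by (simp add: con2_def N_expand pderiv1_commute)

lemma Y_con2: "finite S \<Longrightarrow> vars f \<subseteq> S \<Longrightarrow> con2 S f (\<lambda>k l. Xv k b * Xv l c) = Y b c f"
  by (simp add: con2_def Y_expand pderiv1_commute)

lemma N_con1:
  assumes S: "finite S" "vars h \<subseteq> S"
  shows "N i (con1 S h F) = con1 S h (\<lambda>b. N i (F b)) + con3 S h (\<lambda>b c d. F b * P i c d) +
    con2 S h (\<lambda>b c. B (Xv i c) (F b) - Z i c (F b))"
proof -
  have v: "vars (D [b] h) \<subseteq> S" for b
    using order.trans[OF vars_pderiv1 S(2)] by simp
  have "N i (F b * D [b] h) = N i (F b) * D [b] h + (\<Sum>c\<in>S. \<Sum>d\<in>S. F b * P i c d * D [b, c, d] h) +
      (\<Sum>c\<in>S. (B (Xv i c) (F b) - Z i c (F b)) * D [b, c] h)" for b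
    by (subst N_mult[OF S(1) v])
      (simp add: N_expand[OF S(1) v[simplified]] sum_distrib_left pderiv1_commute mult_ac)
  then show ?thesis
    by (simp add: con1_def con2_def con3_def N_sum sum.distrib del: D_simps)
qed

lemma p2_con:
  assumes "finite S" "vars g \<subseteq> S"
  shows "star_coeff2 B f g = const (1 / 24) *
    (con2 S g (\<lambda>b c. 2 * Z b c f + 3 * Y b c f) + con1 S g (\<lambda>b. 2 * N b f))"
  unfolding p2_eq[OF assms] by (simp add: con1_def con2_def sum_distrib_left mult.assoc)

text \<open>The indices are renamed so that the outer contraction is always with \<open>g\<close>
  and the inner one with \<open>f\<close>. Each antisymmetrized pair then contributes to two
  different orders in \<open>g\<close>, except for the pair with two derivatives on both
  arguments.\<close>

lemma p3_con:
  assumes S: "finite S" "vars f \<subseteq> S" "vars g \<subseteq> S"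
  shows "star_coeff3 B f g = const (1 / 48) *
    (con2 S g (\<lambda>b c. con1 S f (\<lambda>a. - 2 * N b (Xv c a)) + con2 S f (\<lambda>a d. Z a b (Xv c d))
        - con2 S f (\<lambda>a d. Z b a (Xv d c)) + con3 S f (\<lambda>a d e. 2 * P b a d * Xv e c))
   - con1 S g (\<lambda>b. con2 S f (\<lambda>a d. - 2 * N a (Xv d b)) + con3 S f (\<lambda>a d e. Y d e (Xv b a)))
   + con3 S g (\<lambda>b c d. con3 S f (\<lambda>a e j. Xv a b * Xv e c * Xv j d) + con1 S f (\<lambda>a. Y c d (Xv a b))
        - con2 S f (\<lambda>a e. 2 * P a b c * Xv d e)))"
proof -
  have 1: "(\<Sum>l\<in>S. \<Sum>m\<in>S. \<Sum>n\<in>S. - 2 * N l (Xv m n) * (D [n] f * D [l, m] g - D [l, m] f * D [n] g)) =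
      con2 S g (\<lambda>b c. con1 S f (\<lambda>a. - 2 * N b (Xv c a))) -
      con1 S g (\<lambda>b. con2 S f (\<lambda>a d. - 2 * N a (Xv d b)))"
  proof -
    have "(\<Sum>l\<in>S. \<Sum>m\<in>S. \<Sum>n\<in>S. - 2 * N l (Xv m n) * D [l, m] f * D [n] g) =
        (\<Sum>(n, l, m)\<in>S \<times> S \<times> S. - 2 * N l (Xv m n) * D [l, m] f * D [n] g)"
      unfolding sum.cartesian_product
      by (rule sum.reindex_bij_witness[of _ "\<lambda>(n, l, m). (l, m, n)" "\<lambda>(l, m, n). (n, l, m)"]) auto
    also have "\<dots> = con1 S g (\<lambda>b. con2 S f (\<lambda>a d. - 2 * N a (Xv d b)))"
      by (simp add: sum.cartesian_product[symmetric] con1_def con2_def sum_distrib_right)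
    finally show ?thesis
      by (simp add: con1_def con2_def sum_distrib_right sum_subtractf sum_negf right_diff_distrib mult.assoc)
  qed
  have 2: "(\<Sum>i\<in>S. \<Sum>j\<in>S. \<Sum>k\<in>S. \<Sum>l\<in>S. \<Sum>m\<in>S. \<Sum>n\<in>S.
        Xv i j * Xv k l * Xv m n * (D [i, k, m] f * D [j, l, n] g)) =
      con3 S g (\<lambda>b c d. con3 S f (\<lambda>a e j. Xv a b * Xv e c * Xv j d))" (is "?L = ?R")
  proof -
    have "?L = (\<Sum>(j, l, n, i, k, m)\<in>S \<times> S \<times> S \<times> S \<times> S \<times> S.
        Xv i j * Xv k l * Xv m n * (D [i, k, m] f * D [j, l, n] g))"
      unfolding sum.cartesian_product
      by (rule sum.reindex_bij_witness[of _ "\<lambda>(j, l, n, i, k, m). (i, j, k, l, m, n)"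
            "\<lambda>(i, j, k, l, m, n). (j, l, n, i, k, m)"]) auto
    then show ?thesis
      by (simp add: sum.cartesian_product[symmetric] con3_def sum_distrib_right mult.assoc)
  qed
  have 3: "(\<Sum>i\<in>S. \<Sum>j\<in>S. \<Sum>m\<in>S. \<Sum>n\<in>S.
        Z m i (Xv j n) * (D [m, n] f * D [i, j] g - D [i, j] f * D [m, n] g)) =
      con2 S g (\<lambda>b c. con2 S f (\<lambda>a d. Z a b (Xv c d))) -
      con2 S g (\<lambda>b c. con2 S f (\<lambda>a d. Z b a (Xv d c)))"
  proof -
    have "(\<Sum>i\<in>S. \<Sum>j\<in>S. \<Sum>m\<in>S. \<Sum>n\<in>S. Z m i (Xv j n) * D [i, j] f * D [m, n] g) =
        (\<Sum>(m, n, i, j)\<in>S \<times> S \<times> S \<times> S. Z m i (Xv j n) * D [i, j] f * D [m, n] g)"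
      unfolding sum.cartesian_product
      by (rule sum.reindex_bij_witness[of _ "\<lambda>(m, n, i, j). (i, j, m, n)"
            "\<lambda>(i, j, m, n). (m, n, i, j)"]) auto
    also have "\<dots> = con2 S g (\<lambda>b c. con2 S f (\<lambda>a d. Z b a (Xv d c)))"
      by (simp add: sum.cartesian_product[symmetric] con2_def sum_distrib_right)
    finally show ?thesis
      by (simp add: con2_def sum_distrib_right sum_subtractf right_diff_distrib mult.assoc)
  qed
  have 4: "(\<Sum>m\<in>S. \<Sum>n\<in>S. \<Sum>i\<in>S. \<Sum>j\<in>S.
        Y i j (Xv m n) * (D [m] f * D [n, i, j] g - D [n, i, j] f * D [m] g)) =
      con3 S g (\<lambda>b c d. con1 S f (\<lambda>a. Y c d (Xv a b))) -
      con1 S g (\<lambda>b. con3 S f (\<lambda>a d e. Y d e (Xv b a)))"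
  proof -
    have "(\<Sum>m\<in>S. \<Sum>n\<in>S. \<Sum>i\<in>S. \<Sum>j\<in>S. Y i j (Xv m n) * D [m] f * D [n, i, j] g) =
        (\<Sum>(n, i, j, m)\<in>S \<times> S \<times> S \<times> S. Y i j (Xv m n) * D [m] f * D [n, i, j] g)"
      unfolding sum.cartesian_product
      by (rule sum.reindex_bij_witness[of _ "\<lambda>(n, i, j, m). (m, n, i, j)"
            "\<lambda>(m, n, i, j). (n, i, j, m)"]) auto
    also have "\<dots> = con3 S g (\<lambda>b c d. con1 S f (\<lambda>a. Y c d (Xv a b)))"
      by (simp add: sum.cartesian_product[symmetric] con1_def con3_def sum_distrib_right)
    finally show ?thesis
      by (simp add: con1_def con3_def sum_distrib_right sum_subtractf right_diff_distrib mult.assoc)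
  qed
  have 5: "(\<Sum>i\<in>S. \<Sum>j\<in>S. \<Sum>l\<in>S. \<Sum>m\<in>S. \<Sum>n\<in>S.
        2 * P i j l * Xv m n * (D [j, l, m] f * D [i, n] g - D [i, n] f * D [j, l, m] g)) =
      con2 S g (\<lambda>b c. con3 S f (\<lambda>a d e. 2 * P b a d * Xv e c)) -
      con3 S g (\<lambda>b c d. con2 S f (\<lambda>a e. 2 * P a b c * Xv d e))"
  proof -
    have "(\<Sum>i\<in>S. \<Sum>j\<in>S. \<Sum>l\<in>S. \<Sum>m\<in>S. \<Sum>n\<in>S. 2 * P i j l * Xv m n * D [j, l, m] f * D [i, n] g) =
        (\<Sum>(i, n, j, l, m)\<in>S \<times> S \<times> S \<times> S \<times> S. 2 * P i j l * Xv m n * D [j, l, m] f * D [i, n] g)"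
      unfolding sum.cartesian_product
      by (rule sum.reindex_bij_witness[of _ "\<lambda>(i, n, j, l, m). (i, j, l, m, n)"
            "\<lambda>(i, j, l, m, n). (i, n, j, l, m)"]) auto
    also have "\<dots> = con2 S g (\<lambda>b c. con3 S f (\<lambda>a d e. 2 * P b a d * Xv e c))"
      by (simp add: sum.cartesian_product[symmetric] con2_def con3_def sum_distrib_right)
    finally have 51: "(\<Sum>i\<in>S. \<Sum>j\<in>S. \<Sum>l\<in>S. \<Sum>m\<in>S. \<Sum>n\<in>S.
        2 * P i j l * Xv m n * D [j, l, m] f * D [i, n] g) = \<dots>" .
    have "(\<Sum>i\<in>S. \<Sum>j\<in>S. \<Sum>l\<in>S. \<Sum>m\<in>S. \<Sum>n\<in>S. 2 * P i j l * Xv m n * D [i, n] f * D [j, l, m] g) =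
        (\<Sum>(j, l, m, i, n)\<in>S \<times> S \<times> S \<times> S \<times> S. 2 * P i j l * Xv m n * D [i, n] f * D [j, l, m] g)"
      unfolding sum.cartesian_product
      by (rule sum.reindex_bij_witness[of _ "\<lambda>(j, l, m, i, n). (i, j, l, m, n)"
            "\<lambda>(i, j, l, m, n). (j, l, m, i, n)"]) auto
    also have "\<dots> = con3 S g (\<lambda>b c d. con2 S f (\<lambda>a e. 2 * P a b c * Xv d e))"
      by (simp add: sum.cartesian_product[symmetric] con2_def con3_def sum_distrib_right)
    finally show ?thesis
      using 51 by (simp add: sum_subtractf right_diff_distrib mult.assoc)
  qed
  show ?thesis
    unfolding p3_eq[OF S] 1 2 3 4 5 by (simp add: con_add con_diff algebra_simps)
qed

section \<open>Associativity when the first factor is a variable\<close>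

lemma p1_scaled: "2 * star_coeff1 B f g = B f g"
  unfolding p1_eq by (rule const_inverse_numeral)

lemma p2_scaled:
  assumes "finite S" "vars g \<subseteq> S"
  shows "24 * star_coeff2 B f g =
    con2 S g (\<lambda>b c. 2 * Z b c f + 3 * Y b c f) + con1 S g (\<lambda>b. 2 * N b f)"
  unfolding p2_con[OF assms] by (rule const_inverse_numeral)

lemma p3_scaled:
  assumes "finite S" "vars f \<subseteq> S" "vars g \<subseteq> S"
  shows "48 * star_coeff3 B f g =
    con2 S g (\<lambda>b c. con1 S f (\<lambda>a. - 2 * N b (Xv c a)) + con2 S f (\<lambda>a d. Z a b (Xv c d))
        - con2 S f (\<lambda>a d. Z b a (Xv d c)) + con3 S f (\<lambda>a d e. 2 * P b a d * Xv e c))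
   - con1 S g (\<lambda>b. con2 S f (\<lambda>a d. - 2 * N a (Xv d b)) + con3 S f (\<lambda>a d e. Y d e (Xv b a)))
   + con3 S g (\<lambda>b c d. con3 S f (\<lambda>a e j. Xv a b * Xv e c * Xv j d) + con1 S f (\<lambda>a. Y c d (Xv a b))
        - con2 S f (\<lambda>a e. 2 * P a b c * Xv d e))"
  unfolding p3_con[OF assms] by (rule const_inverse_numeral)

lemma bilin_p1: "bilin (star_coeff1 B)"
  unfolding bilin_def p1_eq
  by (simp add: B_add_left B_add_right B_const_mult_left B_const_mult_right distrib_left mult.left_commute)

lemma bilin_p2: "bilin (star_coeff2 B)"
  unfolding bilin_def
proof (intro conjI allI)
  fix f g h :: "('i, 'k) mpol" and c
  have h: "finite (vars h)" "vars h \<subseteq> vars h"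
    by auto
  have gh: "finite (vars g \<union> vars h)" "vars g \<subseteq> vars g \<union> vars h" "vars h \<subseteq> vars g \<union> vars h"
    "vars (g + h) \<subseteq> vars g \<union> vars h"
    using vars_add[of g h] by auto
  show "star_coeff2 B (f + g) h = star_coeff2 B f h + star_coeff2 B g h"
    unfolding p2_con[OF h] by (simp add: Z_add Y_add N_add con_add con_mult algebra_simps)
  show "star_coeff2 B f (g + h) = star_coeff2 B f g + star_coeff2 B f h"
    unfolding p2_con[OF gh(1,2)] p2_con[OF gh(1,3)] p2_con[OF gh(1,4)]
    by (simp add: con_add_right algebra_simps)
  show "star_coeff2 B (const c * f) h = const c * star_coeff2 B f h"
    unfolding p2_con[OF h]
    by (simp only: Z_const_mult Y_const_mult N_const_mult con_add con_mult) (simp add: algebra_simps)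
  show "star_coeff2 B f (const c * h) = const c * star_coeff2 B f h"
    unfolding p2_con[OF h] p2_con[OF h(1) vars_const_mult]
    by (simp only: con_const_mult_right) (simp add: algebra_simps)
qed

lemma bilin_p3: "bilin (star_coeff3 B)"
  unfolding bilin_def
proof (intro conjI allI)
  fix f g h :: "('i, 'k) mpol" and c
  let ?S = "vars f \<union> vars g \<union> vars h"
  have S: "finite ?S" "vars f \<subseteq> ?S" "vars g \<subseteq> ?S" "vars h \<subseteq> ?S" "vars (f + g) \<subseteq> ?S" "vars (g + h) \<subseteq> ?S"
    "vars (const c * f) \<subseteq> ?S" "vars (const c * g) \<subseteq> ?S"
    using vars_add[of f g] vars_add[of g h] vars_const_mult[of c f] vars_const_mult[of c g] by auto
  note p3 = p3_con[OF S(1)]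
  show "star_coeff3 B (f + g) h = star_coeff3 B f h + star_coeff3 B g h"
    unfolding p3[OF S(5,4)] p3[OF S(2,4)] p3[OF S(3,4)] con_add_right
    by (simp only: con_add con_diff ring_distribs) (simp only: add_ac diff_conv_add_uminus minus_add_distrib)
  show "star_coeff3 B f (g + h) = star_coeff3 B f g + star_coeff3 B f h"
    unfolding p3[OF S(2,6)] p3[OF S(2,3)] p3[OF S(2,4)] con_add_right
    by (simp only: ring_distribs) (simp only: add_ac diff_conv_add_uminus minus_add_distrib)
  show "star_coeff3 B (const c * f) g = const c * star_coeff3 B f g"
    unfolding p3[OF S(7,3)] p3[OF S(2,3)] con_const_mult_right
    by (simp only: con_mult flip: distrib_left right_diff_distrib) (simp only: mult_ac)
  show "star_coeff3 B f (const c * g) = const c * star_coeff3 B f g"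
    unfolding p3[OF S(2,8)] p3[OF S(2,3)] con_const_mult_right
    by (simp only: flip: distrib_left right_diff_distrib) (simp only: mult_ac)
qed

lemma p2_const_left: "star_coeff2 B (const c * f) g = const c * star_coeff2 B f g"
  using bilin_p2 unfolding bilin_def by blast

lemma p2_const_right: "star_coeff2 B f (const c * g) = const c * star_coeff2 B f g"
  using bilin_p2 unfolding bilin_def by blast

lemma p2_var_left: "24 * star_coeff2 B (var i) u = 2 * N i u"
  using p2_scaled[of "vars u" u "var i"] N_con2[of "vars u" u i]
  by (simp add: con_mult con_0)

text \<open>As for the second coefficient, only terms with a single derivative on the variable
  survive: one half each of the first and the fourth sum of the cubic coefficient.\<close>

lemma p3_var_left:
  assumes "finite S" "i \<in> S" "vars u \<subseteq> S"
  shows "48 * star_coeff3 B (var i) u =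
    con2 S u (\<lambda>b c. - 2 * N b (Xv c i)) + con3 S u (\<lambda>b c d. Y c d (Xv i b))"
proof -
  have "vars (var i :: ('i, 'k) mpol) \<subseteq> S"
    using vars_var[of i] assms(2) by blast
  from p3_scaled[OF assms(1) this assms(3)] show ?thesis
    by (simp add: con_var[OF assms(1,2)] con_0)
qed

lemma N_times_var: "N b (var i * g) = var i * N b g - Z b i g - B (Xv i b) g"
proof -
  have "N b (var i * g) = var i * N b g + con1 (vars g) g (\<lambda>a. P b a i - P i b a)"
    using N_mult[of "vars g" g b "var i"] by (simp add: con1_def)
  also have "con1 (vars g) g (\<lambda>a. P b a i - P i b a) =
      - con1 (vars g) g (\<lambda>a. P a b i) - con1 (vars g) g (\<lambda>a. P i b a)"
    by (simp add: con_diff B_anti[of "var b"] B_uminus_left con_uminus)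
  also have "\<dots> = - Z b i g - B (Xv i b) g"
    using derivation_con1[OF _ derivation_B_right, of "vars g" g "Xv i b"] Z_con1[of "vars g" g b i]
    by simp
  finally show ?thesis
    by simp
qed

lemma B_con1_left: "finite S \<Longrightarrow> vars h \<subseteq> S \<Longrightarrow> B h g = con1 S h (\<lambda>b. B (var b) g)"
  by (simp add: con1_def B_expand_left)

lemma B_con1_right: "finite S \<Longrightarrow> vars h \<subseteq> S \<Longrightarrow> B g h = con1 S h (\<lambda>b. B g (var b))"
  by (simp add: con1_def B_expand_right)

text \<open>The Jacobi identity as a formula for the associator of the bracket, the form in which
  iterated first order coefficients meet in the associativity conditions.\<close>

lemma B_jacobi': "B (B f g) h - B f (B g h) = B g (B h f)"
proof -
  have "B (B f g) h = - B h (B f g)"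
    by (rule B_anti)
  also have "\<dots> = B f (B g h) + B g (B h f)"
    using B_jacobi[of f g h] by (simp only: eq_neg_iff_add_eq_0 neg_eq_iff_add_eq_0 add_ac)
  finally show ?thesis
    by simp
qed

lemma B_Xv_left: "B (Xv a b) g = B g (Xv b a)"
  by (subst B_anti, subst B_anti[of "var a"]) (simp add: B_uminus_right)

lemma associative_order1:
  "star_coeff1 B (var i * g) h + star_coeff1 B (var i) g * h =
   var i * star_coeff1 B g h + star_coeff1 B (var i) (g * h)"
  unfolding p1_eq by (simp add: B_mult_left B_mult_right algebra_simps)

text \<open>The two sides are compared by derivatives of \<open>h\<close>. The Jacobi identity
  enters twice: in \<open>5\<close> for the associator of the bracket, and through
  \<open>Z_swap\<close> in \<open>7\<close> for the first derivatives. The second derivatives match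
  by antisymmetry and the symmetry of \<open>D [b, c] h\<close>.\<close>

lemma associative_order2:
  "star_coeff2 B (var i * g) h + star_coeff1 B (star_coeff1 B (var i) g) h + star_coeff2 B (var i) g * h =
   var i * star_coeff2 B g h + star_coeff1 B (var i) (star_coeff1 B g h) + star_coeff2 B (var i) (g * h)"
\<comment> \<open>The numeral is 24, the denominator of \<open>star_coeff2\<close>.\<close>
proof (rule numeral_mult_cancel[where n = "num.Bit0 (num.Bit0 (num.Bit0 (num.Bit1 num.One)))"])
  define S where "S = vars h"
  have S: "finite S" "vars h \<subseteq> S"
    by (auto simp: S_def)
  have 1: "24 * star_coeff2 B (var i * g) h = var i * (24 * star_coeff2 B g h) +
      con2 S h (\<lambda>b c. 2 * (P i b c * g) + 3 * (Xv i b * B g (var c) + Xv i c * B g (var b))) +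
      con1 S h (\<lambda>b. - 2 * Z b i g - 2 * B (Xv i b) g)"
    unfolding p2_scaled[OF S]
    by (simp add: Z_mult Y_mult N_times_var con_add con_diff con_mult con_uminus distrib_left
        right_diff_distrib mult.left_commute[of _ "var i"])
  \<comment> \<open>Each of the two nested first order coefficients carries a factor 1/2, which
    turns 24 into 6.\<close>
  have 2: "24 * star_coeff1 B (star_coeff1 B (var i) g) h = 6 * B (B (var i) g) h"
  proof -
    have "24 * star_coeff1 B (star_coeff1 B (var i) g) h = 6 * (2 * (2 * star_coeff1 B (star_coeff1 B (var i) g) h))"
      by simp
    then show ?thesis
      by (simp only: p1_scaled flip: B_numeral_left)
  qed
  have 3: "24 * star_coeff1 B (var i) (star_coeff1 B g h) = 6 * B (var i) (B g h)"
  proof -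
    have "24 * star_coeff1 B (var i) (star_coeff1 B g h) = 6 * (2 * (2 * star_coeff1 B (var i) (star_coeff1 B g h)))"
      by simp
    then show ?thesis
      by (simp only: p1_scaled flip: B_numeral_right)
  qed
  have 4: "24 * star_coeff2 B (var i) (g * h) = g * (2 * N i h) + (24 * star_coeff2 B (var i) g) * h +
      con1 S h (\<lambda>b. 2 * (B (Xv i b) g - Z i b g))"
    unfolding p2_var_left N_mult[OF S] by (simp add: con1_def sum_distrib_left algebra_simps)
  have 5: "B (B (var i) g) h - B (var i) (B g h) =
      con1 S h (\<lambda>b. B g (Xv b i)) + con2 S h (\<lambda>b c. Xv b i * B g (var c))"
    unfolding B_jacobi' B_con1_left[OF S, of "var i"]
    by (rule derivation_of_con1[OF S derivation_B_right])
  have 6: "con2 S h (\<lambda>b c. 2 * (P i b c * g) + 3 * (Xv i b * B g (var c) + Xv i c * B g (var b))) =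
      g * (2 * N i h) - 6 * con2 S h (\<lambda>b c. Xv b i * B g (var c))"
  proof -
    have "con2 S h (\<lambda>b c. Xv i c * B g (var b)) = con2 S h (\<lambda>b c. Xv i b * B g (var c))"
      by (rule con2_swap)
    moreover have "con2 S h (\<lambda>b c. Xv b i * B g (var c)) = - con2 S h (\<lambda>b c. Xv i b * B g (var c))"
      by (subst B_anti) (simp add: con_uminus)
    ultimately show ?thesis
      using N_con2[OF S, of i] by (simp add: con_add con_mult con_mult_right algebra_simps)
  qed
  have 7: "con1 S h (\<lambda>b. - 2 * Z b i g - 2 * B (Xv i b) g) =
      con1 S h (\<lambda>b. 2 * (B (Xv i b) g - Z i b g)) - 6 * con1 S h (\<lambda>b. B g (Xv b i))"
  proof -
    have eq: "- 2 * Z b i g - 2 * B (Xv i b) g = 2 * (B (Xv i b) g - Z i b g) - 6 * B g (Xv b i)" for b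
      unfolding Z_swap[of b i] B_Xv_left[of i b] by simp
    show ?thesis
      unfolding eq con_diff con_mult ..
  qed
  have 8: "6 * B (B (var i) g) h = 6 * B (var i) (B g h) +
      6 * con1 S h (\<lambda>b. B g (Xv b i)) + 6 * con2 S h (\<lambda>b c. Xv b i * B g (var c))"
    unfolding diff_eq_eq[THEN iffD1, OF 5] by (simp add: distrib_left)
  show "24 * (star_coeff2 B (var i * g) h + star_coeff1 B (star_coeff1 B (var i) g) h + star_coeff2 B (var i) g * h) =
    24 * (var i * star_coeff2 B g h + star_coeff1 B (var i) (star_coeff1 B g h) + star_coeff2 B (var i) (g * h))"
    unfolding distrib_left[of 24] 2 3 4 8 1 6 7 by (simp add: algebra_simps)
qed

section \<open>The order 3 obstruction by number of derivatives on the third factor\<close>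

context
  fixes i :: 'i and g :: "('i, 'k) mpol" and S :: "'i set"
  assumes S: "finite S" "i \<in> S" "vars g \<subseteq> S"
begin

text \<open>The coefficient of \<open>D [b] h\<close> in 48 times the difference of the two sides.
  \<open>N_commutator\<close> reduces it to contractions with first and second derivatives of
  \<open>g\<close>. The first order family \<open>?U\<close> cancels by antisymmetry; the second
  order family \<open>?V\<close> turns out to be antisymmetric, with the Jacobi identity entering
  through \<open>Z_swap\<close>.\<close>

lemma order3_con1:
  "2 * B (N i g) (var b) + 2 * N b (B (var i) g) - 2 * B (var i) (N b g) - 2 * N i (B g (var b))
    - con1 S g (\<lambda>a. - 2 * N i (Xv a b) + - 2 * N a (Xv i b))
    - con1 S g (\<lambda>a. - 2 * N a (Xv b i) + - 2 * N b (Xv a i))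
    - con2 S g (\<lambda>a d. Y a d (Xv b i) + Y i d (Xv b a) + Y d i (Xv b a))
    - con2 S g (\<lambda>a d. Y a d (Xv i b) + Y b d (Xv i a) + Y d b (Xv i a)) = 0" (is "?L = 0")
proof -
  define K where "K a b k l = B (P a k l) (var b) - B (Xv a k) (Xv l b) + Z a k (Xv l b)" for a b k l
  have K: "B (N a g) (var b) - N a (B g (var b)) = con2 S g (K a b) - con1 S g (\<lambda>k. N a (Xv k b))" for a b
    unfolding N_commutator[OF S(1,3)] by (simp add: con1_def con2_def K_def pderiv1_commute)
  have N_uminus: "N a (- u) = - N a u" for a u
    using N_add[of a u "- u"] by (simp add: N_def[of _ 0] eq_neg_iff_add_eq_0 add.commute)
  have "2 * N b (B (var i) g) - 2 * B (var i) (N b g) = 2 * (B (N b g) (var i) - N b (B g (var i)))"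
    by (simp add: B_anti[of "var i"] N_uminus algebra_simps)
  then have "?L = 2 * (B (N i g) (var b) - N i (B g (var b))) + 2 * (B (N b g) (var i) - N b (B g (var i)))
    - con1 S g (\<lambda>a. - 2 * N i (Xv a b) + - 2 * N a (Xv i b))
    - con1 S g (\<lambda>a. - 2 * N a (Xv b i) + - 2 * N b (Xv a i))
    - con2 S g (\<lambda>a d. Y a d (Xv b i) + Y i d (Xv b a) + Y d i (Xv b a))
    - con2 S g (\<lambda>a d. Y a d (Xv i b) + Y b d (Xv i a) + Y d b (Xv i a))"
    by (simp add: algebra_simps)
  also have "\<dots> = con2 S g (\<lambda>a d. 2 * K i b a d + 2 * K b i a d - (Y a d (Xv b i) + Y i d (Xv b a) + Y d i (Xv b a))
      - (Y a d (Xv i b) + Y b d (Xv i a) + Y d b (Xv i a)))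
    + con1 S g (\<lambda>a. - 2 * N i (Xv a b) - 2 * N b (Xv a i) - (- 2 * N i (Xv a b) + - 2 * N a (Xv i b))
      - (- 2 * N a (Xv b i) + - 2 * N b (Xv a i)))" (is "_ = con2 S g ?V + con1 S g ?U")
    unfolding K by (simp add: con_add con_diff con_mult con_uminus)
  also have "?U = (\<lambda>a. 0)"
  proof
    fix a
    have "N a (Xv i b) = - N a (Xv b i)"
      by (subst B_anti) (rule N_uminus)
    then show "?U a = 0"
      by simp
  qed
  also have "con2 S g ?V = 0"
  proof (rule con2_eq_0)
    \<comment> \<open>In this form, exchanging \<open>a\<close> and \<open>d\<close> pairs the first
      summand with the third and the second with the fourth, with opposite signs.\<close>
    have V: "?V a d = 2 * Z i a (Xv d b) + 2 * Z b a (Xv d i) + 2 * Z i d (Xv b a) + 2 * Z b d (Xv i a)" for a d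
    proof -
      have "Y a d (Xv i b) = - Y a d (Xv b i)"
        by (subst B_anti) (simp add: Y_def B_uminus_left Z_uminus)
      then show ?thesis
        unfolding K_def Y_commute[of i d] Y_commute[of b d]
        by (simp add: Y_def[of d] Z_swap[of d])
    qed
    show "?V a d + ?V d a = 0" for a d
      unfolding V
      unfolding B_anti[of "var b" "var a"] B_anti[of "var b" "var d"]
        B_anti[of "var i" "var a"] B_anti[of "var i" "var d"]
      by (simp add: Z_uminus)
  qed
  finally show ?thesis
    by (simp add: con_0)
qed

text \<open>\<open>E b c\<close> is the coefficient of \<open>D [b, c] h\<close> in 48 times the
  difference of the two sides. Its terms of order two in \<open>g\<close> combine to commutators of
  derivations only after \<open>E c b\<close> is added, since several of them find their partner
  with \<open>b\<close> and \<open>c\<close> exchanged.\<close>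

lemma order3_con2:
  defines "E \<equiv> \<lambda>b c. 2 * Z b c (B (var i) g) + 3 * Y b c (B (var i) g)
      - B (var i) (2 * Z b c g + 3 * Y b c g) - 2 * N b g * Xv i c
      - 2 * (B (Xv i c) (B g (var b)) - Z i c (B g (var b)))
      - con1 S g (\<lambda>a. Y b c (Xv i a) + Y a c (Xv i b) + Y c a (Xv i b))
      + con1 S g (\<lambda>a. Z i b (Xv c a) + Z a b (Xv c i)) - con1 S g (\<lambda>a. Z b i (Xv a c) + Z b a (Xv i c))
      + con2 S g (\<lambda>a d. 2 * P b i a * Xv d c + 2 * P b a i * Xv d c + 2 * P b a d * Xv i c)"
  shows "E b c + E c b = 0"
proof -
  \<comment> \<open>\<open>C\<close> gathers the coefficients that are contracted with first
    derivatives of \<open>g\<close>, including those split off when contractions of \<open>P\<close>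
    with second derivatives are rewritten as brackets.\<close>
  define C where "C a b c = - 2 * B (P b i a) (var c) - 2 * B (P b a i) (var c)
      - (Y b c (Xv i a) + Y a c (Xv i b) + Y c a (Xv i b))
      + (Z i b (Xv c a) + Z a b (Xv c i)) - (Z b i (Xv a c) + Z b a (Xv i c))" for a b c
  note S' = S(1,3)
  have E: "E b c = - (Z b c (B (var i) g) - B (var i) (Z b c g)) - B (B (Xv i b) g) (var c)
      + B (Xv i c) (B g (var b)) + 2 * (Z i c (B g (var b)) - B (Z i b g) (var c)) + con1 S g (\<lambda>a. C a b c)"
    for b c
  proof -
    have 1: "con2 S g (\<lambda>a d. P b i a * Xv d c) =
        B (B (Xv b i) g) (var c) - con1 S g (\<lambda>a. B (P b i a) (var c))"
      using derivation_of_con1[OF S' derivation_B_left, of "P b i" "var c"]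
        B_con1_right[OF S', of "Xv b i"] by simp
    have 2: "con2 S g (\<lambda>a d. P b a i * Xv d c) =
        - B (Z b i g) (var c) - con1 S g (\<lambda>a. B (P b a i) (var c))"
    proof -
      have "con1 S g (\<lambda>a. P b a i) = - Z b i g"
        using Z_con1[OF S', of b i] by (simp add: B_anti[of "var b"] B_uminus_left con_uminus)
      then show ?thesis
        using derivation_of_con1[OF S' derivation_B_left, of "\<lambda>a. P b a i" "var c"]
        by (simp add: B_uminus_left)
    qed
    have 3: "con2 S g (\<lambda>a d. 2 * P b i a * Xv d c + 2 * P b a i * Xv d c + 2 * P b a d * Xv i c) =
        2 * (B (B (Xv b i) g) (var c) - con1 S g (\<lambda>a. B (P b i a) (var c)))
        + 2 * (- B (Z b i g) (var c) - con1 S g (\<lambda>a. B (P b a i) (var c))) + 2 * N b g * Xv i c"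
      unfolding 1[symmetric] 2[symmetric] N_con2[OF S', symmetric]
      by (simp only: con_add con_mult con_mult_right mult.assoc) (simp add: mult_ac)
    have 4: "B (B (var i) g) (var b) - B (var i) (B g (var b)) = B (Xv i b) g" for b
      unfolding B_jacobi' by (rule B_Xv_left[symmetric])
    \<comment> \<open>After unfolding \<open>Y\<close>, the bracket with \<open>var i\<close> is
      moved outward past \<open>var b\<close> and then past \<open>var c\<close>, at the cost of one
      Jacobi term each time.\<close>
    have 5: "Y b c (B (var i) g) - B (var i) (Y b c g) =
        B (B (Xv i b) g) (var c) + B (Xv i c) (B g (var b)) - (Z b c (B (var i) g) - B (var i) (Z b c g))"
    proof -
      have "B (B (B (var i) g) (var b)) (var c) =
          B (B (var i) (B g (var b))) (var c) + B (B (Xv i b) g) (var c)"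
        unfolding 4[symmetric] by (simp add: B_diff_left)
      moreover have "B (B (var i) (B g (var b))) (var c) =
          B (var i) (B (B g (var b)) (var c)) + B (Xv i c) (B g (var b))"
        unfolding diff_eq_eq[THEN iffD1, OF B_jacobi'[of "var i" "B g (var b)" "var c"]]
          B_Xv_left[of i c "B g (var b)"] by (rule add.commute)
      ultimately show ?thesis
        by (simp add: Y_def B_diff_right)
    qed
    have 6: "B (Z b i g) (var c) = B (Z i b g) (var c) + B (B (Xv i b) g) (var c)"
      unfolding Z_swap[of b i] B_Xv_left[of i b] by (simp add: B_add_left)
    have 7: "B (B (Xv b i) g) (var c) = - B (B (Xv i b) g) (var c)"
      unfolding B_anti[of "var b" "var i"] by (simp add: B_uminus_left)
    have 8: "2 * Z b c (B (var i) g) + 3 * Y b c (B (var i) g) - B (var i) (2 * Z b c g + 3 * Y b c g) =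
        2 * (Z b c (B (var i) g) - B (var i) (Z b c g)) + 3 * (Y b c (B (var i) g) - B (var i) (Y b c g))"
      by (simp add: B_add_right B_numeral_right algebra_simps)
    show ?thesis
      unfolding E_def 3 8 5 6 7 C_def
      by (simp add: con_add con_diff con_mult con_uminus algebra_simps)
  qed
  \<comment> \<open>The value on \<open>var a\<close> of the derivation into which the sum will be
    turned, before symmetrization in \<open>b\<close> and \<open>c\<close>.\<close>
  define R where "R a b c = - (Z b c (Xv i a) - B (var i) (P a b c)) + B (var a) (P i c b)
      + 2 * (Z i c (Xv a b) - B (P a i c) (var b)) + C a b c" for a b c
  \<comment> \<open>Regrouped across \<open>E b c\<close> and \<open>E c b\<close>, so that every
    difference is a commutator of two derivations applied to \<open>g\<close>.\<close>
  have "E b c + E c b =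
      - (Z b c (B (var i) g) - B (var i) (Z b c g)) - (Z c b (B (var i) g) - B (var i) (Z c b g))
      + (B (Xv i c) (B g (var b)) - B (B (Xv i c) g) (var b))
      + (B (Xv i b) (B g (var c)) - B (B (Xv i b) g) (var c))
      + 2 * (Z i c (B g (var b)) - B (Z i c g) (var b)) + 2 * (Z i b (B g (var c)) - B (Z i b g) (var c))
      + con1 S g (\<lambda>a. C a b c) + con1 S g (\<lambda>a. C a c b)"
    unfolding E by (simp add: algebra_simps)
  also have "\<dots> = con1 S g (\<lambda>a. R a b c + R a c b)"
  proof -
    have 1: "Z b c (B (var i) g) - B (var i) (Z b c g) = con1 S g (\<lambda>a. Z b c (Xv i a) - B (var i) (P a b c))" for b c
      using derivation_commutator[OF S' derivation_Z derivation_B_right, of b c "var i"] by simp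
    have 2: "B (Xv i c) (B g (var b)) - B (B (Xv i c) g) (var b) = con1 S g (\<lambda>a. B (var a) (P i c b))" for b c
    proof -
      have "B (Xv i c) (B g (var b)) - B (B (Xv i c) g) (var b) = - B g (B (var b) (Xv i c))"
        unfolding diff_eq_eq[THEN iffD1, OF B_jacobi'[of "Xv i c" g "var b"]] by simp
      also have "\<dots> = B g (P i c b)"
        by (subst B_anti[of "var b"]) (simp add: B_uminus_right)
      finally show ?thesis
        by (simp add: B_con1_left[OF S'])
    qed
    have 3: "Z i c (B g (var b)) - B (Z i c g) (var b) = con1 S g (\<lambda>a. Z i c (Xv a b) - B (P a i c) (var b))" for b c
      using derivation_commutator[OF S' derivation_Z derivation_B_left, of i c "var b"] by simp
    show ?thesis
      unfolding 1 2 3 R_def by (simp only: con_add con_diff con_mult con_uminus) (simp add: algebra_simps)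
  qed
  also have "(\<lambda>a. R a b c + R a c b) = (\<lambda>a. 0)"
  proof
    fix a
    \<comment> \<open>The rules that follow choose one representative among terms related by
      antisymmetry or the Jacobi identity. \<open>cyc\<close> is the Jacobi identity for three
      variables, \<open>q\<close> the one for \<open>Xv a b\<close> and two variables; after these
      replacements the terms cancel linearly.\<close>
    have Zm: "Z k l (Xv e d) = - Z k l (Xv d e)" for k l d e
      by (subst B_anti) (rule Z_uminus)
    have Pm: "P e d k = - P d e k" for d e k
      by (subst B_anti[of "var e" "var d"]) (rule B_uminus_left)
    have PPm: "B (P e d k) u = - B (P d e k) u" for d e k u
      by (subst Pm) (rule B_uminus_left)
    have cyc: "B (P a b i) u = B (P i b a) u - B (P i a b) u" for a b u
    proof -
      have "P a b i = P i b a + P a i b"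
        using diff_eq_eq[THEN iffD1, OF B_jacobi'[of "var a" "var b" "var i"]]
        unfolding B_Xv_left[of i b "var a"] B_Xv_left[of a i "var b"] by (simp only: add.commute)
      then show ?thesis
        unfolding Pm[of a i b] by (simp add: B_diff_left)
    qed
    have q: "B (P a b c) (var d) = B (Xv a b) (Xv c d) + B (P a b d) (var c)" for a b c d
    proof -
      have "B (var c) (B (var d) (Xv a b)) = B (P a b d) (var c)"
        unfolding B_anti[of "var d"] B_anti[of "var c"] B_uminus_left by simp
      then show ?thesis
        unfolding diff_eq_eq[THEN iffD1, OF B_jacobi'[of "Xv a b" "var c" "var d"]] by simp
    qed
    have XX: "B (Xv a c) (Xv b i) = - B (Xv i b) (Xv c a)" "B (Xv i c) (Xv b a) = - B (Xv a b) (Xv c i)"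
      unfolding B_Xv_left[of i b "Xv c a"] B_Xv_left[of a b "Xv c i"]
        B_anti[of "var a" "var c"] B_anti[of "var i" "var c"] by (simp_all only: B_uminus_left)
    show "R a b c + R a c b = 0"
      unfolding R_def C_def Y_commute[of c a] Y_commute[of b a] Y_def
        Z_swap[of b i "Xv a c"] Z_swap[of c i "Xv a b"] Z_swap[of b a "Xv i c"] Z_swap[of c a "Xv i b"]
        Zm[of i b c a] Zm[of i c b a] Zm[of a b c i] Zm[of a c b i]
        B_anti[of "var i" "P a b c"] B_anti[of "var i" "P a c b"]
        B_anti[of "var a" "P i c b"] B_anti[of "var a" "P i b c"]
        PPm[of a i c "var b"] PPm[of a i b "var c"] PPm[of b i a "var c"] PPm[of c i a "var b"]
        PPm[of b a i "var c"] PPm[of c a i "var b"]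
        q[of a b c i] q[of a c b i] q[of i b c a] q[of i c b a]
        cyc[of a b "var c"] cyc[of a c "var b"] XX
      by (simp add: algebra_simps)
  qed
  finally show ?thesis
    by (simp add: con_0)
qed

text \<open>By antisymmetry the \<open>Z\<close> terms cancel against each other. The remaining
  terms are families that differ only by a permutation of \<open>b\<close>, \<open>c\<close>,
  \<open>d\<close>, which \<open>con3\<close> does not see.\<close>

lemma order3_con3:
  assumes h: "vars h \<subseteq> S"
  shows "con3 S h (\<lambda>b c d. Xv i b * Y c d g + Xv i c * Y b d g + Xv i d * Y b c g
    - (2 * P i b c * B (var d) g + 2 * Z b c g * Xv d i)
    - (2 * Z b c g + 3 * Y b c g) * Xv i d - 2 * B g (var b) * P i c d) = 0"
proof -
  define F G where "F b c d = Y b c g * Xv i d" and "G b c d = B (var b) g * P i c d" for b c d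
  have rot: "con3 S h (\<lambda>b c d. H c d b) = con3 S h H" for H
    using con3_swap[of S h "\<lambda>b c d. H b d c"] con3_swap'[of S h H] by simp
  have "con3 S h (\<lambda>b c d. Xv i b * Y c d g + Xv i c * Y b d g + Xv i d * Y b c g
    - (2 * P i b c * B (var d) g + 2 * Z b c g * Xv d i)
    - (2 * Z b c g + 3 * Y b c g) * Xv i d - 2 * B g (var b) * P i c d) =
    con3 S h (\<lambda>b c d. F c d b + F b d c + F b c d - 3 * F b c d - 2 * G d b c + 2 * G b c d)"
  proof -
    have "Xv i b * Y c d g + Xv i c * Y b d g + Xv i d * Y b c g
      - (2 * P i b c * B (var d) g + 2 * Z b c g * Xv d i)
      - (2 * Z b c g + 3 * Y b c g) * Xv i d - 2 * B g (var b) * P i c d =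
      F c d b + F b d c + F b c d - 3 * F b c d - 2 * G d b c + 2 * G b c d" for b c d
      unfolding F_def G_def B_anti[of "var d" "var i"] B_anti[of g "var b"] by (simp add: algebra_simps)
    then show ?thesis
      by simp
  qed
  also have "\<dots> = 0"
    by (simp only: con_add con_diff con_mult con3_swap'[of S h F] rot[of F] rot[of "\<lambda>b c d. G d b c", symmetric])
      simp
  finally show ?thesis .
qed

end

context
  fixes i :: 'i and g h :: "('i, 'k) mpol" and S :: "'i set"
  assumes S: "finite S" "i \<in> S" "vars g \<subseteq> S" "vars h \<subseteq> S"
begin

text \<open>At most one derivative can fall on \<open>var i\<close>. Apart from the multiple by
  \<open>var i\<close>, each contraction with \<open>g\<close> therefore loses exactly one index, in
  every possible position.\<close>

lemma p3_times_var:
  "48 * star_coeff3 B (var i * g) h = var i * (48 * star_coeff3 B g h)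
    + con2 S h (\<lambda>b c. g * (- 2 * N b (Xv c i)))
    + con2 S h (\<lambda>b c. con1 S g (\<lambda>a. Z i b (Xv c a) + Z a b (Xv c i)))
    - con2 S h (\<lambda>b c. con1 S g (\<lambda>a. Z b i (Xv a c) + Z b a (Xv i c)))
    + con2 S h (\<lambda>b c. con2 S g (\<lambda>a d. 2 * P b i a * Xv d c + 2 * P b a i * Xv d c + 2 * P b a d * Xv i c))
    - con1 S h (\<lambda>b. con1 S g (\<lambda>a. - 2 * N i (Xv a b) + - 2 * N a (Xv i b)))
    - con1 S h (\<lambda>b. con2 S g (\<lambda>a d. Y a d (Xv b i) + Y i d (Xv b a) + Y d i (Xv b a)))
    + con3 S h (\<lambda>b c d. Xv i b * Y c d g + Xv i c * Y b d g + Xv i d * Y b c g)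
    + con3 S h (\<lambda>b c d. g * Y c d (Xv i b))
    - con3 S h (\<lambda>b c d. 2 * P i b c * B (var d) g + 2 * Z b c g * Xv d i)"
proof -
  have v: "vars (var i * g) \<subseteq> S"
    using vars_mult[of "var i" g] vars_var[of i] S by blast
  have 1: "con2 S g (\<lambda>a e. Xv i b * Xv a c * Xv e d + Xv a b * Xv i c * Xv e d + Xv a b * Xv e c * Xv i d) =
      Xv i b * Y c d g + Xv i c * Y b d g + Xv i d * Y b c g" for b c d
  proof -
    have "Xv i b * Xv a c * Xv e d + Xv a b * Xv i c * Xv e d + Xv a b * Xv e c * Xv i d =
      Xv i b * (Xv a c * Xv e d) + Xv i c * (Xv a b * Xv e d) + Xv i d * (Xv a b * Xv e c)" for a e
      by (simp add: mult_ac)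
    then show ?thesis
      by (simp only: con_add con_mult Y_con2[OF S(1,3)])
  qed
  have 2: "con1 S g (\<lambda>a. 2 * P i b c * Xv d a + 2 * P a b c * Xv d i) =
      2 * P i b c * B (var d) g + 2 * Z b c g * Xv d i" for b c d
  proof -
    have "con1 S g (\<lambda>a. 2 * P i b c * Xv d a + 2 * P a b c * Xv d i) =
        2 * P i b c * con1 S g (Xv d) + Xv d i * (2 * con1 S g (\<lambda>a. P a b c))"
      by (simp only: con_add con_mult con_mult_right)
    then show ?thesis
      unfolding B_con1_right[OF S(1,3), of "var d"] Z_con1[OF S(1,3)] by (simp only: mult.commute)
  qed
  show ?thesis
    unfolding p3_scaled[OF S(1) v S(4)] p3_scaled[OF S(1,3,4)] con_times_var[OF S(1,2)] 1 2
    by (simp only: con_add[of S h] con_diff[of S h] con_mult[of S h "var i"])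
      (simp only: distrib_left right_diff_distrib diff_conv_add_uminus minus_add_distrib minus_minus mult_minus_right add_ac)
qed

lemma associative_order3:
  "star_coeff3 B (var i * g) h + star_coeff2 B (star_coeff1 B (var i) g) h +
     star_coeff1 B (star_coeff2 B (var i) g) h + star_coeff3 B (var i) g * h =
   var i * star_coeff3 B g h + star_coeff1 B (var i) (star_coeff2 B g h) +
     star_coeff2 B (var i) (star_coeff1 B g h) + star_coeff3 B (var i) (g * h)"
\<comment> \<open>The numeral is 48. It also clears the compositions of the first with the second
  coefficient, whose denominators are 2 and 24.\<close>
proof (rule numeral_mult_cancel[where n = "num.Bit0 (num.Bit0 (num.Bit0 (num.Bit0 (num.Bit1 num.One))))"])
  \<comment> \<open>The letters name the source: \<open>A\<close> is
    \<open>star_coeff3 B (var i * g) h\<close>, \<open>B\<close> and \<open>C\<close> are the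
    compositions on the left, \<open>D\<close> and \<open>E\<close> those on the right, and
    \<open>F\<close> is \<open>star_coeff3 B (var i) (g * h)\<close>; the digit counts derivatives
    of \<open>h\<close>. \<open>W\<close> and \<open>Q\<close> are the coefficients of
    \<open>star_coeff3 B (var i)\<close>; their contractions with \<open>h\<close>, multiplied by
    \<open>g\<close>, occur on both sides.\<close>
  define W where "W = (\<lambda>b c. - 2 * N b (Xv c i))"
  define Q where "Q = (\<lambda>b c d. Y c d (Xv i b))"
  define A1 where "A1 = (\<lambda>b. con1 S g (\<lambda>a. - 2 * N i (Xv a b) + - 2 * N a (Xv i b)))"
  define A1' where "A1' = (\<lambda>b. con2 S g (\<lambda>a d. Y a d (Xv b i) + Y i d (Xv b a) + Y d i (Xv b a)))"
  define A2 where "A2 = (\<lambda>b c. con1 S g (\<lambda>a. Z i b (Xv c a) + Z a b (Xv c i)))"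
  define A2' where "A2' = (\<lambda>b c. con1 S g (\<lambda>a. Z b i (Xv a c) + Z b a (Xv i c)))"
  define A2'' where "A2'' = (\<lambda>b c. con2 S g (\<lambda>a d. 2 * P b i a * Xv d c + 2 * P b a i * Xv d c + 2 * P b a d * Xv i c))"
  define A3 where "A3 = (\<lambda>b c d. Xv i b * Y c d g + Xv i c * Y b d g + Xv i d * Y b c g)"
  define A3' where "A3' = (\<lambda>b c d. 2 * P i b c * B (var d) g + 2 * Z b c g * Xv d i)"
  define B1 where "B1 = (\<lambda>b. 2 * N b (B (var i) g))"
  define B2 where "B2 = (\<lambda>b c. 2 * Z b c (B (var i) g) + 3 * Y b c (B (var i) g))"
  define C1 where "C1 = (\<lambda>b. 2 * B (N i g) (var b))"
  define D1 where "D1 = (\<lambda>b. 2 * B (var i) (N b g))"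
  define D2 where "D2 = (\<lambda>b c. B (var i) (2 * Z b c g + 3 * Y b c g))"
  define D2' where "D2' = (\<lambda>b c. 2 * N b g * Xv i c)"
  define D3 where "D3 = (\<lambda>b c d. (2 * Z b c g + 3 * Y b c g) * Xv i d)"
  define E1 where "E1 = (\<lambda>b. 2 * N i (B g (var b)))"
  define E2 where "E2 = (\<lambda>b c. 2 * (B (Xv i c) (B g (var b)) - Z i c (B g (var b))))"
  define E3 where "E3 = (\<lambda>b c d. 2 * B g (var b) * P i c d)"
  define F1 where "F1 = (\<lambda>b. con1 S g (\<lambda>a. W a b + W b a))"
  define F1' where "F1' = (\<lambda>b. con2 S g (\<lambda>a d. Q b a d + Q a b d + Q a d b))"
  define F2 where "F2 = (\<lambda>b c. con1 S g (\<lambda>a. Q a b c + Q b a c + Q b c a))"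
  have vgh: "vars (g * h) \<subseteq> S"
    using vars_mult[of g h] S by blast
  have tA: "48 * star_coeff3 B (var i * g) h = var i * (48 * star_coeff3 B g h) + g * con2 S h W
      + con2 S h A2 - con2 S h A2' + con2 S h A2'' - con1 S h A1 - con1 S h A1'
      + con3 S h A3 + g * con3 S h Q - con3 S h A3'"
    unfolding p3_times_var A1_def A1'_def A2_def A2'_def A2''_def A3_def A3'_def W_def Q_def
    by (simp only: con_mult)
  have tB: "48 * star_coeff2 B (star_coeff1 B (var i) g) h = con2 S h B2 + con1 S h B1"
  proof -
    have "48 * star_coeff2 B (star_coeff1 B (var i) g) h = 24 * star_coeff2 B (B (var i) g) h"
      using const_inverse_numeral[of "num.Bit0 num.One" "24 * star_coeff2 B (B (var i) g) h"]
      by (simp add: p1_eq p2_const_left mult.left_commute[of "const _"] flip: mult.assoc)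
    then show ?thesis
      by (simp only: p2_scaled[OF S(1,4)] B1_def B2_def)
  qed
  have tC: "48 * star_coeff1 B (star_coeff2 B (var i) g) h = con1 S h C1"
  proof -
    have "48 * star_coeff1 B (star_coeff2 B (var i) g) h =
        24 * (2 * star_coeff1 B (star_coeff2 B (var i) g) h)"
      by simp
    also have "\<dots> = B (24 * star_coeff2 B (var i) g) h"
      by (simp only: p1_scaled B_numeral_left)
    also have "\<dots> = con1 S h C1"
      unfolding p2_var_left B_numeral_left C1_def con_mult B_con1_right[OF S(1,4), symmetric] ..
    finally show ?thesis .
  qed
  have tD: "48 * star_coeff1 B (var i) (star_coeff2 B g h) =
      con2 S h D2 + con3 S h D3 + con1 S h D1 + con2 S h D2'"
  proof -
    have "48 * star_coeff1 B (var i) (star_coeff2 B g h) =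
        24 * (2 * star_coeff1 B (var i) (star_coeff2 B g h))"
      by simp
    also have "\<dots> = B (var i) (24 * star_coeff2 B g h)"
      by (simp only: p1_scaled B_numeral_right)
    also have "\<dots> = con2 S h D2 + con3 S h D3 + con1 S h D1 + con2 S h D2'"
      unfolding p2_scaled[OF S(1,4)] B_add_right[of _ "con2 _ _ _"]
        derivation_of_con1[OF S(1,4) derivation_B_right] derivation_of_con2[OF S(1,4) derivation_B_right]
        D1_def D2_def D2'_def D3_def B_numeral_right[of _ _ "N _ _"] by (simp only: add.assoc)
    finally show ?thesis .
  qed
  have tE: "48 * star_coeff2 B (var i) (star_coeff1 B g h) = con1 S h E1 + con3 S h E3 + con2 S h E2"
  proof -
    have "48 * star_coeff2 B (var i) (star_coeff1 B g h) = 24 * star_coeff2 B (var i) (B g h)"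
      using const_inverse_numeral[of "num.Bit0 num.One" "24 * star_coeff2 B (var i) (B g h)"]
      by (simp add: p1_eq p2_const_right mult.left_commute[of "const _"] flip: mult.assoc)
    also have "\<dots> = 2 * N i (con1 S h (\<lambda>b. B g (var b)))"
      by (simp only: p2_var_left flip: B_con1_right[OF S(1,4)])
    finally show ?thesis
      by (simp only: N_con1[OF S(1,4)] distrib_left con_mult E1_def E2_def E3_def mult.assoc)
  qed
  have tF: "48 * star_coeff3 B (var i) (g * h) = (48 * star_coeff3 B (var i) g) * h + g * con2 S h W
      + g * con3 S h Q + con1 S h F1 + con1 S h F1' + con2 S h F2"
    unfolding p3_var_left[OF S(1,2) vgh] p3_var_left[OF S(1,2,3)] con2_times con3_times
      F1_def F1'_def F2_def W_def[symmetric] Q_def[symmetric] by (simp add: algebra_simps)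
  have z1: "con1 S h (\<lambda>b. C1 b + B1 b - D1 b - E1 b - A1 b - F1 b - A1' b - F1' b) = 0"
    unfolding C1_def B1_def D1_def E1_def A1_def F1_def A1'_def F1'_def W_def Q_def
      order3_con1[OF S(1-3)] con_0 ..
  have z2: "con2 S h (\<lambda>b c. B2 b c - D2 b c - D2' b c - E2 b c - F2 b c + A2 b c - A2' b c + A2'' b c) = 0"
    unfolding B2_def D2_def D2'_def E2_def F2_def A2_def A2'_def A2''_def Q_def
    by (rule con2_eq_0) (rule order3_con2[OF S(1-3)])
  have z3: "con3 S h (\<lambda>b c d. A3 b c d - A3' b c d - D3 b c d - E3 b c d) = 0"
    unfolding A3_def A3'_def D3_def E3_def by (rule order3_con3[OF S])
  note z = z1[unfolded con_add con_diff] z2[unfolded con_add con_diff] z3[unfolded con_diff]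
  let ?L = "star_coeff3 B (var i * g) h + star_coeff2 B (star_coeff1 B (var i) g) h +
     star_coeff1 B (star_coeff2 B (var i) g) h + star_coeff3 B (var i) g * h"
  let ?R = "var i * star_coeff3 B g h + star_coeff1 B (var i) (star_coeff2 B g h) +
     star_coeff2 B (var i) (star_coeff1 B g h) + star_coeff3 B (var i) (g * h)"
  have "48 * ?L - 48 * ?R =
    (con1 S h C1 + con1 S h B1 - con1 S h D1 - con1 S h E1 - con1 S h A1 - con1 S h F1 - con1 S h A1' - con1 S h F1') +
    (con2 S h B2 - con2 S h D2 - con2 S h D2' - con2 S h E2 - con2 S h F2 + con2 S h A2 - con2 S h A2' + con2 S h A2'') +
    (con3 S h A3 - con3 S h A3' - con3 S h D3 - con3 S h E3)"
    unfolding distrib_left[of 48] tA tB tC tD tE tF by (simp add: algebra_simps)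
  then show "48 * ?L = 48 * ?R"
    unfolding z by simp
qed

end

end

section \<open>Associativity from generators\<close>

lemma fps_split: "F = fps_const (fps_nth F 0) + fps_X * fps_shift 1 (F :: 'a::comm_ring_1 fps)"
proof (rule fps_ext)
  fix n show "fps_nth F n = fps_nth (fps_const (fps_nth F 0) + fps_X * fps_shift 1 F) n"
    by (cases n) simp_all
qed

text \<open>The constant term of \<open>F\<close> is covered by the hypothesis, and the rest is a
  multiple of \<open>fps_X\<close>, which contributes one more power. Induction on the exponent thus
  replaces continuity and infinite sums.\<close>

lemma fps_X_power_dvd_linear:
  fixes \<Phi> :: "'a::comm_ring_1 fps \<Rightarrow> 'a fps"
  assumes add: "\<And>F G. \<Phi> (F + G) = \<Phi> F + \<Phi> G" and X: "\<And>F. \<Phi> (fps_X * F) = fps_X * \<Phi> F"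
    and const: "\<And>f. fps_X ^ n dvd \<Phi> (fps_const f)"
  shows "fps_X ^ n dvd \<Phi> F"
proof -
  have "fps_X ^ k dvd \<Phi> F" if "k \<le> n" for k
    using that
  proof (induction k arbitrary: F)
    case (Suc k)
    have "\<Phi> F = \<Phi> (fps_const (fps_nth F 0)) + fps_X * \<Phi> (fps_shift 1 F)"
      using add X fps_split[of F] by metis
    moreover have "fps_X ^ Suc k dvd \<Phi> (fps_const (fps_nth F 0))"
      using const Suc.prems by (rule power_le_dvd)
    moreover have "fps_X ^ Suc k dvd fps_X * \<Phi> (fps_shift 1 F)"
      using Suc.IH[of "fps_shift 1 F"] Suc.prems by (simp add: mult_dvd_mono)
    ultimately show ?case
      by (metis dvd_add)
  qed simp
  then show ?thesis
    by simp
qed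

context
  fixes p :: "('i, 'k::field_char_0) mpol \<Rightarrow> ('i, 'k) mpol \<Rightarrow> ('i, 'k) mpol"
  assumes p: "bilin p"
begin

lemma bilin_add_left: "p (f + g) h = p f h + p g h"
  and bilin_add_right: "p h (f + g) = p h f + p h g"
  and bilin_const_left: "p (const c * f) h = const c * p f h"
  and bilin_const_right: "p f (const c * h) = const c * p f h"
  using p unfolding bilin_def by blast+

lemma bilin_0_left [simp]: "p 0 h = 0"
  using bilin_const_left[of 0 0] by simp

lemma bilin_0_right [simp]: "p h 0 = 0"
  using bilin_const_right[of h 0 0] by simp

lemma bilin_sum_left: "p (\<Sum>a\<in>A. f a) h = (\<Sum>a\<in>A. p (f a) h)"
  by (induction A rule: infinite_finite_induct) (simp_all add: bilin_add_left)

lemma bilin_sum_right: "p h (\<Sum>a\<in>A. f a) = (\<Sum>a\<in>A. p h (f a))"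
  by (induction A rule: infinite_finite_induct) (simp_all add: bilin_add_right)

lemma ext_add_left: "ext p (F + G) H = ext p F H + ext p G H"
  by (rule fps_ext) (simp add: ext_def bilin_add_left sum.distrib)

lemma ext_add_right: "ext p H (F + G) = ext p H F + ext p H G"
  by (rule fps_ext) (simp add: ext_def bilin_add_right sum.distrib)

lemma ext_X_left: "ext p (fps_X * F) G = fps_X * ext p F G"
proof (rule fps_ext)
  fix n show "fps_nth (ext p (fps_X * F) G) n = fps_nth (fps_X * ext p F G) n"
    by (cases n) (simp_all add: ext_def sum.atMost_Suc_shift del: sum.atMost_Suc)
qed

lemma ext_X_right: "ext p F (fps_X * G) = fps_X * ext p F G"
proof (rule fps_ext)
  fix n show "fps_nth (ext p F (fps_X * G)) n = fps_nth (fps_X * ext p F G) n"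
    by (cases n) (simp_all add: ext_def Suc_diff_le)
qed

lemma ext_const_left: "fps_nth (ext p (fps_const f) G) n = p f (fps_nth G n)"
proof -
  have "fps_nth (ext p (fps_const f) G) n = (\<Sum>i\<le>n. if i = 0 then p f (fps_nth G n) else 0)"
    unfolding ext_def fps_nth_Abs_fps by (rule sum.cong) auto
  then show ?thesis
    by simp
qed

lemma ext_const_right: "fps_nth (ext p F (fps_const g)) n = p (fps_nth F n) g"
proof -
  have "fps_nth (ext p F (fps_const g)) n = (\<Sum>i\<le>n. if i = n then p (fps_nth F n) g else 0)"
    unfolding ext_def fps_nth_Abs_fps by (rule sum.cong) auto
  then show ?thesis
    by simp
qed

lemma ext_const: "ext p (fps_const f) (fps_const g) = fps_const (p f g)"
  by (rule fps_ext) (simp add: ext_const_left)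

lemma ext_scalar_left: "ext p (fps_const (const c) * F) G = fps_const (const c) * ext p F G"
  by (rule fps_ext) (simp add: ext_def bilin_const_left sum_distrib_left)

end

lemma bilin_times: "bilin ((*) :: ('i, 'k::field_char_0) mpol \<Rightarrow> _)"
  by (simp add: bilin_def algebra_simps)

section \<open>The star product of three bilinear maps and its associator\<close>

context
  fixes p1 p2 p3 :: "('i, 'k::field_char_0) mpol \<Rightarrow> ('i, 'k) mpol \<Rightarrow> ('i, 'k) mpol"
  assumes bilin: "bilin p1" "bilin p2" "bilin p3"
begin

private abbreviation (input) star_product (infixl "\<star>" 70) where
  "F \<star> G \<equiv> star p1 p2 p3 F G"

private abbreviation (input) associator where
  "associator F G H \<equiv> F \<star> G \<star> H - F \<star> (G \<star> H)"

lemma star_add_left: "(F + G) \<star> H = F \<star> H + G \<star> H"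
  by (simp add: star_def ext_add_left[OF bilin(1)] ext_add_left[OF bilin(2)]
      ext_add_left[OF bilin(3)] ext_add_left[OF bilin_times] distrib_left add_ac mult.left_commute)

lemma star_add_right: "H \<star> (F + G) = H \<star> F + H \<star> G"
  by (simp add: star_def ext_add_right[OF bilin(1)] ext_add_right[OF bilin(2)]
      ext_add_right[OF bilin(3)] ext_add_right[OF bilin_times] distrib_left add_ac mult.left_commute)

lemma star_X_left: "(fps_X * F) \<star> G = fps_X * (F \<star> G)"
  by (simp add: star_def ext_X_left[OF bilin(1)] ext_X_left[OF bilin(2)]
      ext_X_left[OF bilin(3)] ext_X_left[OF bilin_times] distrib_left add_ac mult.left_commute)

lemma star_X_right: "F \<star> (fps_X * G) = fps_X * (F \<star> G)"
  by (simp add: star_def ext_X_right[OF bilin(1)] ext_X_right[OF bilin(2)]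
      ext_X_right[OF bilin(3)] ext_X_right[OF bilin_times] distrib_left add_ac mult.left_commute)

lemma star_X_power_left: "(fps_X ^ n * F) \<star> G = fps_X ^ n * (F \<star> G)"
  by (induction n) (simp_all add: star_X_left mult.assoc)

lemma star_X_power_right: "F \<star> (fps_X ^ n * G) = fps_X ^ n * (F \<star> G)"
  by (induction n) (simp_all add: star_X_right mult.assoc)

lemma star_diff_left: "(F - G) \<star> H = F \<star> H - G \<star> H"
  using star_add_left[of "F - G" G H] by simp

lemma star_diff_right: "H \<star> (F - G) = H \<star> F - H \<star> G"
  using star_add_right[of H "F - G" G] by simp

lemma star_0_right [simp]: "H \<star> 0 = 0"
  using star_diff_right[of H 0 0] by simp

lemma star_sum_right: "H \<star> (\<Sum>a\<in>A. F a) = (\<Sum>a\<in>A. H \<star> F a)"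
  by (induction A rule: infinite_finite_induct) (simp_all add: star_add_right)

lemma star_const: "fps_const f \<star> fps_const g = fps_const (f * g) + fps_X * fps_const (p1 f g) +
    fps_X ^ 2 * fps_const (p2 f g) + fps_X ^ 3 * fps_const (p3 f g)"
  by (simp only: star_def ext_const[OF bilin(1)] ext_const[OF bilin(2)]
      ext_const[OF bilin(3)] ext_const[OF bilin_times])

lemma dvd_star_left: "fps_X ^ n dvd F \<Longrightarrow> fps_X ^ n dvd F \<star> G"
  by (auto simp: star_X_power_left elim!: dvdE)

lemma dvd_star_right: "fps_X ^ n dvd G \<Longrightarrow> fps_X ^ n dvd F \<star> G"
  by (auto simp: star_X_power_right elim!: dvdE)

text \<open>The hypotheses are the coefficients of \<open>h\<close>, \<open>h^2\<close> and
  \<open>h^3\<close> in the associator; that of \<open>h^0\<close> is associativity of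
  polynomials.\<close>

lemma associator_const:
  assumes "p1 (x * g) h + p1 x g * h = x * p1 g h + p1 x (g * h)"
    and "p2 (x * g) h + p1 (p1 x g) h + p2 x g * h = x * p2 g h + p1 x (p1 g h) + p2 x (g * h)"
    and "p3 (x * g) h + p2 (p1 x g) h + p1 (p2 x g) h + p3 x g * h =
      x * p3 g h + p1 x (p2 g h) + p2 x (p1 g h) + p3 x (g * h)"
  shows "fps_X ^ 4 dvd associator (fps_const x) (fps_const g) (fps_const h)"
proof -
  note simps = star_add_left star_add_right star_X_left star_X_right star_X_power_left star_X_power_right
    star_const
  \<comment> \<open>\<open>L\<close> and \<open>R\<close> are the terms from \<open>h^4\<close> to
    \<open>h^6\<close> of the two iterated products, divided by \<open>h^4\<close>.\<close>
  define L where "L = fps_const (p1 (p3 x g) h + p2 (p2 x g) h + p3 (p1 x g) h)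
    + fps_X * fps_const (p2 (p3 x g) h + p3 (p2 x g) h) + fps_X ^ 2 * fps_const (p3 (p3 x g) h)"
  define R where "R = fps_const (p1 x (p3 g h) + p2 x (p2 g h) + p3 x (p1 g h))
    + fps_X * fps_const (p2 x (p3 g h) + p3 x (p2 g h)) + fps_X ^ 2 * fps_const (p3 x (p3 g h))"
  have "fps_const x \<star> fps_const g \<star> fps_const h = fps_const (x * g * h)
      + fps_X * fps_const (p1 (x * g) h + p1 x g * h)
      + fps_X ^ 2 * fps_const (p2 (x * g) h + p1 (p1 x g) h + p2 x g * h)
      + fps_X ^ 3 * fps_const (p3 (x * g) h + p2 (p1 x g) h + p1 (p2 x g) h + p3 x g * h) + fps_X ^ 4 * L"
    unfolding L_def simps
    by (simp add: distrib_left fps_const_add[symmetric] del: fps_const_add fps_const_mult)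
      (simp add: eval_nat_numeral mult_ac add_ac)
  moreover have "fps_const x \<star> (fps_const g \<star> fps_const h) = fps_const (x * g * h)
      + fps_X * fps_const (x * p1 g h + p1 x (g * h))
      + fps_X ^ 2 * fps_const (x * p2 g h + p1 x (p1 g h) + p2 x (g * h))
      + fps_X ^ 3 * fps_const (x * p3 g h + p1 x (p2 g h) + p2 x (p1 g h) + p3 x (g * h)) + fps_X ^ 4 * R"
    unfolding R_def simps
    by (simp add: distrib_left fps_const_add[symmetric] del: fps_const_add fps_const_mult)
      (simp add: eval_nat_numeral mult_ac add_ac)
  ultimately have "associator (fps_const x) (fps_const g) (fps_const h) = fps_X ^ 4 * (L - R)"
    unfolding assms by (simp add: right_diff_distrib)
  then show ?thesis
    by simp
qed

lemma associator_const_left: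
  assumes "\<And>g h. fps_X ^ n dvd associator (fps_const x) (fps_const g) (fps_const h)"
  shows "fps_X ^ n dvd associator (fps_const x) G H"
proof -
  have "fps_X ^ n dvd associator (fps_const x) (fps_const g) H" for g
    by (rule fps_X_power_dvd_linear[where \<Phi> = "associator (fps_const x) (fps_const g)"])
      (simp_all only: star_add_right star_X_right add_diff_add right_diff_distrib assms)
  then show ?thesis
    by (rule fps_X_power_dvd_linear[where \<Phi> = "\<lambda>G. associator (fps_const x) G H", rotated 2])
      (simp_all only: star_add_right star_X_right star_add_left star_X_left add_diff_add right_diff_distrib)
qed

lemma star_const_const_left:
  assumes unit: "\<And>g. p1 1 g = 0" "\<And>g. p2 1 g = 0" "\<And>g. p3 1 g = 0"
  shows "fps_const (const c) \<star> G = fps_const (const c) * G"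
proof -
  have "p1 (const c) g = 0" "p2 (const c) g = 0" "p3 (const c) g = 0" for g
    using bilin_const_left[OF bilin(1), of c 1 g] bilin_const_left[OF bilin(2), of c 1 g]
      bilin_const_left[OF bilin(3), of c 1 g] unit by simp_all
  then have "ext p1 (fps_const (const c)) G = 0" "ext p2 (fps_const (const c)) G = 0"
    "ext p3 (fps_const (const c)) G = 0"
    by (auto intro!: fps_ext simp: ext_const_left[OF bilin(1)] ext_const_left[OF bilin(2)]
        ext_const_left[OF bilin(3)])
  moreover have "ext (*) (fps_const (const c)) G = fps_const (const c) * G"
    by (rule fps_ext) (simp add: ext_const_left[OF bilin_times])
  ultimately show ?thesis
    by (simp add: star_def)
qed

text \<open>The outer induction on the power of \<open>h\<close> treats all triples at once, because
  the inner one, on the polynomial in the first slot, produces an arbitrary correction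
  \<open>T\<close> that comes with a factor \<open>h\<close>.\<close>

lemma associator_from_var:
  assumes unit: "\<And>g. p1 1 g = 0" "\<And>g. p2 1 g = 0" "\<And>g. p3 1 g = 0"
    and var: "\<And>i g h. fps_X ^ m dvd associator (fps_const (var i)) (fps_const g) (fps_const h)"
  shows "fps_X ^ m dvd associator F G H"
proof -
  have "fps_X ^ n dvd associator F G H" if "n \<le> m" for n
    using that
  proof (induction n arbitrary: F G H)
    case (Suc n)
    have var': "fps_X ^ Suc n dvd associator (fps_const (var i)) G H" for i G H
      using associator_const_left[OF var] Suc.prems by (rule power_le_dvd)
    have "fps_X ^ Suc n dvd associator (fps_const f) G H" for f
    proof (induction f rule: mpol_induct)
      case (const c)
      have "fps_const (const c) * G \<star> H = fps_const (const c) * (G \<star> H)"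
        by (simp add: star_def ext_scalar_left[OF bilin(1)] ext_scalar_left[OF bilin(2)]
            ext_scalar_left[OF bilin(3)] ext_scalar_left[OF bilin_times]
            distrib_left mult.left_commute)
      then show ?case
        by (simp add: star_const_const_left[OF unit])
    next
      case (add f g)
      then have "fps_X ^ Suc n dvd associator (fps_const f) G H + associator (fps_const g) G H"
        by (rule dvd_add)
      then show ?case
        by (simp add: star_add_left add_diff_add flip: fps_const_add)
    next
      case (var i f)
      let ?x = "fps_const (var i)" and ?f = "fps_const f"
      define T where "T = fps_const (p1 (var i) f) + fps_X * fps_const (p2 (var i) f) +
        fps_X ^ 2 * fps_const (p3 (var i) f)"
      have "?x \<star> ?f = fps_const (var i * f) + fps_X * T"
        unfolding star_const T_def by (simp add: eval_nat_numeral algebra_simps)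
      then have "fps_const (var i * f) = ?x \<star> ?f - fps_X * T"
        by simp
      then have "associator (fps_const (var i * f)) G H = associator (?x \<star> ?f) G H - fps_X * associator T G H"
        by (simp only: star_diff_left star_X_left) (simp add: right_diff_distrib)
      \<comment> \<open>The pentagon identity, valid for every biadditive product. Three associators
        on the right begin with the variable, and the fourth has the smaller first factor
        \<open>f\<close>.\<close>
      also have "associator (?x \<star> ?f) G H = associator ?x ?f G \<star> H + associator ?x (?f \<star> G) H
          + ?x \<star> associator ?f G H - associator ?x ?f (G \<star> H)"
        by (simp add: star_diff_left star_diff_right)
      finally have "associator (fps_const (var i * f)) G H = associator ?x ?f G \<star> H + associator ?x (?f \<star> G) H
          + ?x \<star> associator ?f G H - associator ?x ?f (G \<star> H) - fps_X * associator T G H" .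
      moreover have "fps_X ^ Suc n dvd fps_X * associator T G H"
        using Suc.IH[of T G H] Suc.prems by (simp add: mult_dvd_mono)
      ultimately show ?case
        using var'[of i] dvd_star_left[OF var'[of i ?f G]] dvd_star_right[OF var.IH]
        by (metis (no_types, lifting) dvd_add dvd_diff)
    qed
    then show ?case
      by (rule fps_X_power_dvd_linear[where \<Phi> = "\<lambda>F. associator F G H", rotated 2])
        (simp_all only: star_add_left star_X_left add_diff_add right_diff_distrib)
  qed simp
  then show ?thesis
    by simp
qed

end

section \<open>Symmetrization\<close>

text \<open>The coefficients of a linear form are its derivatives. They are thus independent of the
  chosen representation, and any finite index set containing \<open>vars v\<close> may be
  used.\<close>

lemma V_pderiv1_const:
  assumes "v \<in> V"
  obtains \<kappa> where "\<And>i. pderiv1 i v = const (\<kappa> i)"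
    and "\<And>S. finite S \<Longrightarrow> vars v \<subseteq> S \<Longrightarrow> v = (\<Sum>i\<in>S. const (\<kappa> i) * var i)"
proof -
  from assms obtain T c where T: "finite T" "v = (\<Sum>i\<in>T. const (c i) * var i)"
    by (auto simp: V_def)
  define \<kappa> where "\<kappa> i = (if i \<in> T then c i else 0)" for i
  have d: "pderiv1 i v = const (\<kappa> i)" for i
    using T(1) by (simp add: T(2) pderiv1_sum pderiv1_var \<kappa>_def if_distrib[of "(*) _"] cong: if_cong)
  have "v = (\<Sum>i\<in>S. const (\<kappa> i) * var i)" if "finite S" "vars v \<subseteq> S" for S
  proof -
    have "v = (\<Sum>i\<in>T \<union> S. const (\<kappa> i) * var i)"
      using T that by (subst T(2), intro sum.mono_neutral_cong_left) (auto simp: \<kappa>_def)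
    also have "\<dots> = (\<Sum>i\<in>S. const (\<kappa> i) * var i)"
    proof (intro sum.mono_neutral_right ballI)
      fix i assume "i \<in> T \<union> S - S"
      then have "const (\<kappa> i) = (0 :: ('a, 'b) mpol)"
        using d[of i] pderiv1_eq_0[OF that(2), of i] by simp
      then show "const (\<kappa> i) * var i = (0 :: ('a, 'b) mpol)"
        by simp
    qed (use T that in auto)
    finally show ?thesis .
  qed
  with d show ?thesis
    using that by blast
qed

lemma pderiv1_prod:
  fixes a :: "'a \<Rightarrow> ('i, 'k::field_char_0) mpol"
  assumes "finite K"
  shows "pderiv1 i (\<Prod>k\<in>K. a k) = (\<Sum>k\<in>K. pderiv1 i (a k) * (\<Prod>j\<in>K - {k}. a j))"
  using assms
proof (induction K)
  case (insert x K)
  have "(\<Sum>k\<in>K. pderiv1 i (a k) * (\<Prod>j\<in>insert x K - {k}. a j)) =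
      (\<Sum>k\<in>K. a x * (pderiv1 i (a k) * (\<Prod>j\<in>K - {k}. a j)))"
  proof (rule sum.cong[OF refl])
    fix k assume "k \<in> K"
    with insert.hyps have "insert x K - {k} = insert x (K - {k})" "x \<notin> K - {k}"
      by auto
    then show "pderiv1 i (a k) * (\<Prod>j\<in>insert x K - {k}. a j) = a x * (pderiv1 i (a k) * (\<Prod>j\<in>K - {k}. a j))"
      using insert.hyps by (simp add: mult_ac)
  qed
  then show ?case
    using insert by (simp add: pderiv1_mult sum_distrib_left add.commute)
qed simp

lemma sum_antisym:
  fixes G :: "'a \<Rightarrow> 'a \<Rightarrow> ('i, 'k::field_char_0) mpol"
  assumes "\<And>a b. G a b = - G b a"
  shows "(\<Sum>a\<in>S. \<Sum>b\<in>S. G a b) = 0"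
proof (rule half_double)
  have "(\<Sum>a\<in>S. \<Sum>b\<in>S. G a b) = (\<Sum>a\<in>S. \<Sum>b\<in>S. - G a b)"
    by (subst sum.swap) (intro sum.cong refl assms)
  then show "(\<Sum>a\<in>S. \<Sum>b\<in>S. G a b) + (\<Sum>a\<in>S. \<Sum>b\<in>S. G a b) = 0"
    by (simp only: sum_negf eq_neg_iff_add_eq_0)
qed

text \<open>
  Since \<open>a\<^sub>k = \<Sum>\<^sub>i (\<partial>\<^sup>i a\<^sub>k) x\<^sub>i\<close> with constant coefficients, the sum over \<open>k\<close> equals
  \<open>\<Sum>\<^sub>i p(x\<^sub>i, \<partial>\<^sup>i F)\<close> for \<open>F = \<Prod>\<^sub>k a\<^sub>k\<close>.
\<close>

lemma polarization:
  fixes p :: "('i, 'k::field_char_0) mpol \<Rightarrow> ('i, 'k) mpol \<Rightarrow> ('i, 'k) mpol"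
  assumes p: "bilin p"
    and euler: "\<And>F S. finite S \<Longrightarrow> vars F \<subseteq> S \<Longrightarrow> (\<Sum>i\<in>S. p (var i) (pderiv1 i F)) = 0"
    and K: "finite K" "\<And>k. k \<in> K \<Longrightarrow> a k \<in> V"
  shows "(\<Sum>k\<in>K. p (a k) (\<Prod>j\<in>K - {k}. a j)) = 0"
proof -
  define F where "F = (\<Prod>k\<in>K. a k)"
  define S where "S = vars F \<union> (\<Union>k\<in>K. vars (a k))"
  have S: "finite S" "vars F \<subseteq> S" "\<And>k. k \<in> K \<Longrightarrow> vars (a k) \<subseteq> S"
    using K by (auto simp: S_def)
  have "0 = (\<Sum>i\<in>S. p (var i) (pderiv1 i F))"
    using euler[OF S(1,2)] by simp
  also have "\<dots> = (\<Sum>k\<in>K. \<Sum>i\<in>S. p (var i) (pderiv1 i (a k) * (\<Prod>j\<in>K - {k}. a j)))"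
    unfolding F_def pderiv1_prod[OF K(1)] bilin_sum_right[OF p] by (rule sum.swap)
  also have "\<dots> = (\<Sum>k\<in>K. p (a k) (\<Prod>j\<in>K - {k}. a j))"
  proof (rule sum.cong[OF refl])
    fix k assume k: "k \<in> K"
    obtain \<kappa> where \<kappa>: "\<And>i. pderiv1 i (a k) = const (\<kappa> i)"
      and a: "\<And>S. finite S \<Longrightarrow> vars (a k) \<subseteq> S \<Longrightarrow> a k = (\<Sum>i\<in>S. const (\<kappa> i) * var i)"
      using V_pderiv1_const[OF K(2)[OF k]] by blast
    have "p (a k) q = (\<Sum>i\<in>S. const (\<kappa> i) * p (var i) q)" for q
      by (subst a[OF S(1) S(3)[OF k]]) (simp only: bilin_sum_left[OF p] bilin_const_left[OF p])
    then show "(\<Sum>i\<in>S. p (var i) (pderiv1 i (a k) * (\<Prod>j\<in>K - {k}. a j))) = p (a k) (\<Prod>j\<in>K - {k}. a j)"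
      by (simp add: \<kappa> bilin_const_right[OF p])
  qed
  finally show ?thesis ..
qed

lemma fps_const_sum: "fps_const (\<Sum>a\<in>A. f a) = (\<Sum>a\<in>A. fps_const (f a :: 'a::comm_ring_1))"
  by (induction A rule: infinite_finite_induct) (simp_all flip: fps_const_add)

lemma vars_1 [simp]: "vars (1 :: ('i, 'k::comm_semiring_1) mpol) = {}"
  by (simp add: vars_def)

text \<open>Permutations are grouped by their first entry \<open>k\<close>. By induction the
  remaining factors sum to a multiple of the product over \<open>K - {k}\<close>, free of
  \<open>h\<close>; multiplying by \<open>a k\<close> produces corrections that
  \<open>polarization\<close> annihilates. Permuting indices instead of elements allows repeated
  factors. The equality is exact, not only modulo \<open>h^4\<close>.\<close>

lemma star_symmetrization_prod:
  fixes p1 p2 p3 :: "('i, 'k::field_char_0) mpol \<Rightarrow> ('i, 'k) mpol \<Rightarrow> ('i, 'k) mpol"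
  assumes bilin: "bilin p1" "bilin p2" "bilin p3"
    and euler: "\<And>F S. finite S \<Longrightarrow> vars F \<subseteq> S \<Longrightarrow> (\<Sum>i\<in>S. p1 (var i) (pderiv1 i F)) = 0"
      "\<And>F S. finite S \<Longrightarrow> vars F \<subseteq> S \<Longrightarrow> (\<Sum>i\<in>S. p2 (var i) (pderiv1 i F)) = 0"
      "\<And>F S. finite S \<Longrightarrow> vars F \<subseteq> S \<Longrightarrow> (\<Sum>i\<in>S. p3 (var i) (pderiv1 i F)) = 0"
    and K: "finite K" "\<And>k. k \<in> K \<Longrightarrow> a k \<in> V"
  shows "(\<Sum>xs\<in>permutations_of_set K. foldr (star p1 p2 p3) (map (\<lambda>k. fps_const (a k)) xs) 1) =
    fps_const (const (fact (card K)) * (\<Prod>k\<in>K. a k))"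
  using K
proof (induction "card K" arbitrary: K)
  case 0
  then show ?case
    by simp
next
  case (Suc n K)
  let ?S = "star p1 p2 p3"
  let ?f = "\<lambda>xs. foldr ?S (map (\<lambda>k. fps_const (a k)) xs) 1"
  let ?Q = "\<lambda>k. \<Prod>j\<in>K - {k}. a j"
  have ne: "K \<noteq> {}"
    using Suc.hyps(2) by auto
  have IH: "(\<Sum>xs\<in>permutations_of_set (K - {k}). ?f xs) = fps_const (const (fact n) * ?Q k)" if "k \<in> K" for k
  proof -
    have "n = card (K - {k})"
      using that Suc.hyps(2) Suc.prems(1) by simp
    with Suc.hyps(1)[OF this] Suc.prems show ?thesis
      by simp
  qed
  have "(\<Sum>xs\<in>permutations_of_set K. ?f xs) =
      (\<Sum>k\<in>K. \<Sum>xs\<in>(#) k ` permutations_of_set (K - {k}). ?f xs)"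
    unfolding permutations_of_set_nonempty[OF ne]
    by (rule sum.UNION_disjoint) (use Suc.prems(1) in auto)
  also have "\<dots> = (\<Sum>k\<in>K. ?S (fps_const (a k)) (\<Sum>xs\<in>permutations_of_set (K - {k}). ?f xs))"
    by (intro sum.cong refl) (simp add: sum.reindex star_sum_right[OF bilin])
  also have "\<dots> = (\<Sum>k\<in>K. ?S (fps_const (a k)) (fps_const (const (fact n) * ?Q k)))"
    by (intro sum.cong refl) (simp only: IH)
  also have "\<dots> = fps_const (\<Sum>k\<in>K. const (fact n) * (a k * ?Q k))
      + fps_X * fps_const (const (fact n) * (\<Sum>k\<in>K. p1 (a k) (?Q k)))
      + fps_X ^ 2 * fps_const (const (fact n) * (\<Sum>k\<in>K. p2 (a k) (?Q k)))
      + fps_X ^ 3 * fps_const (const (fact n) * (\<Sum>k\<in>K. p3 (a k) (?Q k)))"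
    unfolding star_const[OF bilin] bilin_const_right[OF bilin(1)] bilin_const_right[OF bilin(2)]
      bilin_const_right[OF bilin(3)] sum.distrib sum_distrib_left fps_const_sum
    by (simp only: mult.left_commute)
  also have "(\<Sum>k\<in>K. p1 (a k) (?Q k)) = 0"
    by (rule polarization[OF bilin(1) euler(1) Suc.prems])
  also have "(\<Sum>k\<in>K. p2 (a k) (?Q k)) = 0"
    by (rule polarization[OF bilin(2) euler(2) Suc.prems])
  also have "(\<Sum>k\<in>K. p3 (a k) (?Q k)) = 0"
    by (rule polarization[OF bilin(3) euler(3) Suc.prems])
  also have "(\<Sum>k\<in>K. const (fact n) * (a k * ?Q k)) = (\<Sum>k\<in>K. const (fact n) * (\<Prod>k\<in>K. a k))"
    by (intro sum.cong refl) (simp add: prod.remove[OF Suc.prems(1)])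
  also have "\<dots> = const (fact (card K)) * (\<Prod>k\<in>K. a k)"
    unfolding Suc.hyps(2)[symmetric] fact_Suc const_mult const_of_nat
    by (simp add: Suc.hyps(2)[symmetric] mult.assoc)
  finally show ?case
    by simp
qed

text \<open>Only one inclusion is checked directly; the finite sets then agree by counting.\<close>

lemma sum_permutes_eq_permutations_of_set:
  "(\<Sum>p | p permutes {..<n}. f (map p [0..<n])) = (\<Sum>xs\<in>permutations_of_set {..<n}. f xs)"
proof -
  let ?g = "\<lambda>p. map p [0..<n]"
  have inj: "inj_on ?g {p. p permutes {..<n}}"
  proof (rule inj_onI, rule ext)
    fix p q :: "nat \<Rightarrow> nat" and i
    assume *: "p \<in> {p. p permutes {..<n}}" "q \<in> {p. p permutes {..<n}}" "?g p = ?g q"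
    then show "p i = q i"
      by (cases "i < n") (auto simp: permutes_not_in)
  qed
  have sub: "?g ` {p. p permutes {..<n}} \<subseteq> permutations_of_set {..<n}"
  proof safe
    fix p assume p: "p permutes {..<n}"
    show "?g p \<in> permutations_of_set {..<n}"
    proof (rule permutations_of_setI)
      show "set (?g p) = {..<n}"
        using permutes_image[OF p] by (simp add: atLeast0LessThan)
      show "distinct (?g p)"
        using permutes_inj_on[OF p] by (simp add: distinct_map)
    qed
  qed
  have "?g ` {p. p permutes {..<n}} = permutations_of_set {..<n}"
    by (rule card_subset_eq[OF _ sub]) (simp_all add: card_image[OF inj] card_permutations)
  then show ?thesis
    using sum.reindex[OF inj, of f] by simp
qed

context poisson
begin

text \<open>For a power of a linear form \<open>a\<close> this says that
  \<open>star_coeff1 B a (a ^ n)\<close> vanishes. Here, and likewise for the other two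
  coefficients, \<open>i\<close> is a lower index of an \<open>X\<close> whose other lower index is
  also contracted with a derivative of \<open>F\<close>: an antisymmetric pair meets commuting
  derivatives.\<close>

lemma euler_p1:
  assumes "finite S" "vars F \<subseteq> S"
  shows "(\<Sum>i\<in>S. star_coeff1 B (var i) (pderiv1 i F)) = 0"
proof -
  have v: "vars (pderiv1 i F) \<subseteq> S" for i
    by (rule order.trans[OF vars_pderiv1 assms(2)])
  have "(\<Sum>i\<in>S. \<Sum>j\<in>S. Xv i j * pderiv1 j (pderiv1 i F)) = 0"
  proof (rule sum_antisym)
    show "Xv i j * pderiv1 j (pderiv1 i F) = - (Xv j i * pderiv1 i (pderiv1 j F))" for i j
      by (subst B_anti) (simp add: pderiv1_commute)
  qed
  then show ?thesis
    by (simp add: p1_eq B_expand_right[OF assms(1) v] flip: sum_distrib_left)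
qed

lemma euler_p2:
  assumes "finite S" "vars F \<subseteq> S"
  shows "(\<Sum>i\<in>S. star_coeff2 B (var i) (pderiv1 i F)) = 0"
proof (rule numeral_mult_cancel[where n = "num.Bit0 (num.Bit0 (num.Bit0 (num.Bit1 num.One)))"])
  have v: "vars (pderiv1 i F) \<subseteq> S" for i
    by (rule order.trans[OF vars_pderiv1 assms(2)])
  have "(\<Sum>i\<in>S. N i (pderiv1 i F)) = (\<Sum>i\<in>S. \<Sum>b\<in>S. \<Sum>c\<in>S. P i b c * pderiv1 c (pderiv1 b (pderiv1 i F)))"
    by (simp add: N_expand[OF assms(1) v])
  also have "\<dots> = 0"
  proof (rule sum_antisym)
    fix i b
    have "P i b c * pderiv1 c (pderiv1 b (pderiv1 i F)) = - (P b i c * pderiv1 c (pderiv1 i (pderiv1 b F)))" for c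
      by (subst B_anti[of "var i"]) (simp add: B_uminus_left pderiv1_commute)
    then show "(\<Sum>c\<in>S. P i b c * pderiv1 c (pderiv1 b (pderiv1 i F))) =
        - (\<Sum>c\<in>S. P b i c * pderiv1 c (pderiv1 i (pderiv1 b F)))"
      by (simp add: sum_negf)
  qed
  finally show "24 * (\<Sum>i\<in>S. star_coeff2 B (var i) (pderiv1 i F)) = 24 * 0"
    by (simp only: sum_distrib_left p2_var_left) (simp flip: sum_distrib_left)
qed

lemma euler_p3:
  assumes "finite S" "vars F \<subseteq> S"
  shows "(\<Sum>i\<in>S. star_coeff3 B (var i) (pderiv1 i F)) = 0"
proof (rule numeral_mult_cancel[where n = "num.Bit0 (num.Bit0 (num.Bit0 (num.Bit0 (num.Bit1 num.One))))"])
  have v: "vars (pderiv1 i F) \<subseteq> S" for i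
    by (rule order.trans[OF vars_pderiv1 assms(2)])
  have 1: "(\<Sum>i\<in>S. con2 S (pderiv1 i F) (\<lambda>b c. - 2 * N b (Xv c i))) = 0"
  proof -
    have "(\<Sum>i\<in>S. con2 S (pderiv1 i F) (\<lambda>b c. - 2 * N b (Xv c i))) =
        (\<Sum>i\<in>S. \<Sum>c\<in>S. \<Sum>b\<in>S. - 2 * N b (Xv c i) * D [b, c, i] F)"
      unfolding con2_def by (simp only: D_simps) (intro sum.cong refl sum.swap)
    also have "\<dots> = 0"
    proof (rule sum_antisym)
      fix i c
      have "N b (- u) = - N b u" for b u
        using N_const_mult[of b "- 1" u] by (simp add: const_def single_uminus)
      then have "- 2 * N b (Xv c i) * D [b, c, i] F = - (- 2 * N b (Xv i c) * D [b, i, c] F)" for b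
        by (subst B_anti) (simp add: pderiv1_commute)
      then show "(\<Sum>b\<in>S. - 2 * N b (Xv c i) * D [b, c, i] F) = - (\<Sum>b\<in>S. - 2 * N b (Xv i c) * D [b, i, c] F)"
        by (simp only: sum_negf)
    qed
    finally show ?thesis .
  qed
  have 2: "(\<Sum>i\<in>S. con3 S (pderiv1 i F) (\<lambda>b c d. Y c d (Xv i b))) = 0"
    unfolding con3_def
  proof (rule sum_antisym)
    fix i b
    have "Y c d (Xv i b) * D [b, c, d] (pderiv1 i F) = - (Y c d (Xv b i) * D [i, c, d] (pderiv1 b F))" for c d
      by (subst B_anti) (simp add: Y_def B_uminus_left Z_uminus pderiv1_commute algebra_simps)
    then show "(\<Sum>c\<in>S. \<Sum>d\<in>S. Y c d (Xv i b) * D [b, c, d] (pderiv1 i F)) =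
        - (\<Sum>c\<in>S. \<Sum>d\<in>S. Y c d (Xv b i) * D [i, c, d] (pderiv1 b F))"
      by (simp only: sum_negf)
  qed
  have "48 * (\<Sum>i\<in>S. star_coeff3 B (var i) (pderiv1 i F)) =
      (\<Sum>i\<in>S. con2 S (pderiv1 i F) (\<lambda>b c. - 2 * N b (Xv c i)) + con3 S (pderiv1 i F) (\<lambda>b c d. Y c d (Xv i b)))"
    unfolding sum_distrib_left by (intro sum.cong refl p3_var_left assms(1) v)
  then show "48 * (\<Sum>i\<in>S. star_coeff3 B (var i) (pderiv1 i F)) = 48 * 0"
    unfolding sum.distrib 1 2 by simp
qed

lemma coeff_1_left: "star_coeff1 B 1 g = 0" "star_coeff2 B 1 g = 0" "star_coeff3 B 1 g = 0"
proof -
  show "star_coeff1 B 1 g = 0"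
    by (simp add: p1_eq)
  show "star_coeff2 B 1 g = 0"
    using derivation_const[OF derivation_Z, of _ _ 1]
    by (simp add: p2_con[of "vars g"] Y_def N_def con_0)
  show "star_coeff3 B 1 g = 0"
    by (simp add: p3_con[of "vars g"] con_0)
qed

lemma coeff_1_right: "star_coeff1 B f 1 = 0" "star_coeff2 B f 1 = 0" "star_coeff3 B f 1 = 0"
  by (simp_all add: p1_eq p2_con[of "{}"] p3_con[of "vars f"])

text \<open>Every term of the second and third coefficient differentiates one of its arguments at
  least twice, which kills linear forms. The commutator of linear forms thus comes from the first
  coefficient alone.\<close>

lemma V_coeff:
  assumes "x \<in> V" "y \<in> V"
  shows "star_coeff2 B x y = 0" "star_coeff3 B x y = 0"
proof -
  have con: "con2 S v F = 0" "con3 S v G = 0" if "v \<in> V" for S F G and v :: "('i, 'k) mpol"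
  proof -
    obtain \<kappa> where "\<And>i. pderiv1 i v = const (\<kappa> i)"
      using V_pderiv1_const[OF \<open>v \<in> V\<close>] by blast
    then show "con2 S v F = 0" "con3 S v G = 0"
      by (simp_all add: con2_def con3_def)
  qed
  have "N b x = 0" for b
    using N_con2[of "vars x" x b] con[OF assms(1)] by simp
  then show "star_coeff2 B x y = 0"
    by (simp add: p2_con[of "vars y"] con[OF assms(2)] con_0)
  show "star_coeff3 B x y = 0"
    by (simp add: p3_con[of "vars x \<union> vars y"] con[OF assms(1)] con[OF assms(2)] con_0)
qed

abbreviation (input) star_B (infixl "\<star>" 70) where
  "F \<star> G \<equiv> star (star_coeff1 B) (star_coeff2 B) (star_coeff3 B) F G"

lemmas bilin_coeff = bilin_p1 bilin_p2 bilin_p3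

lemma third_order_deformation_star:
  "third_order_deformation (star_coeff1 B) (star_coeff2 B) (star_coeff3 B)"
proof -
  have "fps_X ^ 4 dvd F \<star> G \<star> H - F \<star> (G \<star> H)" for F G H
  proof (rule associator_from_var[OF bilin_coeff coeff_1_left])
    fix i and g h :: "('i, 'k) mpol"
    have S: "finite ({i} \<union> vars g \<union> vars h)" "i \<in> {i} \<union> vars g \<union> vars h"
      "vars g \<subseteq> {i} \<union> vars g \<union> vars h" "vars h \<subseteq> {i} \<union> vars g \<union> vars h"
      by auto
    show "fps_X ^ 4 dvd fps_const (var i) \<star> fps_const g \<star> fps_const h -
        fps_const (var i) \<star> (fps_const g \<star> fps_const h)"
      by (rule associator_const[OF bilin_coeff associative_order1 associative_order2
            associative_order3[OF S]])
  qed
  then show ?thesis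
    by (simp add: third_order_deformation_def bilin_coeff eq_h4_def)
qed

lemma bracket_exact_star: "bracket_exact B (star (star_coeff1 B) (star_coeff2 B) (star_coeff3 B))"
  unfolding bracket_exact_def
proof (intro ballI)
  fix x y :: "('i, 'k) mpol" assume V: "x \<in> V" "y \<in> V"
  have "star_coeff1 B x y - star_coeff1 B y x = 2 * (const (1 / 2) * B x y)"
    unfolding p1_eq B_anti[of y x] by (simp only: mult_minus_right diff_minus_eq_add mult_2)
  also have "\<dots> = B x y"
    by (rule const_inverse_numeral)
  finally have "star_commutator (\<star>) (fps_const x) (fps_const y) = fps_X * fps_const (B x y)"
    by (simp add: star_commutator_def star_const[OF bilin_coeff] V_coeff V mult.commute[of y x]
        flip: right_diff_distrib)
  then show "star_commutator (\<star>) (fps_const x) (fps_const y) \<approx> fps_X * fps_const (B x y)"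
    by (simp add: eq_h4_def)
qed

lemma star_unit_1: "star_unit (\<star>) 1"
proof -
  have "ext p 1 F = 0" if "bilin p" "\<And>f. p 1 f = 0"
    for F and p :: "('i, 'k) mpol \<Rightarrow> ('i, 'k) mpol \<Rightarrow> ('i, 'k) mpol"
    using ext_const_left[OF that(1), of 1 F] that(2) by (auto intro!: fps_ext)
  moreover have "ext p F 1 = 0" if "bilin p" "\<And>f. p f 1 = 0"
    for F and p :: "('i, 'k) mpol \<Rightarrow> ('i, 'k) mpol \<Rightarrow> ('i, 'k) mpol"
    using ext_const_right[OF that(1), of F 1] that(2) by (auto intro!: fps_ext)
  moreover have "ext (*) 1 F = F" "ext (*) F 1 = F" for F :: "('i, 'k) mpol fps"
    using ext_const_left[OF bilin_times, of 1 F] ext_const_right[OF bilin_times, of F 1]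
    by (auto intro!: fps_ext)
  ultimately show ?thesis
    by (simp add: star_unit_def eq_h4_def star_def bilin_coeff coeff_1_left coeff_1_right)
qed

lemma star_symmetrization_id: "star_symmetrization (\<star>) (\<lambda>F. F)"
  unfolding star_symmetrization_def
proof (intro conjI allI exI[of _ 1] impI star_unit_1)
  fix as :: "('i, 'k) mpol list"
  assume as: "set as \<subseteq> V"
  let ?n = "length as"
  have "(\<Sum>p | p permutes {..<?n}. foldr (\<star>) (map (\<lambda>i. fps_const (as ! p i)) [0..<?n]) 1) =
      (\<Sum>p | p permutes {..<?n}. foldr (\<star>) (map (\<lambda>k. fps_const (as ! k)) (map p [0..<?n])) 1)"
    by (simp add: comp_def)
  also have "\<dots> = (\<Sum>xs\<in>permutations_of_set {..<?n}. foldr (\<star>) (map (\<lambda>k. fps_const (as ! k)) xs) 1)"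
    by (rule sum_permutes_eq_permutations_of_set)
  also have "\<dots> = fps_const (const (fact (card {..<?n})) * (\<Prod>k<?n. as ! k))"
    by (rule star_symmetrization_prod[OF bilin_coeff euler_p1 euler_p2 euler_p3]) (use as in auto)
  also have "(\<Prod>k<?n. as ! k) = prod_list as"
    by (simp add: prod.list_conv_set_nth atLeast0LessThan)
  finally have *: "(\<Sum>p | p permutes {..<?n}. foldr (\<star>) (map (\<lambda>i. fps_const (as ! p i)) [0..<?n]) 1) =
      fps_const (const (fact ?n) * prod_list as)"
    by simp
  have "scal (fps_const (1 / fact ?n :: 'k)) = fps_const (const (1 / fact ?n) :: ('i, 'k) mpol)"
    by (rule fps_ext) (simp add: scal_def)
  moreover have "const (1 / fact ?n :: 'k) * (const (fact ?n) * prod_list as) = prod_list as"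
    by (simp flip: const_mult mult.assoc)
  ultimately show "fps_const (prod_list as) \<approx> scal (fps_const (1 / fact ?n)) *
      (\<Sum>p | p permutes {..<?n}. foldr (\<star>) (map (\<lambda>i. fps_const (as ! p i)) [0..<?n]) 1)"
    unfolding * by (simp add: eq_h4_def)
qed (simp_all add: eq_h4_def)

end

theorem lemma7p7:
  fixes B :: "('i, 'k::field_char_0) mpol \<Rightarrow> ('i, 'k) mpol \<Rightarrow> ('i, 'k) mpol"
  assumes "poisson_bracket B"
  shows "third_order_deformation (star_coeff1 B) (star_coeff2 B) (star_coeff3 B) \<and>
         bracket_exact B (star (star_coeff1 B) (star_coeff2 B) (star_coeff3 B)) \<and>
         balanced (star (star_coeff1 B) (star_coeff2 B) (star_coeff3 B))"
proof -
  interpret poisson B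
    by unfold_locales (rule assms)
  \<comment> \<open>With the identity as \<open>\<sigma>\<close>, \<open>s_balanced\<close> holds
    for every bound on the degree, in particular for \<open>commutator_degree\<close>.\<close>
  have "balanced (star (star_coeff1 B) (star_coeff2 B) (star_coeff3 B))"
    unfolding balanced_def s_balanced_def using star_symmetrization_id by (auto simp: eq_h4_def)
  then show ?thesis
    using third_order_deformation_star bracket_exact_star by blast
qed

end
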